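(* Let $d>0$ be a real number, let $W:[0,1]^2\to[-d,d]$ be a symmetric measurable function, and let $f=t(\cdot,W)$. Then the following are equivalent: (a) there is a $[-d,d]$-weighted graph $H$ such that $f(F)=t(F,H)$ for all multigraphs $F$; (b) both $C(f)$ and $E(f)$ have finite rank; (c) both $B(f)$ and $C(f)$ have finite rank; (d) $M(f,2)$ has finite rank.
   Context: A multigraph is a finite undirected graph in which multiple edges are allowed and loops are excluded. A graph parameter is a real-valued function on multigraphs that is invariant under isomorphism. For a bounded symmetric measurable $W:[0,1]^2\to\mathbb{R}$ and a multigraph $F$, $$t(F,W)=\int_{[0,1]^{V(F)}}\prod_{ij\in E(F)}W(x_i,x_j)\,dx,$$ edges being counted with multiplicity. A weighted graph $H$ is a finite nonempty node set $V(H)$ together with positive real nodeweights $\alpha_i$ and real edgeweights $\beta_{ij}=\beta_{ji}$ ($i,j\in V(H)$, $i=j$ allowed). It is a $[-d,d]$-weighted graph if all $\beta_{ij}\in[-d,d]$. For a multigraph $F$, $$t(F,H)=\Bigl(\sum_{i}\alpha_i\Bigr)^{-|V(F)|}\sum_{\varphi:V(F)\to V(H)}\ \prod_{i\in V(F)}\alpha_{\varphi(i)}\prod_{ij\in E(F)}\beta_{\varphi(i)\varphi(j)} .$$ Let $K_2^n$ be the multigraph with two nodes joined by $n$ parallel edges, $C_n$ the $n$-cycle (with $C_2=K_2^2$), and $K_{a,b}$ the complete bipartite graph with color classes of sizes $a$ and $b$. For a graph parameter $f$ define the infinite matrices $E(f)_{ij}=f(K_2^{i+j})$ $(i,j\ge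 0)$, $C(f)_{ij}=f(C_{i+j})$ $(i,j\ge 1)$, $B(f)_{ij}=f(K_{i+j,2})$ $(i,j\ge 0)$. Let $\mathcal{G}_2$ be the set of (isomorphism types of) multigraphs in which two different nodes are labeled $1,2$, with any number of further unlabeled nodes. The product $F_1F_2$ of $F_1,F_2\in\mathcal{G}_2$ is obtained by taking their disjoint union and identifying nodes with identical labels, keeping all edges with multiplicity. $M(f,2)$ is the infinite matrix with rows and columns indexed by $\mathcal{G}_2$ and entries $M(f,2)_{F_1,F_2}=f(F_1F_2)$. *)

theory Defs
  imports "HOL-Analysis.Analysis" "HOL-Library.Multiset" "HOL-Library.Function_Algebras"
begin

text \<open>A multigraph has a finite set of natural numbers as nodes and a multiset of two-element
  subsets of it as edges; every isomorphism type of finite loopless multigraphs is represented.\<close>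

record multigraph =
  nodes :: "nat set"
  edges :: "nat set multiset"

definition is_multigraph :: "multigraph \<Rightarrow> bool" where
  "is_multigraph F \<longleftrightarrow>
     finite (nodes F) \<and> (\<forall>e \<in># edges F. e \<subseteq> nodes F \<and> card e = 2)"

text \<open>The endpoints of an edge \<open>e = {i, j}\<close> are \<open>Min e\<close> and \<open>Max e\<close>; in both homomorphism
  densities below the order is immaterial, because \<open>W\<close> and the edgeweights are symmetric.

  The completed product of the uniform measures on \<open>[0,1]\<close> is Lebesgue measure on the cube
  \<open>[0,1]\<^sup>V\<close>. The completion is needed, as \<open>W\<close> is only assumed to be Lebesgue measurable: the
  integrand need not be measurable for the uncompleted product.\<close>

definition t_kernel :: "multigraph \<Rightarrow> (real \<Rightarrow> real \<Rightarrow> real) \<Rightarrow> real" where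
  "t_kernel F W =
     (LINT x | completion (\<Pi>\<^sub>M i \<in> nodes F. restrict_space lborel {0..1}).
        (\<Prod>e \<in># edges F. W (x (Min e)) (x (Max e))))"

record weighted_graph =
  wnodes :: "nat set"
  nodeweight :: "nat \<Rightarrow> real"
  edgeweight :: "nat \<Rightarrow> nat \<Rightarrow> real"

definition is_weighted_graph :: "weighted_graph \<Rightarrow> bool" where
  "is_weighted_graph H \<longleftrightarrow>
     finite (wnodes H) \<and> wnodes H \<noteq> {} \<and>
     (\<forall>i \<in> wnodes H. nodeweight H i > 0) \<and>
     (\<forall>i \<in> wnodes H. \<forall>j \<in> wnodes H. edgeweight H i j = edgeweight H j i)"

definition is_bounded_weighted_graph :: "real \<Rightarrow> weighted_graph \<Rightarrow> bool" where
  "is_bounded_weighted_graph d H \<longleftrightarrow>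
     is_weighted_graph H \<and>
     (\<forall>i \<in> wnodes H. \<forall>j \<in> wnodes H. edgeweight H i j \<in> {-d..d})"

definition t_weighted :: "multigraph \<Rightarrow> weighted_graph \<Rightarrow> real" where
  "t_weighted F H =
     (\<Sum>i \<in> wnodes H. nodeweight H i) powi (- int (card (nodes F))) *
     (\<Sum>\<phi> \<in> nodes F \<rightarrow>\<^sub>E wnodes H.
        (\<Prod>i \<in> nodes F. nodeweight H (\<phi> i)) *
        (\<Prod>e \<in># edges F. edgeweight H (\<phi> (Min e)) (\<phi> (Max e))))"

definition parallel_edges :: "nat \<Rightarrow> multigraph" where
  "parallel_edges n = \<lparr>nodes = {0, 1}, edges = replicate_mset n {0, 1}\<rparr>"

text \<open>For \<open>n = 2\<close> the edge \<open>{0, 1}\<close> occurs twice, so that this is two parallel edges.\<close>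

definition cycle_graph :: "nat \<Rightarrow> multigraph" where
  "cycle_graph n =
     \<lparr>nodes = {..<n}, edges = image_mset (\<lambda>i. {i, (i + 1) mod n}) (mset_set {..<n})\<rparr>"

definition complete_bipartite :: "nat \<Rightarrow> nat \<Rightarrow> multigraph" where
  "complete_bipartite a b =
     \<lparr>nodes = {..<a + b},
      edges = image_mset (\<lambda>(i, j). {i, j}) (mset_set ({..<a} \<times> {a..<a + b}))\<rparr>"

text \<open>In a 2-labeled multigraph the nodes \<open>1\<close> and \<open>2\<close> carry the labels \<open>1\<close> and \<open>2\<close>. The set below
  contains every isomorphism type, in several copies; isomorphic copies only duplicate rows and
  columns of the connection matrix of an isomorphism-invariant parameter.\<close>

definition two_labeled :: "multigraph set" where
  "two_labeled = {F. is_multigraph F \<and> {1, 2} \<subseteq> nodes F}"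

definition rename_nodes :: "(nat \<Rightarrow> nat) \<Rightarrow> multigraph \<Rightarrow> multigraph" where
  "rename_nodes g F = \<lparr>nodes = g ` nodes F, edges = image_mset ((`) g) (edges F)\<rparr>"

text \<open>The unlabeled nodes of the two factors are sent to odd and to even numbers above \<open>2\<close>,
  which makes them disjoint from each other and from the shared labeled nodes.\<close>

definition glue :: "multigraph \<Rightarrow> multigraph \<Rightarrow> multigraph" where
  "glue F\<^sub>1 F\<^sub>2 =
     (let G\<^sub>1 = rename_nodes (\<lambda>v. if v \<in> {1, 2} then v else 2 * v + 3) F\<^sub>1;
          G\<^sub>2 = rename_nodes (\<lambda>v. if v \<in> {1, 2} then v else 2 * v + 4) F\<^sub>2
      in \<lparr>nodes = nodes G\<^sub>1 \<union> nodes G\<^sub>2, edges = edges G\<^sub>1 + edges G\<^sub>2\<rparr>)"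

definition E_matrix :: "(multigraph \<Rightarrow> real) \<Rightarrow> nat \<Rightarrow> nat \<Rightarrow> real" where
  "E_matrix f i j = f (parallel_edges (i + j))"

definition C_matrix :: "(multigraph \<Rightarrow> real) \<Rightarrow> nat \<Rightarrow> nat \<Rightarrow> real" where
  "C_matrix f i j = f (cycle_graph (i + j))"

definition B_matrix :: "(multigraph \<Rightarrow> real) \<Rightarrow> nat \<Rightarrow> nat \<Rightarrow> real" where
  "B_matrix f i j = f (complete_bipartite (i + j) 2)"

definition M2_matrix :: "(multigraph \<Rightarrow> real) \<Rightarrow> multigraph \<Rightarrow> multigraph \<Rightarrow> real" where
  "M2_matrix f F\<^sub>1 F\<^sub>2 = f (glue F\<^sub>1 F\<^sub>2)"

global_interpretation fun_space: vector_space "\<lambda>(c::real) (v::'j \<Rightarrow> real) j. c * v j"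
  by unfold_locales (auto simp: fun_eq_iff algebra_simps)

text \<open>Finite rank of the matrix \<open>A\<close> with rows indexed by \<open>I\<close> and columns by \<open>J\<close>: the row space is
  finite-dimensional. Rows are extended by \<open>0\<close> outside \<open>J\<close>.\<close>

definition finite_rank :: "'i set \<Rightarrow> 'j set \<Rightarrow> ('i \<Rightarrow> 'j \<Rightarrow> real) \<Rightarrow> bool" where
  "finite_rank I J A \<longleftrightarrow>
     (\<exists>B. finite B \<and>
        fun_space.span B = fun_space.span ((\<lambda>i j. if j \<in> J then A i j else 0) ` I))"

end

theory Submission
  imports Defs "HOL-Probability.Probability" "HOL-Computational_Algebra.Polynomial"
begin

text \<open>
  Why the theorem holds. Changing \<open>W\<close> on a null set changes no density \<open>t(F, W)\<close>, so \<open>W\<close> may be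
  taken to be Borel measurable and symmetric everywhere; it is then treated as the kernel of an
  integral operator over an arbitrary probability space. Write \<open>W\<^sup>k\<close> for the operator powers and
  \<open>U = W\<^sup>2\<close>. The three matrices are Gram matrices of kernels in \<open>L\<^sup>2\<close> of the square: the entries of
  \<open>C(f)\<close>, \<open>E(f)\<close> and \<open>B(f)\<close> are the inner products of operator powers of \<open>W\<close>, of pointwise powers
  of \<open>W\<close>, and of pointwise powers of \<open>U\<close>. A linear relation between the rows of a Gram matrix is a
  linear relation between the kernels themselves (lemma \<open>gram_relation\<close>). No spectral theory is
  needed to exploit this.

  Finite rank of \<open>E(f)\<close> (of \<open>B(f)\<close>) says that some nonzero polynomial vanishes at almost all values
  of \<open>W\<close> (of \<open>U\<close>), which therefore has essentially finitely many values.

  Finite rank of \<open>C(f)\<close> says that some nonzero polynomial without constant term annihilates the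
  operator \<open>W\<close>. The operator is self-adjoint, hence has no nilpotent part, so that powers of the
  variable can be cancelled from the polynomial; the outcome is \<open>W = W\<^sup>3 t(W)\<close> for a polynomial \<open>t\<close>
  (lemmas \<open>annihilating_poly_normal_form\<close> and \<open>kernel_factorizations\<close>). Consequently
  \<open>W = W P\<close>, \<open>U = U P\<close> and \<open>W = U L\<close> for bounded kernels \<open>P\<close> and \<open>L\<close>.

  Now let \<open>V\<close> be \<open>W\<close> or \<open>U\<close>, with finitely many values and \<open>V = V P\<close> (lemma
  \<open>finitely_many_rows\<close>). If two rows of \<open>V\<close> are close in \<open>L\<^sup>1\<close>, then applying the bounded kernel
  \<open>P\<close> shows that they are uniformly close, so by finiteness of the set of values they agree almost
  everywhere. On the other hand \<open>P\<close> can be approximated in \<open>L\<^sup>1\<close> by finite sums of products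
  \<open>a(x) b(y)\<close>, and therefore the rows of \<open>V P\<close> form a totally bounded set. So \<open>V\<close> has only finitely
  many rows up to null sets. The rows of \<open>W = V L\<close> depend only on those of \<open>V\<close>, and by symmetry
  \<open>W\<close> is almost everywhere a step function.

  A step function is the same thing as a weighted graph, whose nodeweights are the measures of the
  steps. For a weighted graph the connection matrix factors through the finitely many maps of the
  labeled nodes, so \<open>M(f, 2)\<close> has finite rank; and \<open>C(f)\<close>, \<open>E(f)\<close> are submatrices of \<open>M(f, 2)\<close>, by
  gluing paths and parallel edges. Finally a step function and its square have finitely many values,
  so step functions give finite rank of both \<open>E(f)\<close> and \<open>B(f)\<close>.
\<close>

section \<open>Finite rank of infinite matrices\<close>

text \<open>The vector space operations on functions are instances of the operations on reals, so that as
  rewrite rules the following facts would match any product of reals under a \<open>\<lambda>\<close>, and interfere with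
  associativity and distributivity there.\<close>
declare fun_space.scale_scale [simp del] fun_space.scale_minus_left [simp del]
  fun_space.scale_minus_right [simp del] fun_space.scale_zero_left [simp del]
  fun_space.scale_zero_right [simp del] fun_space.scale_one [simp del]
  fun_space.scale_left_distrib [algebra_simps del, algebra_split_simps del]
  fun_space.scale_right_distrib [algebra_simps del, algebra_split_simps del]
  fun_space.scale_left_diff_distrib [algebra_simps del, algebra_split_simps del]
  fun_space.scale_right_diff_distrib [algebra_simps del, algebra_split_simps del]

lemma sum_fun_apply: "(\<Sum>k\<in>L. f k) j = (\<Sum>k\<in>L. f k j :: real)"
  by (induction L rule: infinite_finite_induct) auto

lemma finite_rankI:
  fixes A :: "'i \<Rightarrow> 'j \<Rightarrow> real"
  assumes "finite L" and A: "\<And>i j. i \<in> I \<Longrightarrow> j \<in> J \<Longrightarrow> A i j = (\<Sum>k\<in>L. u k i * v k j)"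
  shows "finite_rank I J A"
proof -
  let ?R = "(\<lambda>i j. if j \<in> J then A i j else 0) ` I"
  let ?T = "(\<lambda>k j. if j \<in> J then v k j else 0) ` L"
  have R: "?R \<subseteq> fun_space.span ?T"
  proof
    fix r assume "r \<in> ?R"
    then obtain i where i: "i \<in> I" "r = (\<lambda>j. if j \<in> J then A i j else 0)" by auto
    have "r = (\<Sum>k\<in>L. (\<lambda>j. u k i * (if j \<in> J then v k j else 0)))"
    proof (rule ext)
      fix j
      show "r j = (\<Sum>k\<in>L. (\<lambda>j. u k i * (if j \<in> J then v k j else 0))) j"
        unfolding sum_fun_apply i(2) by (cases "j \<in> J") (simp_all add: A i(1))
    qed
    also have "\<dots> \<in> fun_space.span ?T"
      by (intro fun_space.span_sum fun_space.span_scale fun_space.span_base imageI)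
    finally show "r \<in> fun_space.span ?T" .
  qed
  obtain B where B: "B \<subseteq> ?R" "fun_space.independent B" "?R \<subseteq> fun_space.span B"
    by (rule fun_space.maximal_independent_subset)
  have "finite B"
    using fun_space.independent_span_bound[OF finite_imageI[OF \<open>finite L\<close>] B(2) subset_trans[OF B(1) R]]
    by (rule conjunct1)
  moreover have "fun_space.span B = fun_space.span ?R"
    by (intro subset_antisym fun_space.span_mono B(1) fun_space.span_minimal B(3)
        fun_space.subspace_span)
  ultimately show ?thesis unfolding finite_rank_def by (intro exI conjI)
qed

text \<open>A matrix of finite rank is a product of two matrices with finite inner dimension; conversely such
  a product has finite rank by lemma \<open>finite_rankI\<close>.\<close>

lemma finite_rank_factorization:
  fixes A :: "'i \<Rightarrow> 'j \<Rightarrow> real"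
  assumes "finite_rank I J A"
  shows "\<exists>(B :: ('j \<Rightarrow> real) set) u. finite B \<and> (\<forall>i\<in>I. \<forall>j\<in>J. A i j = (\<Sum>b\<in>B. u b i * b j))"
proof -
  obtain B where B: "finite B"
      "fun_space.span B = fun_space.span ((\<lambda>i j. if j \<in> J then A i j else 0) ` I)"
    using assms unfolding finite_rank_def by (elim exE conjE)
  have ex: "\<forall>i\<in>I. \<exists>u. (\<lambda>j. if j \<in> J then A i j else 0) = (\<Sum>b\<in>B. (\<lambda>j. u b * b j))"
  proof
    fix i assume that: "i \<in> I"
    have "(\<lambda>j. if j \<in> J then A i j else 0) \<in> fun_space.span B"
      unfolding B(2) using that by (intro fun_space.span_base imageI)
    then show "\<exists>u. (\<lambda>j. if j \<in> J then A i j else 0) = (\<Sum>b\<in>B. (\<lambda>j. u b * b j))"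
      unfolding fun_space.span_finite[OF B(1)] by (elim rangeE) (rule exI)
  qed
  then obtain u where u: "\<forall>i\<in>I.
      (\<lambda>j. if j \<in> J then A i j else 0) = (\<Sum>b\<in>B. (\<lambda>j. u i b * b j))"
    using bchoice[OF ex] by (elim exE)
  have "A i j = (\<Sum>b\<in>B. u i b * b j)" if "i \<in> I" "j \<in> J" for i j
    using fun_cong[OF bspec[OF u that(1)], of j] that(2) unfolding sum_fun_apply by simp
  then show ?thesis using B(1) by (intro exI[of _ B] exI[of _ "\<lambda>b i. u i b"] conjI ballI)
qed

lemma finite_rank_submatrix:
  fixes A :: "'a \<Rightarrow> 'b \<Rightarrow> real"
  assumes "finite_rank I J A"
    and "\<And>i. i \<in> I' \<Longrightarrow> \<phi> i \<in> I" "\<And>j. j \<in> J' \<Longrightarrow> \<psi> j \<in> J"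
    and "\<And>i j. i \<in> I' \<Longrightarrow> j \<in> J' \<Longrightarrow> A' i j = A (\<phi> i) (\<psi> j)"
  shows "finite_rank I' J' A'"
proof -
  obtain B :: "('b \<Rightarrow> real) set" and u where B: "finite B"
      "\<And>i j. i \<in> I \<Longrightarrow> j \<in> J \<Longrightarrow> A i j = (\<Sum>b\<in>B. u b i * b j)"
    using finite_rank_factorization[OF assms(1)] by blast
  show ?thesis
    by (rule finite_rankI[OF B(1), where u = "\<lambda>b i. u b (\<phi> i)" and v = "\<lambda>b j. b (\<psi> j)"])
      (simp add: assms B(2))
qed

text \<open>Among more rows than the rank there is a nontrivial linear relation. Two equal rows at different
  indices are a relation as well, so the rows need not be distinct as functions.\<close>

lemma finite_rank_relation:
  fixes A :: "'i \<Rightarrow> 'j \<Rightarrow> real"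
  assumes "finite_rank I J A" "infinite I"
  obtains S c where "finite S" "S \<subseteq> I" "\<exists>i\<in>S. c i \<noteq> 0" "\<And>j. j \<in> J \<Longrightarrow> (\<Sum>i\<in>S. c i * A i j) = 0"
proof -
  define row where "row = (\<lambda>i j. if j \<in> J then A i j else 0)"
  obtain B where B: "finite B" "fun_space.span B = fun_space.span (row ` I)"
    using assms(1) unfolding finite_rank_def row_def by (elim exE conjE)
  obtain S where S: "S \<subseteq> I" "card S = Suc (card B)" "finite S"
    using assms(2) by (metis infinite_arbitrarily_large)
  show thesis
  proof (cases "inj_on row S")
    case False
    then obtain a b where ab: "a \<in> S" "b \<in> S" "a \<noteq> b" "row a = row b" by (auto simp: inj_on_def)
    have "A a j = A b j" if "j \<in> J" for j
      using fun_cong[OF ab(4), of j] that by (simp add: row_def)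
    then show thesis
      using ab S by (intro that[of "{a, b}" "\<lambda>i. if i = a then 1 else -1"]) auto
  next
    case True
    have "row ` S \<subseteq> fun_space.span B"
      unfolding B(2) by (rule subset_trans[OF image_mono[OF S(1)] fun_space.span_superset])
    then have "fun_space.dependent (row ` S)"
      using fun_space.independent_span_bound[OF B(1), of "row ` S"] S(2) card_image[OF True]
      by linarith
    then obtain u where u: "\<exists>v\<in>row ` S. u v \<noteq> 0" "(\<Sum>v\<in>row ` S. (\<lambda>j. u v * v j)) = 0"
      unfolding fun_space.dependent_finite[OF finite_imageI[OF S(3)]] by (elim exE conjE)
    have "(\<Sum>i\<in>S. u (row i) * A i j) = 0" if "j \<in> J" for j
    proof -
      have "(\<Sum>v\<in>row ` S. u v * v j) = 0"
        using fun_cong[OF u(2), of j] unfolding sum_fun_apply by simp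
      then show ?thesis using that unfolding sum.reindex[OF True] o_def by (simp add: row_def[THEN fun_cong, THEN fun_cong])
    qed
    then show thesis using u(1) S by (intro that[of S "\<lambda>i. u (row i)"]) auto
  qed
qed

section \<open>Bounded kernels on a probability space\<close>

text \<open>Everything below is integrated against probability measures, so that boundedness and
  measurability ensure integrability and the applicability of Fubini's theorem. The bound is only
  required on the space of the measure.\<close>

definition bounded_measurable :: "'a measure \<Rightarrow> ('a \<Rightarrow> real) \<Rightarrow> bool" where
  "bounded_measurable N f \<longleftrightarrow>
     f \<in> borel_measurable N \<and> (\<exists>C. \<forall>x\<in>space N. \<bar>f x\<bar> \<le> C)"

lemma bounded_measurableI:
  "f \<in> borel_measurable N \<Longrightarrow> (\<And>x. x \<in> space N \<Longrightarrow> \<bar>f x\<bar> \<le> C) \<Longrightarrow> bounded_measurable N f"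
  by (auto simp: bounded_measurable_def)

lemma bounded_measurableD: "bounded_measurable N f \<Longrightarrow> f \<in> borel_measurable N"
  by (simp add: bounded_measurable_def)

lemma bounded_measurable_bound:
  assumes "bounded_measurable N f"
  shows "\<exists>C>0. \<forall>x\<in>space N. \<bar>f x\<bar> \<le> C"
proof -
  obtain C where C: "\<forall>x\<in>space N. \<bar>f x\<bar> \<le> C" using assms by (auto simp: bounded_measurable_def)
  then show ?thesis by (intro exI[of _ "max C 1"]) (auto simp: le_max_iff_disj)
qed

lemma bounded_measurable_const [intro]: "bounded_measurable N (\<lambda>x. c)"
  by (auto intro: bounded_measurableI[where C = "\<bar>c\<bar>"])

lemma bounded_measurable_add [intro]:
  assumes "bounded_measurable N f" "bounded_measurable N g"
  shows "bounded_measurable N (\<lambda>x. f x + g x)"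
proof -
  obtain C D where "\<And>x. x \<in> space N \<Longrightarrow> \<bar>f x\<bar> \<le> C" "\<And>x. x \<in> space N \<Longrightarrow> \<bar>g x\<bar> \<le> D"
    using bounded_measurable_bound[OF assms(1)] bounded_measurable_bound[OF assms(2)] by blast
  then have b: "\<bar>f x + g x\<bar> \<le> C + D" if "x \<in> space N" for x
    using that abs_triangle_ineq[of "f x" "g x"] by (meson add_mono order_trans)
  note [measurable] = assms[THEN bounded_measurableD]
  show ?thesis by (rule bounded_measurableI[OF _ b]) measurable
qed

lemma bounded_measurable_mult [intro]:
  assumes "bounded_measurable N f" "bounded_measurable N g"
  shows "bounded_measurable N (\<lambda>x. f x * g x)"
proof -
  obtain C where C: "C > 0" "\<And>x. x \<in> space N \<Longrightarrow> \<bar>f x\<bar> \<le> C"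
    using bounded_measurable_bound[OF assms(1)] by blast
  obtain D where D: "D > 0" "\<And>x. x \<in> space N \<Longrightarrow> \<bar>g x\<bar> \<le> D"
    using bounded_measurable_bound[OF assms(2)] by blast
  have b: "\<bar>f x * g x\<bar> \<le> C * D" if "x \<in> space N" for x
    using C(1) D(1) C(2)[OF that] D(2)[OF that] by (auto simp: abs_mult intro!: mult_mono)
  note [measurable] = assms[THEN bounded_measurableD]
  show ?thesis by (rule bounded_measurableI[OF _ b]) measurable
qed

lemma bounded_measurable_diff [intro]:
  assumes "bounded_measurable N f" "bounded_measurable N g"
  shows "bounded_measurable N (\<lambda>x. f x - g x)"
  using bounded_measurable_add[OF assms(1)
      bounded_measurable_mult[OF bounded_measurable_const[of N "-1"] assms(2)]] by simp

lemma bounded_measurable_power [intro]: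
  assumes "bounded_measurable N f" shows "bounded_measurable N (\<lambda>x. f x ^ n)"
  by (induction n) (use assms in \<open>auto intro: bounded_measurable_mult\<close>)

lemma bounded_measurable_abs [intro]:
  assumes "bounded_measurable N f" shows "bounded_measurable N (\<lambda>x. \<bar>f x\<bar>)"
  using assms by (auto simp: bounded_measurable_def)

lemma bounded_measurable_sum [intro]:
  "(\<And>i. i \<in> I \<Longrightarrow> bounded_measurable N (f i)) \<Longrightarrow> bounded_measurable N (\<lambda>x. \<Sum>i\<in>I. f i x)"
  by (induction I rule: infinite_finite_induct) auto

lemma bounded_measurable_prod [intro]:
  "(\<And>i. i \<in> I \<Longrightarrow> bounded_measurable N (f i)) \<Longrightarrow> bounded_measurable N (\<lambda>x. \<Prod>i\<in>I. f i x)"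
  by (induction I rule: infinite_finite_induct) auto

lemma bounded_measurable_prod_mset:
  "(\<And>i. i \<in># I \<Longrightarrow> bounded_measurable N (f i)) \<Longrightarrow> bounded_measurable N (\<lambda>x. \<Prod>i\<in>#I. f i x)"
  by (induction I) auto

lemma bounded_measurable_compose:
  assumes "bounded_measurable N' f" "T \<in> measurable N N'"
  shows "bounded_measurable N (\<lambda>x. f (T x))"
proof -
  obtain C where "\<And>x. x \<in> space N' \<Longrightarrow> \<bar>f x\<bar> \<le> C"
    using bounded_measurable_bound[OF assms(1)] by blast
  moreover have "(\<lambda>x. f (T x)) \<in> borel_measurable N"
    using assms by (auto intro: measurable_compose dest: bounded_measurableD)
  ultimately show ?thesis
    using assms(2) by (intro bounded_measurableI[where C = C]) (auto dest: measurable_space)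
qed

lemma (in finite_measure) bounded_measurable_integrable:
  assumes "bounded_measurable M f" shows "integrable M f"
proof -
  obtain C where "\<And>x. x \<in> space M \<Longrightarrow> \<bar>f x\<bar> \<le> C" using bounded_measurable_bound[OF assms] by blast
  then show ?thesis
    using assms by (intro integrable_const_bound[where B = C]) (auto dest: bounded_measurableD)
qed

context prob_space
begin

lemma abs_integral_le:
  assumes "f \<in> borel_measurable M" "\<And>x. x \<in> space M \<Longrightarrow> \<bar>f x\<bar> \<le> (C::real)"
  shows "\<bar>\<integral>x. f x \<partial>M\<bar> \<le> C"
proof -
  have i: "integrable M f"
    by (rule bounded_measurable_integrable[OF bounded_measurableI[OF assms]])
  have "\<bar>\<integral>x. f x \<partial>M\<bar> \<le> (\<integral>x. \<bar>f x\<bar> \<partial>M)" by (rule integral_abs_bound)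
  also have "\<dots> \<le> (\<integral>x. C \<partial>M)" using i assms(2) by (intro integral_mono) auto
  also have "\<dots> = C" by (simp add: prob_space)
  finally show ?thesis .
qed

lemma bounded_measurable_integral:
  assumes "bounded_measurable (N \<Otimes>\<^sub>M M) (\<lambda>(x, y). f x y)"
  shows "bounded_measurable N (\<lambda>x. \<integral>y. f x y \<partial>M)"
proof -
  note [measurable] = bounded_measurableD[OF assms]
  obtain C where C: "\<And>p. p \<in> space (N \<Otimes>\<^sub>M M) \<Longrightarrow> \<bar>(\<lambda>(x, y). f x y) p\<bar> \<le> C"
    using bounded_measurable_bound[OF assms] by blast
  have "\<bar>\<integral>y. f x y \<partial>M\<bar> \<le> C" if [measurable]: "x \<in> space N" for x
    using that C[of "(x, _)"] by (intro abs_integral_le) (auto simp: space_pair_measure)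
  then show ?thesis by (intro bounded_measurableI) measurable
qed

text \<open>A bounded measurable kernel; only its values on the space of \<open>M\<close> matter.\<close>

definition bkernel :: "('a \<Rightarrow> 'a \<Rightarrow> real) \<Rightarrow> bool" where
  "bkernel K \<longleftrightarrow> bounded_measurable (M \<Otimes>\<^sub>M M) (\<lambda>(x, y). K x y)"

text \<open>Composition of kernels, that is, the kernel of the product of the two integral operators.\<close>

definition kcomp :: "('a \<Rightarrow> 'a \<Rightarrow> real) \<Rightarrow> ('a \<Rightarrow> 'a \<Rightarrow> real) \<Rightarrow> 'a \<Rightarrow> 'a \<Rightarrow> real" where
  "kcomp K L x y = (\<integral>z. K x z * L z y \<partial>M)"

text \<open>Equality almost everywhere, in iterated form: for almost all \<open>x\<close>, for almost all \<open>y\<close>. For bounded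
  kernels this is the same as equality almost everywhere for the product measure (lemma
  \<open>keq_pair\<close>), but it is better suited to arguments about rows.\<close>

definition keq :: "('a \<Rightarrow> 'a \<Rightarrow> real) \<Rightarrow> ('a \<Rightarrow> 'a \<Rightarrow> real) \<Rightarrow> bool" where
  "keq K L \<longleftrightarrow> (AE x in M. AE y in M. K x y = L x y)"

lemma pair_sigma_finite_self: "pair_sigma_finite M M"
  by (intro pair_sigma_finite.intro sigma_finite_measure_axioms)

lemma prob_space_pair: "prob_space (M \<Otimes>\<^sub>M M)"
proof -
  interpret P: pair_prob_space M M ..
  show ?thesis by unfold_locales
qed

lemma bounded_measurable_kernel:
  assumes "bkernel K" "a \<in> measurable N M" "b \<in> measurable N M"
  shows "bounded_measurable N (\<lambda>p. K (a p) (b p))"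
  using bounded_measurable_compose[OF assms(1)[unfolded bkernel_def], of "\<lambda>p. (a p, b p)" N] assms(2,3)
  by simp

lemma kernelI: "bounded_measurable (M \<Otimes>\<^sub>M M) (\<lambda>p. K (fst p) (snd p)) \<Longrightarrow> bkernel K"
  by (simp add: bkernel_def case_prod_beta')

lemma bounded_measurable_column: "bkernel K \<Longrightarrow> y \<in> space M \<Longrightarrow> bounded_measurable M (\<lambda>x. K x y)"
  by (rule bounded_measurable_kernel) auto

lemma bounded_measurable_row: "bkernel K \<Longrightarrow> x \<in> space M \<Longrightarrow> bounded_measurable M (\<lambda>y. K x y)"
  by (rule bounded_measurable_kernel) auto

lemma kernel_bound:
  assumes "bkernel K"
  shows "\<exists>C>0. \<forall>x\<in>space M. \<forall>y\<in>space M. \<bar>K x y\<bar> \<le> C"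
proof -
  obtain C where C: "C > 0" "\<And>p. p \<in> space (M \<Otimes>\<^sub>M M) \<Longrightarrow> \<bar>(\<lambda>(x, y). K x y) p\<bar> \<le> C"
    using bounded_measurable_bound[OF assms[unfolded bkernel_def]] by blast
  show ?thesis using C(2) C(1) by (auto simp: space_pair_measure)
qed

lemma bounded_measurable_pair: "bkernel K \<Longrightarrow> bounded_measurable (M \<Otimes>\<^sub>M M) (\<lambda>p. K (fst p) (snd p))"
  by (simp add: bkernel_def case_prod_beta')

lemma kernel_flip: "bkernel K \<Longrightarrow> bkernel (\<lambda>x y. K y x)"
  by (rule kernelI, rule bounded_measurable_kernel) auto

lemma kernel_const: "bkernel (\<lambda>x y. c)"
  by (rule kernelI, rule bounded_measurable_const)

lemma kernel_add: "bkernel K \<Longrightarrow> bkernel L \<Longrightarrow> bkernel (\<lambda>x y. K x y + L x y)"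
  by (rule kernelI, rule bounded_measurable_add; rule bounded_measurable_pair)

lemma kernel_diff: "bkernel K \<Longrightarrow> bkernel L \<Longrightarrow> bkernel (\<lambda>x y. K x y - L x y)"
  by (rule kernelI, rule bounded_measurable_diff; rule bounded_measurable_pair)

lemma kernel_mult: "bkernel K \<Longrightarrow> bkernel L \<Longrightarrow> bkernel (\<lambda>x y. K x y * L x y)"
  by (rule kernelI, rule bounded_measurable_mult; rule bounded_measurable_pair)

lemma kernel_sum: "(\<And>i. i \<in> I \<Longrightarrow> bkernel (K i)) \<Longrightarrow> bkernel (\<lambda>x y. \<Sum>i\<in>I. K i x y)"
  by (rule kernelI, rule bounded_measurable_sum, rule bounded_measurable_pair)

lemma kernel_power: "bkernel K \<Longrightarrow> bkernel (\<lambda>x y. K x y ^ n)"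
  by (rule kernelI, rule bounded_measurable_power, rule bounded_measurable_pair)

lemma kernel_comp:
  assumes "bkernel K" "bkernel L" shows "bkernel (kcomp K L)"
proof -
  have "bounded_measurable ((M \<Otimes>\<^sub>M M) \<Otimes>\<^sub>M M) (\<lambda>q. K (fst (fst q)) (snd q) * L (snd q) (snd (fst q)))"
    by (rule bounded_measurable_mult; rule bounded_measurable_kernel[OF assms(1)] bounded_measurable_kernel[OF assms(2)]) auto
  then show ?thesis
    unfolding kcomp_def by (intro kernelI bounded_measurable_integral) (simp add: case_prod_beta')
qed

lemma bounded_measurable_row_integral: "bkernel K \<Longrightarrow> bounded_measurable M (\<lambda>x. \<integral>y. K x y \<partial>M)"
  by (rule bounded_measurable_integral) (simp add: bkernel_def)

lemma kernel_integral_swap: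
  assumes "bkernel K"
  shows "(\<integral>x. \<integral>y. K x y \<partial>M \<partial>M) = (\<integral>y. \<integral>x. K x y \<partial>M \<partial>M)"
proof -
  interpret P: pair_prob_space M M ..
  have "integrable (M \<Otimes>\<^sub>M M) (case_prod K)"
    using assms by (intro P.P.bounded_measurable_integrable) (simp add: bkernel_def)
  then show ?thesis by (rule P.Fubini_integral[symmetric])
qed

lemma kernel_integral_pair:
  assumes "bkernel K"
  shows "(\<integral>x. \<integral>y. K x y \<partial>M \<partial>M) = (\<integral>p. K (fst p) (snd p) \<partial>(M \<Otimes>\<^sub>M M))"
proof -
  interpret P: pair_prob_space M M ..
  have "integrable (M \<Otimes>\<^sub>M M) (case_prod K)"
    using assms by (intro P.P.bounded_measurable_integrable) (simp add: bkernel_def)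
  from P.integral_fst[OF this] show ?thesis by (simp add: case_prod_beta')
qed

lemma integral_add_kernel:
  assumes "bkernel K" "bkernel L"
  shows "(\<integral>x. \<integral>y. K x y + L x y \<partial>M \<partial>M) = (\<integral>x. \<integral>y. K x y \<partial>M \<partial>M) + (\<integral>x. \<integral>y. L x y \<partial>M \<partial>M)"
proof -
  have "(\<integral>x. \<integral>y. K x y + L x y \<partial>M \<partial>M) = (\<integral>x. (\<integral>y. K x y \<partial>M) + (\<integral>y. L x y \<partial>M) \<partial>M)"
    using assms
    by (intro Bochner_Integration.integral_cong Bochner_Integration.integral_add
          bounded_measurable_integrable bounded_measurable_row) auto
  also have "\<dots> = (\<integral>x. \<integral>y. K x y \<partial>M \<partial>M) + (\<integral>x. \<integral>y. L x y \<partial>M \<partial>M)"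
    using assms by (intro Bochner_Integration.integral_add bounded_measurable_integrable bounded_measurable_row_integral)
  finally show ?thesis .
qed

lemma integral_sum_kernel:
  assumes "\<And>i. i \<in> I \<Longrightarrow> bkernel (K i)"
  shows "(\<integral>x. \<integral>y. (\<Sum>i\<in>I. K i x y) \<partial>M \<partial>M) = (\<Sum>i\<in>I. \<integral>x. \<integral>y. K i x y \<partial>M \<partial>M)"
  using assms
  by (induction I rule: infinite_finite_induct) (simp_all add: integral_add_kernel kernel_sum)

lemma comp_assoc:
  assumes "bkernel K" "bkernel L" "bkernel N" "x \<in> space M" "y \<in> space M"
  shows "kcomp (kcomp K L) N x y = kcomp K (kcomp L N) x y"
proof -
  have k: "bkernel (\<lambda>z w. K x w * L w z * N z y)"
    by (intro kernel_mult kernel_flip[OF assms(2)])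
       (rule kernelI, rule bounded_measurable_kernel, use assms in auto)+
  have "kcomp (kcomp K L) N x y = (\<integral>z. \<integral>w. K x w * L w z * N z y \<partial>M \<partial>M)"
    by (simp add: kcomp_def)
  also have "\<dots> = (\<integral>w. \<integral>z. K x w * L w z * N z y \<partial>M \<partial>M)"
    by (rule kernel_integral_swap[OF k])
  also have "\<dots> = kcomp K (kcomp L N) x y"
    by (simp add: kcomp_def mult.assoc)
  finally show ?thesis .
qed

lemma comp_flip: "kcomp (\<lambda>x y. L y x) (\<lambda>x y. K y x) = (\<lambda>x y. kcomp K L y x)"
  by (intro ext) (simp add: kcomp_def mult.commute)

lemma comp_cong:
  assumes "\<And>z. z \<in> space M \<Longrightarrow> K x z = K' x' z" "\<And>z. z \<in> space M \<Longrightarrow> L z y = L' z y'"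
  shows "kcomp K L x y = kcomp K' L' x' y'"
  unfolding kcomp_def using assms by (intro Bochner_Integration.integral_cong) auto

lemma integrable_comp_integrand: "bkernel K \<Longrightarrow> bkernel L \<Longrightarrow> x \<in> space M \<Longrightarrow> y \<in> space M \<Longrightarrow>
    integrable M (\<lambda>z. K x z * L z y)"
  by (intro bounded_measurable_integrable bounded_measurable_mult bounded_measurable_column bounded_measurable_row)

lemma comp_add_left: "bkernel K \<Longrightarrow> bkernel K' \<Longrightarrow> bkernel L \<Longrightarrow> x \<in> space M \<Longrightarrow> y \<in> space M \<Longrightarrow>
    kcomp (\<lambda>x y. K x y + K' x y) L x y = kcomp K L x y + kcomp K' L x y"
  by (simp add: kcomp_def integrable_comp_integrand distrib_right)

lemma comp_add_right: "bkernel K \<Longrightarrow> bkernel L \<Longrightarrow> bkernel L' \<Longrightarrow> x \<in> space M \<Longrightarrow> y \<in> space M \<Longrightarrow>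
    kcomp K (\<lambda>x y. L x y + L' x y) x y = kcomp K L x y + kcomp K L' x y"
  by (simp add: kcomp_def integrable_comp_integrand distrib_left)

lemma comp_scale_left: "kcomp (\<lambda>x y. c * K x y) L x y = c * kcomp K L x y"
  by (simp add: kcomp_def mult.assoc)

lemma comp_scale_right: "kcomp K (\<lambda>x y. c * L x y) x y = c * kcomp K L x y"
  by (simp add: kcomp_def mult.left_commute)

lemma keq_measurable:
  assumes "bkernel K" "bkernel L"
  shows "{p \<in> space (M \<Otimes>\<^sub>M M). K (fst p) (snd p) = L (fst p) (snd p)} \<in> sets (M \<Otimes>\<^sub>M M)"
proof -
  have [measurable]: "(\<lambda>p. K (fst p) (snd p)) \<in> borel_measurable (M \<Otimes>\<^sub>M M)"
      "(\<lambda>p. L (fst p) (snd p)) \<in> borel_measurable (M \<Otimes>\<^sub>M M)"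
    using assms by (auto simp: bkernel_def case_prod_beta' dest: bounded_measurableD)
  show ?thesis by measurable
qed

lemma keq_pair: "bkernel K \<Longrightarrow> bkernel L \<Longrightarrow>
    keq K L \<longleftrightarrow> (AE p in M \<Otimes>\<^sub>M M. K (fst p) (snd p) = L (fst p) (snd p))"
  unfolding keq_def
  by (rule pair_sigma_finite.AE_pair_iff[OF pair_sigma_finite_self keq_measurable])

lemma keq_flip_AE:
  assumes "bkernel K" "bkernel L" "keq K L"
  shows "AE y in M. AE x in M. K x y = L x y"
  using pair_sigma_finite.AE_commute[OF pair_sigma_finite_self keq_measurable[OF assms(1,2)]] assms(3)
  by (simp add: keq_def)

lemma keq_flip: "bkernel K \<Longrightarrow> bkernel L \<Longrightarrow> keq K L \<Longrightarrow> keq (\<lambda>x y. K y x) (\<lambda>x y. L y x)"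
  unfolding keq_def using keq_flip_AE by (simp add: keq_def)

lemma keq_refl [simp]: "keq K K"
  by (simp add: keq_def)

lemma keqI: "(\<And>x y. x \<in> space M \<Longrightarrow> y \<in> space M \<Longrightarrow> K x y = L x y) \<Longrightarrow> keq K L"
  unfolding keq_def by (intro AE_I2) auto

lemma keq_sym: "keq K L \<Longrightarrow> keq L K"
  by (simp add: keq_def eq_commute)

lemma keq_trans [trans]:
  assumes "keq K L" "keq L N" shows "keq K N"
  using assms unfolding keq_def
proof eventually_elim
  case (elim x)
  then show ?case by eventually_elim simp
qed

lemma keq_add:
  assumes "keq K L" "keq K' L'" shows "keq (\<lambda>x y. K x y + K' x y) (\<lambda>x y. L x y + L' x y)"
  using assms unfolding keq_def
proof eventually_elim
  case (elim x)
  then show ?case by eventually_elim simp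
qed

lemma keq_scale:
  assumes "keq K L" shows "keq (\<lambda>x y. c * K x y) (\<lambda>x y. c * L x y)"
  using assms unfolding keq_def
proof eventually_elim
  case (elim x)
  then show ?case by eventually_elim simp
qed

text \<open>Two kernels with equal rows at \<open>x\<close> and \<open>x'\<close> up to null sets have compositions that agree at
  \<open>x\<close> and \<open>x'\<close> for every \<open>y\<close>, without an exceptional null set.\<close>

lemma comp_AE_cong_left:
  assumes "bkernel K" "bkernel K'" "bkernel L" "x \<in> space M" "y \<in> space M" "AE z in M. K x z = K' x' z"
    "x' \<in> space M"
  shows "kcomp K L x y = kcomp K' L x' y"
  unfolding kcomp_def
proof (rule integral_cong_AE)
  show "(\<lambda>z. K x z * L z y) \<in> borel_measurable M"
    using integrable_comp_integrand[OF assms(1,3,4,5)] by (rule borel_measurable_integrable)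
  show "(\<lambda>z. K' x' z * L z y) \<in> borel_measurable M"
    using integrable_comp_integrand[OF assms(2,3,7,5)] by (rule borel_measurable_integrable)
  show "AE z in M. K x z * L z y = K' x' z * L z y"
    using assms(6) by eventually_elim simp
qed

lemma keq_comp_left:
  assumes "bkernel K" "bkernel K'" "bkernel L" "keq K K'"
  shows "keq (kcomp K L) (kcomp K' L)"
  unfolding keq_def
  using assms(4)[unfolded keq_def] AE_space
proof eventually_elim
  case (elim x)
  show ?case
    by (intro AE_I2 comp_AE_cong_left[OF assms(1-3) elim(2) _ elim(1) elim(2)])
qed

lemma keq_comp_right:
  assumes "bkernel K" "bkernel L" "bkernel L'" "keq L L'"
  shows "keq (kcomp K L) (kcomp K L')"
proof -
  have "keq (kcomp (\<lambda>x y. L y x) (\<lambda>x y. K y x)) (kcomp (\<lambda>x y. L' y x) (\<lambda>x y. K y x))"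
    by (rule keq_comp_left[OF kernel_flip[OF assms(2)] kernel_flip[OF assms(3)]
          kernel_flip[OF assms(1)] keq_flip[OF assms(2,3,4)]])
  then have "keq (\<lambda>x y. kcomp K L y x) (\<lambda>x y. kcomp K L' y x)"
    unfolding comp_flip[of L K] comp_flip[of L' K] .
  from keq_flip[OF kernel_flip kernel_flip this, OF kernel_comp kernel_comp] show ?thesis
    using assms by simp
qed

lemma keq_integral_cong:
  assumes "bkernel K" "bkernel L" "keq K L"
  shows "(\<integral>x. \<integral>y. K x y \<partial>M \<partial>M) = (\<integral>x. \<integral>y. L x y \<partial>M \<partial>M)"
proof (rule integral_cong_AE)
  show "(\<lambda>x. \<integral>y. K x y \<partial>M) \<in> borel_measurable M"
    by (rule bounded_measurableD[OF bounded_measurable_row_integral[OF assms(1)]])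
  show "(\<lambda>x. \<integral>y. L x y \<partial>M) \<in> borel_measurable M"
    by (rule bounded_measurableD[OF bounded_measurable_row_integral[OF assms(2)]])
  show "AE x in M. (\<integral>y. K x y \<partial>M) = (\<integral>y. L x y \<partial>M)"
    using assms(3)[unfolded keq_def] AE_space
  proof eventually_elim
    case (elim x)
    show ?case
      using elim(1) bounded_measurableD[OF bounded_measurable_row[OF assms(1) elim(2)]]
        bounded_measurableD[OF bounded_measurable_row[OF assms(2) elim(2)]]
      by (intro integral_cong_AE)
  qed
qed

lemma keq_zero_if_square_integral_zero:
  assumes "bkernel X" "(\<integral>x. \<integral>y. X x y * X x y \<partial>M \<partial>M) = 0"
  shows "keq X (\<lambda>x y. 0)"
proof -
  have k: "bkernel (\<lambda>x y. X x y * X x y)" by (intro kernel_mult assms)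
  have "AE x in M. (\<integral>y. X x y * X x y \<partial>M) = 0"
    using assms(2) integral_nonneg_eq_0_iff_AE[OF bounded_measurable_integrable[OF bounded_measurable_row_integral[OF k]]]
    by simp
  then show ?thesis unfolding keq_def using AE_space
  proof eventually_elim
    case (elim x)
    then have "AE y in M. X x y * X x y = 0"
      using integral_nonneg_eq_0_iff_AE[OF bounded_measurable_integrable[OF bounded_measurable_row[OF k]]] by simp
    then show ?case by simp
  qed
qed

end

section \<open>Approximation of kernels by finite sums of products\<close>

context prob_space
begin

text \<open>Finite sums of products of a bounded measurable function of \<open>x\<close> and one of \<open>y\<close>.\<close>

inductive tensor :: "('a \<Rightarrow> 'a \<Rightarrow> real) \<Rightarrow> bool" where
  tensor_base: "bounded_measurable M a \<Longrightarrow> bounded_measurable M b \<Longrightarrow> tensor (\<lambda>x y. a x * b y)"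
| tensor_add: "tensor S \<Longrightarrow> tensor T \<Longrightarrow> tensor (\<lambda>x y. S x y + T x y)"

lemma kernel_fst: "bounded_measurable M a \<Longrightarrow> bkernel (\<lambda>x y. a x)"
  by (rule kernelI, rule bounded_measurable_compose[of M a fst]) auto

lemma kernel_snd: "bounded_measurable M b \<Longrightarrow> bkernel (\<lambda>x y. b y)"
  by (rule kernelI, rule bounded_measurable_compose[of M b snd]) auto

lemma tensor_kernel: "tensor S \<Longrightarrow> bkernel S"
  by (induction rule: tensor.induct) (simp_all add: kernel_add kernel_mult kernel_fst kernel_snd)

lemma tensor_scale: "tensor S \<Longrightarrow> tensor (\<lambda>x y. c * S x y)"
proof (induction rule: tensor.induct)
  case (tensor_base a b)
  have "tensor (\<lambda>x y. (c * a x) * b y)"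
    by (rule tensor.tensor_base[OF bounded_measurable_mult[OF bounded_measurable_const tensor_base(1)] tensor_base(2)])
  then show ?case by (simp add: mult.assoc)
next
  case (tensor_add S T)
  from tensor.tensor_add[OF tensor_add(3,4)] show ?case by (simp add: distrib_left)
qed

text \<open>Membership in the \<open>L\<^sup>1\<close> closure of the finite sums of products.\<close>

definition tensor_approximable :: "('a \<times> 'a \<Rightarrow> real) \<Rightarrow> bool" where
  "tensor_approximable f \<longleftrightarrow> integrable (M \<Otimes>\<^sub>M M) f \<and>
     (\<forall>e>0. \<exists>S. tensor S \<and> (\<integral>p. \<bar>f p - S (fst p) (snd p)\<bar> \<partial>(M \<Otimes>\<^sub>M M)) < e)"

lemma tensor_integrable: "tensor S \<Longrightarrow> integrable (M \<Otimes>\<^sub>M M) (\<lambda>p. S (fst p) (snd p))"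
proof -
  interpret P: prob_space "M \<Otimes>\<^sub>M M" by (rule prob_space_pair)
  show "tensor S \<Longrightarrow> ?thesis"
    by (rule P.bounded_measurable_integrable[OF bounded_measurable_pair[OF tensor_kernel]])
qed

lemma tensor_approximable_tensor:
  assumes "tensor S" shows "tensor_approximable (\<lambda>p. S (fst p) (snd p))"
  unfolding tensor_approximable_def using tensor_integrable[OF assms] assms
  by (auto intro!: exI[of _ S])

lemma tensor_approximable_add:
  assumes "tensor_approximable f" "tensor_approximable g"
  shows "tensor_approximable (\<lambda>p. f p + g p)"
  unfolding tensor_approximable_def
proof (intro conjI allI impI)
  have i: "integrable (M \<Otimes>\<^sub>M M) f" "integrable (M \<Otimes>\<^sub>M M) g"
    using assms by (auto simp: tensor_approximable_def)
  then show "integrable (M \<Otimes>\<^sub>M M) (\<lambda>p. f p + g p)" by simp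
  fix e :: real assume "e > 0"
  then have "e / 2 > 0" by simp
  then obtain S T where S: "tensor S" "(\<integral>p. \<bar>f p - S (fst p) (snd p)\<bar> \<partial>(M \<Otimes>\<^sub>M M)) < e / 2"
    and T: "tensor T" "(\<integral>p. \<bar>g p - T (fst p) (snd p)\<bar> \<partial>(M \<Otimes>\<^sub>M M)) < e / 2"
    using assms unfolding tensor_approximable_def by blast
  note i' = i tensor_integrable[OF S(1)] tensor_integrable[OF T(1)]
  have "(\<integral>p. \<bar>f p + g p - (S (fst p) (snd p) + T (fst p) (snd p))\<bar> \<partial>(M \<Otimes>\<^sub>M M))
      \<le> (\<integral>p. \<bar>f p - S (fst p) (snd p)\<bar> + \<bar>g p - T (fst p) (snd p)\<bar> \<partial>(M \<Otimes>\<^sub>M M))"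
    using i' by (intro integral_mono) auto
  also have "\<dots> = (\<integral>p. \<bar>f p - S (fst p) (snd p)\<bar> \<partial>(M \<Otimes>\<^sub>M M)) + (\<integral>p. \<bar>g p - T (fst p) (snd p)\<bar> \<partial>(M \<Otimes>\<^sub>M M))"
    using i' by (intro Bochner_Integration.integral_add) auto
  also have "\<dots> < e" using S T by simp
  finally show "\<exists>S. tensor S \<and> (\<integral>p. \<bar>f p + g p - S (fst p) (snd p)\<bar> \<partial>(M \<Otimes>\<^sub>M M)) < e"
    using tensor_add[OF S(1) T(1)] by blast
qed

lemma tensor_approximable_scale:
  assumes "tensor_approximable f" shows "tensor_approximable (\<lambda>p. c * f p)"
  unfolding tensor_approximable_def
proof (intro conjI allI impI)
  have i: "integrable (M \<Otimes>\<^sub>M M) f"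
    using assms by (auto simp: tensor_approximable_def)
  then show "integrable (M \<Otimes>\<^sub>M M) (\<lambda>p. c * f p)" by simp
  fix e :: real assume "e > 0"
  then have "e / (\<bar>c\<bar> + 1) > 0" by simp
  then obtain S where S: "tensor S" "(\<integral>p. \<bar>f p - S (fst p) (snd p)\<bar> \<partial>(M \<Otimes>\<^sub>M M)) < e / (\<bar>c\<bar> + 1)"
    using assms unfolding tensor_approximable_def by blast
  have "(\<integral>p. \<bar>c * f p - c * S (fst p) (snd p)\<bar> \<partial>(M \<Otimes>\<^sub>M M))
      = \<bar>c\<bar> * (\<integral>p. \<bar>f p - S (fst p) (snd p)\<bar> \<partial>(M \<Otimes>\<^sub>M M))"
    unfolding right_diff_distrib[symmetric] abs_mult by simp
  also have "\<dots> \<le> (\<bar>c\<bar> + 1) * (\<integral>p. \<bar>f p - S (fst p) (snd p)\<bar> \<partial>(M \<Otimes>\<^sub>M M))"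
    by (intro mult_right_mono integral_nonneg_AE) auto
  also have "\<dots> < e" using S(2) by (simp add: field_simps)
  finally show "\<exists>S. tensor S \<and> (\<integral>p. \<bar>c * f p - S (fst p) (snd p)\<bar> \<partial>(M \<Otimes>\<^sub>M M)) < e"
    using tensor_scale[OF S(1), of c] by blast
qed

lemma tensor_approximable_zero: "tensor_approximable (\<lambda>p. 0)"
  using tensor_approximable_tensor[OF tensor_base[OF bounded_measurable_const[of M 0] bounded_measurable_const[of M 0]]]
  by simp

lemma tensor_approximable_sum:
  "finite I \<Longrightarrow> (\<And>i. i \<in> I \<Longrightarrow> tensor_approximable (f i)) \<Longrightarrow> tensor_approximable (\<lambda>p. \<Sum>i\<in>I. f i p)"
  by (induction I rule: finite_induct)
    (simp_all add: tensor_approximable_add tensor_approximable_zero)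

lemma tensor_approximable_cong:
  assumes "tensor_approximable f" "\<And>p. p \<in> space (M \<Otimes>\<^sub>M M) \<Longrightarrow> f p = g p"
  shows "tensor_approximable g"
proof -
  have "integrable (M \<Otimes>\<^sub>M M) f \<longleftrightarrow> integrable (M \<Otimes>\<^sub>M M) g"
    by (intro Bochner_Integration.integrable_cong assms refl)
  moreover have "(\<integral>p. \<bar>f p - S (fst p) (snd p)\<bar> \<partial>(M \<Otimes>\<^sub>M M)) = (\<integral>p. \<bar>g p - S (fst p) (snd p)\<bar> \<partial>(M \<Otimes>\<^sub>M M))" for S
    by (intro Bochner_Integration.integral_cong refl) (simp add: assms(2))
  ultimately show ?thesis using assms(1) by (simp add: tensor_approximable_def)
qed

lemma tensor_approximable_lim:
  assumes s: "\<And>i. tensor_approximable (s i)" and f: "integrable (M \<Otimes>\<^sub>M M) f"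
    and lim: "\<And>p. p \<in> space (M \<Otimes>\<^sub>M M) \<Longrightarrow> (\<lambda>i. s i p) \<longlonglongrightarrow> f p"
    and bound: "\<And>i p. p \<in> space (M \<Otimes>\<^sub>M M) \<Longrightarrow> \<bar>s i p\<bar> \<le> 2 * \<bar>f p\<bar>"
  shows "tensor_approximable f"
  unfolding tensor_approximable_def
proof (intro conjI allI impI)
  show "integrable (M \<Otimes>\<^sub>M M) f" by (rule f)
  have i: "integrable (M \<Otimes>\<^sub>M M) (s i)" for i using s by (auto simp: tensor_approximable_def)
  fix e :: real assume "e > 0"
  have "(\<lambda>i. \<integral>p. \<bar>f p - s i p\<bar> \<partial>(M \<Otimes>\<^sub>M M)) \<longlonglongrightarrow> (\<integral>p. 0 \<partial>(M \<Otimes>\<^sub>M M))"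
  proof (rule integral_dominated_convergence)
    show "integrable (M \<Otimes>\<^sub>M M) (\<lambda>p. 3 * \<bar>f p\<bar>)" using f by simp
    show "AE p in M \<Otimes>\<^sub>M M. (\<lambda>i. \<bar>f p - s i p\<bar>) \<longlonglongrightarrow> 0"
    proof (rule AE_I2)
      fix p assume "p \<in> space (M \<Otimes>\<^sub>M M)"
      then have "(\<lambda>i. \<bar>f p - s i p\<bar>) \<longlonglongrightarrow> \<bar>f p - f p\<bar>" by (intro tendsto_intros lim)
      then show "(\<lambda>i. \<bar>f p - s i p\<bar>) \<longlonglongrightarrow> 0" by simp
    qed
    show "AE p in M \<Otimes>\<^sub>M M. norm \<bar>f p - s i p\<bar> \<le> 3 * \<bar>f p\<bar>" for i
    proof (rule AE_I2)
      fix p assume "p \<in> space (M \<Otimes>\<^sub>M M)"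
      from bound[OF this, of i] show "norm \<bar>f p - s i p\<bar> \<le> 3 * \<bar>f p\<bar>" by auto
    qed
    show "(\<lambda>p. \<bar>f p - s i p\<bar>) \<in> borel_measurable (M \<Otimes>\<^sub>M M)" for i
      using f i[of i] by (intro borel_measurable_integrable) simp
  qed simp
  then have lim0: "(\<lambda>i. \<integral>p. \<bar>f p - s i p\<bar> \<partial>(M \<Otimes>\<^sub>M M)) \<longlonglongrightarrow> 0" by simp
  have "e / 2 > 0" using \<open>e > 0\<close> by simp
  from order_tendstoD(2)[OF lim0 this]
  obtain k where k: "(\<integral>p. \<bar>f p - s k p\<bar> \<partial>(M \<Otimes>\<^sub>M M)) < e / 2"
    by (auto simp: eventually_sequentially)
  obtain S where S: "tensor S" "(\<integral>p. \<bar>s k p - S (fst p) (snd p)\<bar> \<partial>(M \<Otimes>\<^sub>M M)) < e / 2"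
    using s[of k] \<open>e / 2 > 0\<close> unfolding tensor_approximable_def by blast
  note i' = f i[of k] tensor_integrable[OF S(1)]
  have "(\<integral>p. \<bar>f p - S (fst p) (snd p)\<bar> \<partial>(M \<Otimes>\<^sub>M M))
      \<le> (\<integral>p. \<bar>f p - s k p\<bar> + \<bar>s k p - S (fst p) (snd p)\<bar> \<partial>(M \<Otimes>\<^sub>M M))"
    using i' by (intro integral_mono) auto
  also have "\<dots> = (\<integral>p. \<bar>f p - s k p\<bar> \<partial>(M \<Otimes>\<^sub>M M)) + (\<integral>p. \<bar>s k p - S (fst p) (snd p)\<bar> \<partial>(M \<Otimes>\<^sub>M M))"
    using i' by (intro Bochner_Integration.integral_add) auto
  also have "\<dots> < e" using S k by simp
  finally show "\<exists>S. tensor S \<and> (\<integral>p. \<bar>f p - S (fst p) (snd p)\<bar> \<partial>(M \<Otimes>\<^sub>M M)) < e"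
    using S(1) by blast
qed

text \<open>The approximable measurable sets form a Dynkin system that contains the rectangles.\<close>

lemma tensor_approximable_indicator:
  assumes "A \<in> sets (M \<Otimes>\<^sub>M M)"
  shows "tensor_approximable (indicator A)"
proof -
  interpret P: prob_space "M \<Otimes>\<^sub>M M" by (rule prob_space_pair)
  have bm_ind: "bounded_measurable M (indicator B)" if "B \<in> sets M" for B
    using that by (intro bounded_measurableI[where C = 1]) (auto simp: indicator_def)
  let ?G = "{a \<times> b | a b. a \<in> sets M \<and> b \<in> sets M}"
  have G: "?G \<subseteq> Pow (space M \<times> space M)" using sets.sets_into_space by blast
  have sets_eq: "sets (M \<Otimes>\<^sub>M M) = sigma_sets (space M \<times> space M) ?G"
    by (rule sets_pair_measure)
  have A: "A \<in> sigma_sets (space M \<times> space M) ?G" using assms by (simp only: sets_eq)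
  have rect: "tensor_approximable (indicator (B \<times> C))" if "B \<in> sets M" "C \<in> sets M" for B C
  proof -
    have "tensor (\<lambda>x y. indicator B x * indicator C y)"
      by (rule tensor_base[OF bm_ind[OF that(1)] bm_ind[OF that(2)]])
    from tensor_approximable_tensor[OF this] show ?thesis
      by (rule tensor_approximable_cong) (auto simp: indicator_def)
  qed
  show ?thesis
    using Int_stable_pair_measure_generator[of M M] G A
  proof (induct rule: sigma_sets_induct_disjoint)
    case (basic B)
    then show ?case using rect by blast
  next
    case empty
    show ?case using tensor_approximable_zero by (simp add: indicator_def)
  next
    case (compl B)
    have "tensor_approximable (\<lambda>p. indicator (space M \<times> space M) p + (- 1) * indicator B p)"
      by (intro tensor_approximable_add tensor_approximable_scale rect compl(2)) auto
    then show ?case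
      by (rule tensor_approximable_cong)
         (auto simp: indicator_def space_pair_measure)
  next
    case (union B)
    have meas: "B i \<in> sets (M \<Otimes>\<^sub>M M)" for i
      using union(2) unfolding sets_eq by blast
    have ind: "(\<Sum>i<n. indicator (B i) p) = (indicator (\<Union>i<n. B i) p :: real)" for n p
      by (rule indicator_UN_disjoint[OF finite_lessThan disjoint_family_on_mono[OF subset_UNIV union(1)], symmetric])
    show ?case
    proof (rule tensor_approximable_lim)
      show "tensor_approximable (\<lambda>p. \<Sum>i<n. indicator (B i) p)" for n
        by (intro tensor_approximable_sum union(3)) auto
      show "integrable (M \<Otimes>\<^sub>M M) (indicator (\<Union> (range B)) :: _ \<Rightarrow> real)"
        using meas by (intro P.integrable_const_bound[where B = 1]) (auto simp: indicator_def)
      show "(\<lambda>n. \<Sum>i<n. indicator (B i) p :: real) \<longlonglongrightarrow> indicator (\<Union> (range B)) p" for p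
        unfolding ind by (rule LIMSEQ_indicator_UN)
      show "\<bar>\<Sum>i<n. indicator (B i) p\<bar> \<le> 2 * \<bar>indicator (\<Union> (range B)) p :: real\<bar>" for n p
        unfolding ind by (auto simp: indicator_def)
    qed
  qed
qed

lemma tensor_approximable_integrable:
  assumes "integrable (M \<Otimes>\<^sub>M M) f"
  shows "tensor_approximable f"
  using assms
proof (induct rule: integrable_induct)
  case (base A c)
  have "tensor_approximable (\<lambda>p. c * indicator A p)"
    by (intro tensor_approximable_scale tensor_approximable_indicator base)
  then show ?case by (simp add: mult.commute)
next
  case (add f g)
  then show ?case by (intro tensor_approximable_add)
next
  case (lim f s)
  then show ?case by (intro tensor_approximable_lim[of s f]) auto
qed

lemma kernel_tensor_approx:
  assumes "bkernel K" "e > 0"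
  shows "\<exists>S. tensor S \<and> (\<integral>x. \<integral>y. \<bar>K x y - S x y\<bar> \<partial>M \<partial>M) < e"
proof -
  interpret P: prob_space "M \<Otimes>\<^sub>M M" by (rule prob_space_pair)
  have "tensor_approximable (\<lambda>p. K (fst p) (snd p))"
    by (rule tensor_approximable_integrable[OF P.bounded_measurable_integrable[OF bounded_measurable_pair[OF assms(1)]]])
  then obtain S where S: "tensor S" "(\<integral>p. \<bar>K (fst p) (snd p) - S (fst p) (snd p)\<bar> \<partial>(M \<Otimes>\<^sub>M M)) < e"
    using assms(2) unfolding tensor_approximable_def by blast
  have "bkernel (\<lambda>x y. \<bar>K x y - S x y\<bar>)"
    by (rule kernelI, rule bounded_measurable_abs,
        rule bounded_measurable_pair[OF kernel_diff[OF assms(1) tensor_kernel[OF S(1)]]])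
  from kernel_integral_pair[OF this] S show ?thesis by auto
qed

lemma keq_zero_if_orthogonal_to_tensors:
  assumes X: "bkernel X"
    and orth: "\<And>a b. bounded_measurable M a \<Longrightarrow> bounded_measurable M b \<Longrightarrow>
      (\<integral>x. \<integral>y. X x y * (a x * b y) \<partial>M \<partial>M) = 0"
  shows "keq X (\<lambda>x y. 0)"
proof (rule keq_zero_if_square_integral_zero[OF X])
  obtain C where C: "C > 0" "\<And>x y. x \<in> space M \<Longrightarrow> y \<in> space M \<Longrightarrow> \<bar>X x y\<bar> \<le> C"
    using kernel_bound[OF X] by blast
  have orthS: "(\<integral>x. \<integral>y. X x y * S x y \<partial>M \<partial>M) = 0" if "tensor S" for S
    using that
  proof (induction rule: tensor.induct)
    case (tensor_base a b)
    then show ?case by (rule orth)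
  next
    case (tensor_add S T)
    then show ?case
      using integral_add_kernel[OF kernel_mult[OF X tensor_kernel[OF tensor_add(1)]]
          kernel_mult[OF X tensor_kernel[OF tensor_add(2)]]]
      by (simp add: distrib_left)
  qed
  let ?I = "\<integral>x. \<integral>y. X x y * X x y \<partial>M \<partial>M"
  have le: "?I \<le> C * e" if e: "e > 0" for e
  proof -
    obtain S where S: "tensor S" "(\<integral>x. \<integral>y. \<bar>X x y - S x y\<bar> \<partial>M \<partial>M) < e"
      using kernel_tensor_approx[OF X e] by blast
    have k: "bkernel (\<lambda>x y. X x y * (X x y - S x y))" "bkernel (\<lambda>x y. X x y * S x y)"
      by (intro kernel_mult kernel_diff X tensor_kernel S(1))+
    have ka: "bkernel (\<lambda>x y. C * \<bar>X x y - S x y\<bar>)"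
      by (rule kernelI, rule bounded_measurable_mult[OF bounded_measurable_const], rule bounded_measurable_abs,
          rule bounded_measurable_pair[OF kernel_diff[OF X tensor_kernel[OF S(1)]]])
    have "?I = (\<integral>x. \<integral>y. X x y * (X x y - S x y) + X x y * S x y \<partial>M \<partial>M)"
      by (simp add: right_diff_distrib)
    also have "\<dots> = (\<integral>x. \<integral>y. X x y * (X x y - S x y) \<partial>M \<partial>M)"
      using integral_add_kernel[OF k] orthS[OF S(1)] by simp
    also have "\<dots> \<le> (\<integral>x. \<integral>y. C * \<bar>X x y - S x y\<bar> \<partial>M \<partial>M)"
    proof (intro integral_mono bounded_measurable_integrable bounded_measurable_row_integral k ka)
      fix x y assume xy: "x \<in> space M" "y \<in> space M"
      show "bounded_measurable M (\<lambda>y. X x y * (X x y - S x y))" by (rule bounded_measurable_row[OF k(1) xy(1)])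
      show "bounded_measurable M (\<lambda>y. C * \<bar>X x y - S x y\<bar>)" by (rule bounded_measurable_row[OF ka xy(1)])
      have "X x y * (X x y - S x y) \<le> \<bar>X x y\<bar> * \<bar>X x y - S x y\<bar>"
        by (metis abs_ge_self abs_mult)
      also have "\<dots> \<le> C * \<bar>X x y - S x y\<bar>" using C(2)[OF xy] by (intro mult_right_mono) auto
      finally show "X x y * (X x y - S x y) \<le> C * \<bar>X x y - S x y\<bar>" .
    qed
    also have "\<dots> \<le> C * e" using S(2) C(1) by simp
    finally show ?thesis .
  qed
  have "?I \<ge> 0" by (intro integral_nonneg_AE AE_I2) simp
  moreover have "?I \<le> 0"
  proof (rule field_le_epsilon)
    fix e :: real assume "e > 0"
    then show "?I \<le> 0 + e" using le[of "e / C"] C(1) by simp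
  qed
  ultimately show "?I = 0" by linarith
qed

text \<open>A self-adjoint operator with square zero vanishes. The kernel of the square is only known to be
  zero almost everywhere, which says nothing about its diagonal \<open>\<integral> X(x, z)\<^sup>2 dz\<close>; this is why the kernel
  is tested against products \<open>a(x) b(y)\<close>: the image \<open>g\<close> of \<open>a\<close> under the operator satisfies
  \<open>\<integral> g\<^sup>2 = \<integral> a (X X a) = 0\<close>.\<close>

lemma keq_zero_if_comp_self_zero:
  assumes X: "bkernel X" and sym: "\<And>x y. x \<in> space M \<Longrightarrow> y \<in> space M \<Longrightarrow> X x y = X y x"
    and XX: "keq (kcomp X X) (\<lambda>x y. 0)"
  shows "keq X (\<lambda>x y. 0)"
proof (rule keq_zero_if_orthogonal_to_tensors[OF X])
  fix a b assume a: "bounded_measurable M a" and b: "bounded_measurable M b"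
  define g where "g = (\<lambda>z. \<integral>x. X z x * a x \<partial>M)"
  have g: "bounded_measurable M g"
    unfolding g_def by (rule bounded_measurable_row_integral[OF kernel_mult[OF X kernel_snd[OF a]]])
  have Xg: "(\<integral>z. X x z * g z \<partial>M) = (\<integral>w. kcomp X X x w * a w \<partial>M)" if x: "x \<in> space M" for x
  proof -
    have k: "bkernel (\<lambda>z w. X x z * X z w * a w)"
      by (intro kernel_mult X kernel_snd[OF a] kernel_fst bounded_measurable_row[OF X x])
    have "(\<integral>z. X x z * g z \<partial>M) = (\<integral>z. \<integral>w. X x z * X z w * a w \<partial>M \<partial>M)"
      by (simp add: g_def mult.assoc)
    also have "\<dots> = (\<integral>w. \<integral>z. X x z * X z w * a w \<partial>M \<partial>M)"
      by (rule kernel_integral_swap[OF k])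
    also have "\<dots> = (\<integral>w. kcomp X X x w * a w \<partial>M)" by (simp add: kcomp_def)
    finally show ?thesis .
  qed
  have k2: "bkernel (\<lambda>z x. X z x * a x * g z)"
    by (intro kernel_mult X kernel_snd[OF a] kernel_fst g)
  have "(\<integral>z. g z * g z \<partial>M) = (\<integral>z. \<integral>x. X z x * a x * g z \<partial>M \<partial>M)"
    by (subst (1) g_def) simp
  also have "\<dots> = (\<integral>x. \<integral>z. X z x * a x * g z \<partial>M \<partial>M)"
    by (rule kernel_integral_swap[OF k2])
  also have "\<dots> = (\<integral>x. a x * (\<integral>z. X x z * g z \<partial>M) \<partial>M)"
  proof (rule Bochner_Integration.integral_cong[OF refl])
    fix x assume "x \<in> space M"
    then have "(\<integral>z. X z x * a x * g z \<partial>M) = (\<integral>z. a x * (X x z * g z) \<partial>M)"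
      by (intro Bochner_Integration.integral_cong refl) (simp add: sym[of x] mult_ac)
    then show "(\<integral>z. X z x * a x * g z \<partial>M) = a x * (\<integral>z. X x z * g z \<partial>M)" by simp
  qed
  also have "\<dots> = (\<integral>x. a x * (\<integral>w. kcomp X X x w * a w \<partial>M) \<partial>M)"
    by (rule Bochner_Integration.integral_cong) (simp_all add: Xg)
  also have "\<dots> = (\<integral>x. 0 \<partial>M)"
  proof (rule integral_cong_AE)
    show "(\<lambda>x. a x * (\<integral>w. kcomp X X x w * a w \<partial>M)) \<in> borel_measurable M"
      by (intro borel_measurable_times bounded_measurableD[OF a]
          bounded_measurableD[OF bounded_measurable_row_integral[OF kernel_mult[OF kernel_comp[OF X X] kernel_snd[OF a]]]])
    show "AE x in M. a x * (\<integral>w. kcomp X X x w * a w \<partial>M) = 0"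
      using XX[unfolded keq_def] AE_space
    proof eventually_elim
      case (elim x)
      have "(\<integral>w. kcomp X X x w * a w \<partial>M) = (\<integral>w. 0 \<partial>M)"
      proof (rule integral_cong_AE)
        show "(\<lambda>w. kcomp X X x w * a w) \<in> borel_measurable M"
          by (intro borel_measurable_times bounded_measurableD[OF a]
              bounded_measurableD[OF bounded_measurable_row[OF kernel_comp[OF X X] elim(2)]])
        show "AE w in M. kcomp X X x w * a w = 0" using elim(1) by eventually_elim simp
      qed simp
      then show ?case by simp
    qed
  qed simp
  finally have "AE z in M. g z * g z = 0"
    using integral_nonneg_eq_0_iff_AE[OF bounded_measurable_integrable[OF bounded_measurable_mult[OF g g]]]
    by simp
  then have g0: "AE z in M. g z = 0" by simp
  have "(\<integral>x. \<integral>y. X x y * (a x * b y) \<partial>M \<partial>M) = (\<integral>y. \<integral>x. X x y * (a x * b y) \<partial>M \<partial>M)"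
    by (intro kernel_integral_swap kernel_mult X kernel_fst[OF a] kernel_snd[OF b])
  also have "\<dots> = (\<integral>y. b y * g y \<partial>M)"
  proof (rule Bochner_Integration.integral_cong[OF refl])
    fix y assume "y \<in> space M"
    then have "(\<integral>x. X x y * (a x * b y) \<partial>M) = (\<integral>x. b y * (X y x * a x) \<partial>M)"
      by (intro Bochner_Integration.integral_cong refl) (simp add: sym[of _ y] mult_ac)
    then show "(\<integral>x. X x y * (a x * b y) \<partial>M) = b y * g y" by (simp add: g_def)
  qed
  also have "\<dots> = (\<integral>y. 0 \<partial>M)"
  proof (rule integral_cong_AE)
    show "(\<lambda>y. b y * g y) \<in> borel_measurable M"
      by (intro borel_measurable_times bounded_measurableD[OF b] bounded_measurableD[OF g])
    show "AE y in M. b y * g y = 0" using g0 by eventually_elim simp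
  qed simp
  finally show "(\<integral>x. \<integral>y. X x y * (a x * b y) \<partial>M \<partial>M) = 0" by simp
qed

end

section \<open>Polynomials in an integral operator\<close>

context prob_space
begin

text \<open>Powers of the integral operator with kernel \<open>W\<close>. The index is shifted: \<open>kpow W n\<close> is the kernel of
  the power with exponent \<open>n + 1\<close>, because the identity operator has no kernel.\<close>

primrec kpow :: "('a \<Rightarrow> 'a \<Rightarrow> real) \<Rightarrow> nat \<Rightarrow> 'a \<Rightarrow> 'a \<Rightarrow> real" where
  "kpow W 0 = W"
| "kpow W (Suc n) = kcomp (kpow W n) W"

text \<open>The kernel of \<open>W p(W)\<close>, where \<open>p(W)\<close> is the polynomial \<open>p\<close> evaluated at the integral operator.
  The extra factor \<open>W\<close> again avoids the identity operator.\<close>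

definition kpoly :: "('a \<Rightarrow> 'a \<Rightarrow> real) \<Rightarrow> real poly \<Rightarrow> 'a \<Rightarrow> 'a \<Rightarrow> real" where
  "kpoly W p x y = (\<Sum>i\<le>degree p. coeff p i * kpow W i x y)"

lemma kernel_scale: "bkernel K \<Longrightarrow> bkernel (\<lambda>x y. c * K x y)"
  by (rule kernel_mult[OF kernel_const])

lemma comp_sum_left:
  assumes "\<And>i. i \<in> I \<Longrightarrow> bkernel (K i)" "bkernel L" "x \<in> space M" "y \<in> space M"
  shows "kcomp (\<lambda>x y. \<Sum>i\<in>I. K i x y) L x y = (\<Sum>i\<in>I. kcomp (K i) L x y)"
  unfolding kcomp_def sum_distrib_right
  by (rule Bochner_Integration.integral_sum) (rule integrable_comp_integrand[OF assms(1) assms(2-4)])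

context
  fixes W assumes W: "bkernel W"
begin

lemma kpow_kernel: "bkernel (kpow W n)"
  by (induction n) (simp_all add: W kernel_comp)

lemma kpow_add:
  assumes "x \<in> space M" "y \<in> space M"
  shows "kcomp (kpow W a) (kpow W b) x y = kpow W (Suc (a + b)) x y"
  using assms
proof (induction b arbitrary: x y)
  case (Suc b)
  have "kcomp (kpow W a) (kpow W (Suc b)) x y = kcomp (kcomp (kpow W a) (kpow W b)) W x y"
    using comp_assoc[OF kpow_kernel[of a] kpow_kernel[of b] W Suc.prems] by simp
  also have "\<dots> = kcomp (kpow W (Suc (a + b))) W x y"
    by (rule comp_cong) (simp_all only: Suc.IH Suc.prems)
  finally show ?case by simp
qed simp

lemma kpow_sym:
  assumes sym: "\<And>x y. x \<in> space M \<Longrightarrow> y \<in> space M \<Longrightarrow> W x y = W y x"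
    and "x \<in> space M" "y \<in> space M"
  shows "kpow W n x y = kpow W n y x"
  using assms(2,3)
proof (induction n arbitrary: x y)
  case (Suc n)
  have "kpow W (Suc n) x y = kcomp W (kpow W n) y x"
    unfolding kpow.simps kcomp_def
    by (rule Bochner_Integration.integral_cong[OF refl])
       (simp add: Suc.IH[OF Suc.prems(1)] sym[OF _ Suc.prems(2)])
  also have "\<dots> = kpow W (Suc n) y x"
    using kpow_add[OF Suc.prems(2,1), of 0 n] by simp
  finally show ?case .
qed (simp add: sym)

lemma kpoly_eq: "degree p \<le> n \<Longrightarrow> kpoly W p x y = (\<Sum>i\<le>n. coeff p i * kpow W i x y)"
  unfolding kpoly_def
  by (rule sum.mono_neutral_left) (auto simp: coeff_eq_0)

lemma kpoly_0 [simp]: "kpoly W 0 x y = 0"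
  by (simp add: kpoly_def)

lemma kpoly_1 [simp]: "kpoly W 1 x y = W x y"
  by (simp add: kpoly_def)

lemma kpoly_add: "kpoly W (p + q) x y = kpoly W p x y + kpoly W q x y"
proof -
  let ?n = "max (degree p) (degree q)"
  have "degree (p + q) \<le> ?n" by (rule degree_add_le) auto
  then show ?thesis
    by (simp add: kpoly_eq[of _ ?n] distrib_right sum.distrib)
qed

lemma kpoly_smult: "kpoly W (smult c p) x y = c * kpoly W p x y"
  by (simp add: kpoly_eq[of "smult c p" "degree p"] kpoly_def sum_distrib_left mult.assoc degree_smult_le)

lemma kpoly_kernel: "bkernel (kpoly W p)"
  unfolding kpoly_def[abs_def] by (intro kernel_sum kernel_scale kpow_kernel)

lemma kpoly_sym:
  assumes sym: "\<And>x y. x \<in> space M \<Longrightarrow> y \<in> space M \<Longrightarrow> W x y = W y x"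
    and "x \<in> space M" "y \<in> space M"
  shows "kpoly W p x y = kpoly W p y x"
  unfolding kpoly_def using kpow_sym[OF assms] by simp

lemma kpoly_pCons:
  assumes "x \<in> space M" "y \<in> space M"
  shows "kpoly W (pCons a p) x y = a * W x y + kcomp (kpoly W p) W x y"
proof -
  have "degree (pCons a p) \<le> Suc (degree p)" by (rule degree_pCons_le)
  then have "kpoly W (pCons a p) x y = (\<Sum>i\<le>Suc (degree p). coeff (pCons a p) i * kpow W i x y)"
    by (rule kpoly_eq)
  also have "\<dots> = a * W x y + (\<Sum>i\<le>degree p. coeff p i * kpow W (Suc i) x y)"
    by (subst sum.atMost_Suc_shift) simp
  also have "(\<Sum>i\<le>degree p. coeff p i * kpow W (Suc i) x y) = kcomp (kpoly W p) W x y"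
    unfolding kpoly_def[abs_def]
    by (subst comp_sum_left) (simp_all add: assms W kpow_kernel kernel_scale comp_scale_left)
  finally show ?thesis .
qed

text \<open>The product of \<open>W p(W)\<close> and \<open>W q(W)\<close> is \<open>W (W p(W) q(W))\<close>; \<open>pCons 0\<close> is multiplication by the
  variable. Consequently the polynomials \<open>p\<close> with \<open>W p(W) = 0\<close> form an ideal, as the next two
  lemmas show.\<close>

lemma kpoly_mult:
  assumes "x \<in> space M" "y \<in> space M"
  shows "kcomp (kpoly W p) (kpoly W q) x y = kpoly W (pCons 0 (p * q)) x y"
  using assms
proof (induction q arbitrary: x y)
  case 0
  show ?case by (simp add: kcomp_def)
next
  case (pCons b q)
  have "kcomp (kpoly W p) (kpoly W (pCons b q)) x y
      = kcomp (kpoly W p) (\<lambda>x y. b * W x y + kcomp (kpoly W q) W x y) x y"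
    by (rule comp_cong) (simp_all add: kpoly_pCons pCons.prems)
  also have "\<dots> = b * kcomp (kpoly W p) W x y + kcomp (kpoly W p) (kcomp (kpoly W q) W) x y"
    by (subst comp_add_right)
       (simp_all add: kpoly_kernel W kernel_scale kernel_comp pCons.prems comp_scale_right)
  also have "kcomp (kpoly W p) (kcomp (kpoly W q) W) x y = kcomp (kcomp (kpoly W p) (kpoly W q)) W x y"
    by (rule comp_assoc[symmetric]) (simp_all add: kpoly_kernel W pCons.prems)
  also have "\<dots> = kcomp (kpoly W (pCons 0 (p * q))) W x y"
    by (rule comp_cong) (simp_all add: pCons.IH pCons.prems)
  also have "b * kcomp (kpoly W p) W x y + \<dots> = kpoly W (pCons 0 (p * pCons b q)) x y"
    by (simp add: kpoly_pCons pCons.prems mult_pCons_right kpoly_add[abs_def] kpoly_smult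
        comp_add_left kpoly_kernel W kernel_scale comp_scale_left)
  finally show ?case .
qed

lemma kpoly_zero_pCons:
  assumes "keq (kpoly W p) (\<lambda>x y. 0)" shows "keq (kpoly W (pCons 0 p)) (\<lambda>x y. 0)"
proof -
  have "keq (kpoly W (pCons 0 p)) (kcomp (kpoly W p) W)"
    by (rule keqI) (simp add: kpoly_pCons)
  also have "keq (kcomp (kpoly W p) W) (kcomp (\<lambda>x y. 0) W)"
    by (rule keq_comp_left[OF kpoly_kernel kernel_const W assms])
  also have "kcomp (\<lambda>x y. 0) W = (\<lambda>x y. 0)" by (intro ext) (simp add: kcomp_def)
  finally show ?thesis .
qed

lemma kpoly_zero_mult:
  assumes "keq (kpoly W p) (\<lambda>x y. 0)" shows "keq (kpoly W (p * q)) (\<lambda>x y. 0)"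
proof (induction q)
  case 0
  show ?case by (simp add: keq_def)
next
  case (pCons b q)
  have "keq (kpoly W (p * pCons b q)) (\<lambda>x y. b * kpoly W p x y + kpoly W (pCons 0 (p * q)) x y)"
    by (rule keqI) (simp add: mult_pCons_right kpoly_add kpoly_smult)
  also have "keq \<dots> (\<lambda>x y. b * 0 + 0)"
    by (rule keq_add[OF keq_scale[OF assms] kpoly_zero_pCons[OF pCons.IH]])
  finally show ?case by simp
qed

context
  assumes sym: "\<And>x y. x \<in> space M \<Longrightarrow> y \<in> space M \<Longrightarrow> W x y = W y x"
begin

text \<open>If \<open>W\<^sup>2 p(W) = 0\<close>, then the square of the self-adjoint operator \<open>W p(W)\<close> vanishes, hence the
  operator itself.\<close>

lemma kpoly_zero_pCons_cancel:
  assumes "keq (kpoly W (pCons 0 p)) (\<lambda>x y. 0)"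
  shows "keq (kpoly W p) (\<lambda>x y. 0)"
proof (rule keq_zero_if_comp_self_zero[OF kpoly_kernel kpoly_sym[OF sym]])
  have "keq (kcomp (kpoly W p) (kpoly W p)) (kpoly W (pCons 0 p * p))"
    by (rule keqI) (simp add: kpoly_mult)
  also have "keq \<dots> (\<lambda>x y. 0)"
    by (rule kpoly_zero_mult[OF assms])
  finally show "keq (kcomp (kpoly W p) (kpoly W p)) (\<lambda>x y. 0)" .
qed

text \<open>After cancelling powers of the variable the annihilating polynomial can be scaled to \<open>1 - X s\<close>;
  multiplication by \<open>1 + X s\<close> turns it into \<open>1 - X\<^sup>2 s\<^sup>2\<close>, so that \<open>W = W\<^sup>3 t(W)\<close> with \<open>t = s\<^sup>2\<close>.\<close>

lemma annihilating_poly_normal_form: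
  assumes "p \<noteq> 0" "keq (kpoly W p) (\<lambda>x y. 0)"
  shows "\<exists>t. keq (kpoly W (1 - pCons 0 (pCons 0 t))) (\<lambda>x y. 0)"
  using assms
proof (induction p)
  case (pCons a q)
  show ?case
  proof (cases "a = 0")
    case True
    with pCons.prems have "keq (kpoly W q) (\<lambda>x y. 0)" "q \<noteq> 0"
      by (auto dest: kpoly_zero_pCons_cancel)
    with pCons.IH show ?thesis by blast
  next
    case False
    define s where "s = smult (- 1 / a) q"
    have "pCons a q * (smult (1 / a) (1 + pCons 0 s)) = smult (1 / a) (pCons a q) * (1 + pCons 0 s)"
      by (metis mult_smult_left mult_smult_right)
    also have "smult (1 / a) (pCons a q) = 1 - pCons 0 s"
      using False by (simp add: s_def one_pCons)
    also have "(1 - pCons 0 s) * (1 + pCons 0 s) = 1 - pCons 0 (pCons 0 (s * s))"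
      by (simp add: algebra_simps)
    finally show ?thesis
      using kpoly_zero_mult[OF pCons.prems(2), of "smult (1 / a) (1 + pCons 0 s)"] by metis
  qed
qed simp

text \<open>From \<open>W = W\<^sup>3 t(W)\<close> the kernels are \<open>P = W\<^sup>2 t(W)\<close> and \<open>L = W t(W)\<close>.\<close>

lemma kernel_factorizations:
  assumes "p \<noteq> 0" "keq (kpoly W p) (\<lambda>x y. 0)"
  shows "\<exists>P L. bkernel P \<and> bkernel L \<and> keq W (kcomp W P) \<and>
     keq (kcomp W W) (kcomp (kcomp W W) P) \<and> keq W (kcomp (kcomp W W) L)"
proof -
  obtain t where t: "keq (kpoly W (1 - pCons 0 (pCons 0 t))) (\<lambda>x y. 0)"
    using annihilating_poly_normal_form[OF assms] by blast
  have eqI: "keq (kpoly W q) (kpoly W r)" if "keq (kpoly W (q - r)) (\<lambda>x y. 0)" for q r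
  proof -
    have "keq (kpoly W q) (\<lambda>x y. kpoly W (q - r) x y + kpoly W r x y)"
      by (rule keqI) (simp add: kpoly_add[symmetric])
    also have "keq \<dots> (\<lambda>x y. 0 + kpoly W r x y)" by (rule keq_add[OF that keq_refl])
    finally show ?thesis by simp
  qed
  have U: "kpoly W [:0, 1:] x y = kcomp W W x y" if "x \<in> space M" "y \<in> space M" for x y
    using kpoly_mult[OF that, of 1 1] by (simp add: kpoly_1[abs_def] one_pCons[symmetric])
  have U': "keq (kpoly W [:0, 1:]) (kcomp W W)" by (rule keqI) (rule U)
  have W1: "kpoly W 1 = W" by (intro ext) simp
  let ?P = "kpoly W (pCons 0 t)" and ?L = "kpoly W t"
  have r: "keq W (kpoly W (pCons 0 (pCons 0 t)))"
    using eqI[OF t] by (simp add: W1)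
  have "keq (kpoly W (pCons 0 (pCons 0 t))) (kcomp W ?P)"
    by (rule keqI) (use kpoly_mult[of _ _ 1 "pCons 0 t"] in \<open>simp add: W1\<close>)
  with r have 1: "keq W (kcomp W ?P)" by (rule keq_trans)
  have "keq (kpoly W (pCons 0 (pCons 0 t))) (kcomp (kpoly W [:0, 1:]) ?L)"
    by (rule keqI) (use kpoly_mult[of _ _ "[:0, 1:]" t] in simp)
  also have "keq \<dots> (kcomp (kcomp W W) ?L)"
    by (rule keq_comp_left[OF kpoly_kernel kernel_comp[OF W W] kpoly_kernel U'])
  finally have 2: "keq W (kcomp (kcomp W W) ?L)" using r keq_trans by blast
  \<comment> \<open>\<open>U\<close> is represented by the polynomial \<open>X\<close>, and \<open>X (1 - X\<^sup>2 t)\<close> annihilates as well.\<close>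
  have "(1 - pCons 0 (pCons 0 t)) * [:0, 1:] = [:0, 1:] - pCons 0 (pCons 0 (pCons 0 t))"
    by (simp add: algebra_simps)
  with kpoly_zero_mult[OF t, of "[:0, 1:]"]
  have "keq (kpoly W [:0, 1:]) (kpoly W (pCons 0 (pCons 0 (pCons 0 t))))"
    by (intro eqI) simp
  also have "keq \<dots> (kcomp (kpoly W [:0, 1:]) ?P)"
    by (rule keqI) (use kpoly_mult[of _ _ "[:0, 1:]" "pCons 0 t"] in simp)
  also have "keq \<dots> (kcomp (kcomp W W) ?P)"
    by (rule keq_comp_left[OF kpoly_kernel kernel_comp[OF W W] kpoly_kernel U'])
  finally have "keq (kcomp W W) (kcomp (kcomp W W) ?P)"
    using keq_sym[OF U'] keq_trans by blast
  with 1 2 show ?thesis using kpoly_kernel by blast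
qed

end

end

end

section \<open>From finite rank to step functions\<close>

context prob_space
begin

text \<open>A relation between the columns of the Gram matrix of the kernels \<open>Q i\<close> makes the corresponding
  linear combination orthogonal to each \<open>Q j\<close>, hence to itself.\<close>

lemma gram_relation:
  assumes "finite S" and Q: "\<And>i. i \<in> S \<Longrightarrow> bkernel (Q i)"
    and rel: "\<And>j. j \<in> S \<Longrightarrow> (\<Sum>i\<in>S. c i * (\<integral>x. \<integral>y. Q i x y * Q j x y \<partial>M \<partial>M)) = 0"
  shows "keq (\<lambda>x y. \<Sum>i\<in>S. c i * Q i x y) (\<lambda>x y. 0)"
proof (rule keq_zero_if_square_integral_zero)
  show "bkernel (\<lambda>x y. \<Sum>i\<in>S. c i * Q i x y)" by (intro kernel_sum kernel_scale Q)
  have "(\<integral>x. \<integral>y. (\<Sum>i\<in>S. c i * Q i x y) * (\<Sum>i\<in>S. c i * Q i x y) \<partial>M \<partial>M)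
      = (\<integral>x. \<integral>y. (\<Sum>j\<in>S. \<Sum>i\<in>S. c j * (c i * (Q i x y * Q j x y))) \<partial>M \<partial>M)"
    by (simp add: sum_product mult_ac)
  also have "\<dots> = (\<Sum>j\<in>S. \<integral>x. \<integral>y. (\<Sum>i\<in>S. c j * (c i * (Q i x y * Q j x y))) \<partial>M \<partial>M)"
    by (rule integral_sum_kernel) (intro kernel_sum kernel_scale kernel_mult Q)
  also have "\<dots> = (\<Sum>j\<in>S. \<Sum>i\<in>S. \<integral>x. \<integral>y. c j * (c i * (Q i x y * Q j x y)) \<partial>M \<partial>M)"
    by (intro sum.cong refl integral_sum_kernel kernel_scale kernel_mult Q)
  also have "\<dots> = (\<Sum>j\<in>S. c j * (\<Sum>i\<in>S. c i * (\<integral>x. \<integral>y. Q i x y * Q j x y \<partial>M \<partial>M)))"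
    by (simp add: sum_distrib_left)
  also have "\<dots> = 0" using rel by simp
  finally show "(\<integral>x. \<integral>y. (\<Sum>i\<in>S. c i * Q i x y) * (\<Sum>i\<in>S. c i * Q i x y) \<partial>M \<partial>M) = 0" .
qed

lemma finitely_many_values_if_moment_relation:
  assumes V: "bkernel V" and "finite S" "\<exists>i\<in>S. c i \<noteq> 0"
    and rel: "\<And>j. (\<Sum>i\<in>S. c i * (\<integral>x. \<integral>y. V x y ^ (i + j) \<partial>M \<partial>M)) = 0"
  shows "\<exists>F. finite F \<and> (AE x in M. AE y in M. V x y \<in> F)"
proof -
  define p where "p = (\<Sum>i\<in>S. monom (c i) i)"
  have "keq (\<lambda>x y. \<Sum>i\<in>S. c i * V x y ^ i) (\<lambda>x y. 0)"
    using assms(2) rel by (intro gram_relation) (simp_all add: kernel_power V power_add)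
  moreover have "(\<Sum>i\<in>S. c i * z ^ i) = poly p z" for z
    by (simp add: p_def poly_sum poly_monom)
  ultimately have "AE x in M. AE y in M. V x y \<in> {z. poly p z = 0}"
    by (simp add: keq_def)
  moreover obtain i where "i \<in> S" "c i \<noteq> 0" using assms(3) by blast
  then have "coeff p i \<noteq> 0" using \<open>finite S\<close> by (simp add: p_def coeff_sum)
  then have "p \<noteq> 0" by auto
  then have "finite {z. poly p z = 0}" by (rule poly_roots_finite)
  ultimately show ?thesis by blast
qed

text \<open>For symmetric \<open>W\<close> the inner product of two operator powers is the trace of their product, hence
  depends only on the sum of the exponents.\<close>

lemma trace_kpow:
  assumes W: "bkernel W" and sym: "\<And>x y. x \<in> space M \<Longrightarrow> y \<in> space M \<Longrightarrow> W x y = W y x"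
  shows "(\<integral>x. \<integral>y. kpow W a x y * kpow W b x y \<partial>M \<partial>M) = (\<integral>x. kpow W (Suc (a + b)) x x \<partial>M)"
proof (rule Bochner_Integration.integral_cong[OF refl])
  fix x assume x: "x \<in> space M"
  have "(\<integral>y. kpow W a x y * kpow W b x y \<partial>M) = kcomp (kpow W a) (kpow W b) x x"
    unfolding kcomp_def
    by (rule Bochner_Integration.integral_cong[OF refl]) (simp add: kpow_sym[OF W sym x])
  then show "(\<integral>y. kpow W a x y * kpow W b x y \<partial>M) = kpow W (Suc (a + b)) x x"
    by (simp only: kpow_add[OF W x x])
qed

lemma annihilating_poly_if_trace_relation:
  assumes W: "bkernel W" and sym: "\<And>x y. x \<in> space M \<Longrightarrow> y \<in> space M \<Longrightarrow> W x y = W y x"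
    and "finite S" "S \<subseteq> {1..}" "\<exists>i\<in>S. c i \<noteq> 0"
    and rel: "\<And>j. j \<ge> 1 \<Longrightarrow> (\<Sum>i\<in>S. c i * (\<integral>x. kpow W (i + j - 1) x x \<partial>M)) = 0"
  shows "\<exists>p. p \<noteq> 0 \<and> keq (kpoly W p) (\<lambda>x y. 0)"
proof (intro exI conjI)
  define p where "p = (\<Sum>i\<in>S. monom (c i) (i - 1))"
  have inj: "i - 1 = j - 1 \<longleftrightarrow> i = j" if "i \<in> S" "j \<in> S" for i j
    using subsetD[OF assms(4) that(1)] subsetD[OF assms(4) that(2)] by auto
  obtain k where k: "k \<in> S" "c k \<noteq> 0" using assms(5) by blast
  have "coeff p (k - 1) = (\<Sum>i\<in>S. if i = k then c i else 0)"
    unfolding p_def coeff_sum using inj k(1) by (intro sum.cong) (auto simp: coeff_monom)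
  then show "p \<noteq> 0" using k \<open>finite S\<close> by auto
  have "kpoly W q = (\<lambda>x y. \<Sum>i\<in>T. c i * kpow W (i - 1) x y)"
    if "q = (\<Sum>i\<in>T. monom (c i) (i - 1))" "finite T" for T q
    using that(2,1)
  proof (induction T arbitrary: q rule: finite_induct)
    case empty
    then show ?case by (intro ext) (simp add: kpoly_0[OF W])
  next
    case (insert i T)
    have "kpoly W (monom (c i) (i - 1)) x y = c i * kpow W (i - 1) x y" for x y
      by (subst kpoly_eq[OF W degree_monom_le]) (simp add: if_distrib[of "\<lambda>u. u * _"] cong: if_cong)
    with insert show ?case by (intro ext) (simp add: kpoly_add[OF W])
  qed
  from this[OF p_def \<open>finite S\<close>]
  have kp: "kpoly W p = (\<lambda>x y. \<Sum>i\<in>S. c i * kpow W (i - 1) x y)" .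
  show "keq (kpoly W p) (\<lambda>x y. 0)"
    unfolding kp
  proof (rule gram_relation[OF \<open>finite S\<close>])
    show "bkernel (kpow W (i - 1))" for i by (rule kpow_kernel[OF W])
    fix j assume "j \<in> S"
    then have j: "j \<ge> 1" using assms(4) by auto
    have "Suc (i - 1 + (j - 1)) = i + j - 1" if "i \<in> S" for i
      using subsetD[OF assms(4) that] j by auto
    then show "(\<Sum>i\<in>S. c i * (\<integral>x. \<integral>y. kpow W (i - 1) x y * kpow W (j - 1) x y \<partial>M \<partial>M)) = 0"
      using rel[OF j] by (simp add: trace_kpow[OF W sym] cong: sum.cong)
  qed
qed

text \<open>A measurable partition into finitely many parts, encoded by the function that maps a point to the
  number of its part. Parts of measure zero are allowed.\<close>

definition finite_colouring :: "('a \<Rightarrow> nat) \<Rightarrow> bool" where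
  "finite_colouring c \<longleftrightarrow> c \<in> measurable M (count_space UNIV) \<and> finite (c ` space M)"

text \<open>The triangle inequality for the \<open>L\<^sup>1\<close> distance.\<close>

lemma l1_dist_bound:
  assumes "bounded_measurable M f" "bounded_measurable M g" "bounded_measurable M h"
  shows "(\<integral>x. \<bar>f x - h x\<bar> \<partial>M) \<le> (\<integral>x. \<bar>f x - g x\<bar> \<partial>M) + (\<integral>x. \<bar>g x - h x\<bar> \<partial>M)"
proof -
  have i: "integrable M (\<lambda>x. \<bar>f x - h x\<bar>)" "integrable M (\<lambda>x. \<bar>f x - g x\<bar>)" "integrable M (\<lambda>x. \<bar>g x - h x\<bar>)"
    using assms by (auto intro!: bounded_measurable_integrable bounded_measurable_abs bounded_measurable_diff)
  then have "(\<integral>x. \<bar>f x - h x\<bar> \<partial>M) \<le> (\<integral>x. \<bar>f x - g x\<bar> + \<bar>g x - h x\<bar> \<partial>M)"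
    by (intro integral_mono) auto
  then show ?thesis using i by simp
qed

text \<open>The rows of \<open>V S\<close> lie in a finite-dimensional space of functions and have bounded coefficients.
  Rounding the coefficients to a grid yields a partition into finitely many parts, in each of which
  the rows are close in \<open>L\<^sup>1\<close>.\<close>

lemma tensor_rows_totally_bounded:
  assumes V: "bkernel V" and "tensor S" "e > 0"
  shows "\<exists>c. finite_colouring c \<and> (\<forall>x\<in>space M. \<forall>x'\<in>space M. c x = c x' \<longrightarrow>
           (\<integral>y. \<bar>kcomp V S x y - kcomp V S x' y\<bar> \<partial>M) < e)"
  using assms(2,3)
proof (induction arbitrary: e rule: tensor.induct)
  case (tensor_base a b)
  define \<alpha> where "\<alpha> = (\<lambda>x. \<integral>z. V x z * a z \<partial>M)"
  have \<alpha>: "bounded_measurable M \<alpha>"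
    unfolding \<alpha>_def by (rule bounded_measurable_row_integral[OF kernel_mult[OF V kernel_snd[OF tensor_base(1)]]])
  note [measurable] = bounded_measurableD[OF \<alpha>]
  obtain A where A: "A > 0" "\<And>x. x \<in> space M \<Longrightarrow> \<bar>\<alpha> x\<bar> \<le> A"
    using bounded_measurable_bound[OF \<alpha>] by blast
  obtain B where B: "B > 0" "\<And>x. x \<in> space M \<Longrightarrow> \<bar>b x\<bar> \<le> B"
    using bounded_measurable_bound[OF tensor_base(2)] by blast
  \<comment> \<open>The mesh of the grid for the coefficient \<open>\<alpha> x\<close> of \<open>b\<close> in the row at \<open>x\<close>.\<close>
  define h where "h = e / (2 * B)"
  have h: "h > 0" using tensor_base(3) B(1) by (simp add: h_def)
  define c where "c = (\<lambda>x. nat \<lfloor>(\<alpha> x + A) / h\<rfloor>)"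
  have eq: "kcomp V (\<lambda>x y. a x * b y) x y = \<alpha> x * b y" for x y
    unfolding kcomp_def \<alpha>_def mult.assoc[symmetric] by simp
  have "(\<integral>y. \<bar>\<alpha> x * b y - \<alpha> x' * b y\<bar> \<partial>M) < e"
    if x: "x \<in> space M" "x' \<in> space M" and cc: "c x = c x'" for x x'
  proof -
    have nonneg: "(\<alpha> x + A) / h \<ge> 0" "(\<alpha> x' + A) / h \<ge> 0"
      using A(2)[OF x(1)] A(2)[OF x(2)] h by (auto simp: abs_le_iff)
    then have "\<lfloor>(\<alpha> x + A) / h\<rfloor> = \<lfloor>(\<alpha> x' + A) / h\<rfloor>"
      using cc by (simp add: c_def eq_nat_nat_iff)
    then have "\<bar>(\<alpha> x + A) / h - (\<alpha> x' + A) / h\<bar> \<le> 1" by linarith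
    then have "\<bar>\<alpha> x - \<alpha> x'\<bar> \<le> h"
      using h by (simp add: diff_divide_distrib[symmetric])
    have "\<bar>\<integral>y. \<bar>\<alpha> x * b y - \<alpha> x' * b y\<bar> \<partial>M\<bar> \<le> h * B"
    proof (rule abs_integral_le)
      show "(\<lambda>y. \<bar>\<alpha> x * b y - \<alpha> x' * b y\<bar>) \<in> borel_measurable M"
        using bounded_measurableD[OF tensor_base(2)] by measurable
      show "\<bar>\<bar>\<alpha> x * b y - \<alpha> x' * b y\<bar>\<bar> \<le> h * B" if "y \<in> space M" for y
        using \<open>\<bar>\<alpha> x - \<alpha> x'\<bar> \<le> h\<close> B(2)[OF that] B(1) h
        by (simp add: left_diff_distrib[symmetric] abs_mult mult_mono)
    qed
    also have "h * B < e" using B(1) tensor_base(3) by (simp add: h_def)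
    finally show ?thesis by simp
  qed
  moreover have "finite_colouring c"
    unfolding finite_colouring_def
  proof
    show "c \<in> measurable M (count_space UNIV)" unfolding c_def by measurable
    have "c ` space M \<subseteq> {..nat \<lfloor>2 * A / h\<rfloor>}"
      unfolding c_def using A h by (auto intro!: nat_mono floor_mono divide_right_mono simp: abs_le_iff)
    then show "finite (c ` space M)" by (rule finite_subset) simp
  qed
  ultimately show ?case unfolding eq by blast
next
  case (tensor_add S T)
  have "e / 2 > 0" using tensor_add(5) by simp
  obtain c where c: "finite_colouring c" "\<And>x x'. x \<in> space M \<Longrightarrow> x' \<in> space M \<Longrightarrow> c x = c x' \<Longrightarrow>
           (\<integral>y. \<bar>kcomp V S x y - kcomp V S x' y\<bar> \<partial>M) < e / 2"
    using tensor_add.IH(1)[OF \<open>e / 2 > 0\<close>] by blast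
  obtain d where d: "finite_colouring d" "\<And>x x'. x \<in> space M \<Longrightarrow> x' \<in> space M \<Longrightarrow> d x = d x' \<Longrightarrow>
           (\<integral>y. \<bar>kcomp V T x y - kcomp V T x' y\<bar> \<partial>M) < e / 2"
    using tensor_add.IH(2)[OF \<open>e / 2 > 0\<close>] by blast
  note [measurable] = c(1)[unfolded finite_colouring_def, THEN conjunct1]
    d(1)[unfolded finite_colouring_def, THEN conjunct1]
  let ?c = "\<lambda>x. prod_encode (c x, d x)"
  have "?c ` space M \<subseteq> prod_encode ` (c ` space M \<times> d ` space M)" by auto
  then have "finite (?c ` space M)"
    by (rule finite_subset) (use c(1) d(1) in \<open>simp add: finite_colouring_def\<close>)
  moreover have "?c \<in> measurable M (count_space UNIV)" by measurable
  ultimately have fc: "finite_colouring ?c" by (simp add: finite_colouring_def)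
  have kS: "bkernel (kcomp V S)" and kT: "bkernel (kcomp V T)"
    by (intro kernel_comp V tensor_kernel tensor_add(1,2))+
  have "(\<integral>y. \<bar>kcomp V (\<lambda>x y. S x y + T x y) x y - kcomp V (\<lambda>x y. S x y + T x y) x' y\<bar> \<partial>M) < e"
    if x: "x \<in> space M" "x' \<in> space M" and cc: "?c x = ?c x'" for x x'
  proof -
    have cd: "c x = c x'" "d x = d x'" using cc by simp_all
    have "(\<integral>y. \<bar>kcomp V (\<lambda>x y. S x y + T x y) x y - kcomp V (\<lambda>x y. S x y + T x y) x' y\<bar> \<partial>M)
       = (\<integral>y. \<bar>(kcomp V S x y + kcomp V T x y) - (kcomp V S x' y + kcomp V T x' y)\<bar> \<partial>M)"
      by (intro Bochner_Integration.integral_cong refl)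
         (simp add: comp_add_right V tensor_kernel tensor_add(1,2) x)
    also have "\<dots> \<le> (\<integral>y. \<bar>(kcomp V S x y + kcomp V T x y) - (kcomp V S x' y + kcomp V T x y)\<bar> \<partial>M) +
        (\<integral>y. \<bar>(kcomp V S x' y + kcomp V T x y) - (kcomp V S x' y + kcomp V T x' y)\<bar> \<partial>M)"
      by (intro l1_dist_bound bounded_measurable_add bounded_measurable_row kS kT x)
    also have "\<dots> < e" using c(2)[OF x cd(1)] d(2)[OF x cd(2)] by simp
    finally show ?thesis .
  qed
  with fc show ?case by blast
qed

lemma finite_gap:
  assumes "finite (F :: real set)"
  shows "\<exists>\<delta>>0. \<forall>u\<in>F. \<forall>v\<in>F. \<bar>u - v\<bar> < \<delta> \<longrightarrow> u = v"
proof -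
  define Q where "Q = {p \<in> F \<times> F. fst p \<noteq> snd p}"
  let ?D = "insert 1 ((\<lambda>p. \<bar>fst p - snd p\<bar>) ` Q)"
  have "finite Q" unfolding Q_def by (rule finite_subset[of _ "F \<times> F"]) (auto simp: assms)
  then have fin: "finite ?D" by simp
  have "Min ?D \<in> ?D" by (rule Min_in[OF fin]) auto
  moreover have "\<forall>t\<in>?D. t > 0" by (auto simp: Q_def)
  ultimately have "Min ?D > 0" by (rule bspec[rotated])
  moreover have "u = v" if "u \<in> F" "v \<in> F" "\<bar>u - v\<bar> < Min ?D" for u v
  proof (rule ccontr)
    assume "u \<noteq> v"
    then have "(u, v) \<in> Q" using that(1,2) by (simp add: Q_def)
    then have "\<bar>u - v\<bar> \<in> ?D" by force
    then have "Min ?D \<le> \<bar>u - v\<bar>" by (rule Min_le[OF fin])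
    with that(3) show False by simp
  qed
  ultimately show ?thesis by blast
qed

text \<open>The colouring comes from total boundedness of the rows of \<open>V P\<close>, with \<open>P\<close> replaced by a finite sum
  of products. Points of the same colour have rows that are close in \<open>L\<^sup>1\<close>; applying \<open>P\<close> shows that
  the rows are uniformly closer than the smallest gap \<open>\<delta>\<close> between the values of \<open>V\<close>, so they agree.\<close>

lemma finitely_many_rows:
  assumes V: "bkernel V" and P: "bkernel P" and VP: "keq V (kcomp V P)"
    and F: "finite F" "AE x in M. AE y in M. V x y \<in> F"
  shows "\<exists>c G. finite_colouring c \<and> (AE x in M. x \<in> G) \<and> G \<subseteq> space M \<and>
    (\<forall>x\<in>G. \<forall>x'\<in>G. c x = c x' \<longrightarrow> (AE y in M. V x y = V x' y))"
proof -
  let ?V = "kcomp V P"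
  have V': "bkernel ?V" by (rule kernel_comp[OF V P])
  obtain D where D: "D > 0" "\<And>x y. x \<in> space M \<Longrightarrow> y \<in> space M \<Longrightarrow> \<bar>V x y\<bar> \<le> D"
    using kernel_bound[OF V] by blast
  obtain C where C: "C > 0" "\<And>x y. x \<in> space M \<Longrightarrow> y \<in> space M \<Longrightarrow> \<bar>P x y\<bar> \<le> C"
    using kernel_bound[OF P] by blast
  obtain \<delta> where \<delta>: "\<delta> > 0" "\<And>u v. u \<in> F \<Longrightarrow> v \<in> F \<Longrightarrow> \<bar>u - v\<bar> < \<delta> \<Longrightarrow> u = v"
    using finite_gap[OF F(1)] by blast
  \<comment> \<open>Three errors of size \<open>e\<close> have to be absorbed after multiplication by the bound \<open>C\<close> of \<open>P\<close>.\<close>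
  define e where "e = \<delta> / (4 * C)"
  have e: "e > 0" using \<delta>(1) C(1) by (simp add: e_def)
  then have "e / D > 0" using D(1) by simp
  then obtain S where S: "tensor S" "(\<integral>x. \<integral>y. \<bar>P x y - S x y\<bar> \<partial>M \<partial>M) < e / D"
    using kernel_tensor_approx[OF P] by blast
  note kS = tensor_kernel[OF S(1)]
  obtain c where c: "finite_colouring c" "\<And>x x'. x \<in> space M \<Longrightarrow> x' \<in> space M \<Longrightarrow> c x = c x' \<Longrightarrow>
           (\<integral>y. \<bar>kcomp V S x y - kcomp V S x' y\<bar> \<partial>M) < e"
    using tensor_rows_totally_bounded[OF V S(1) e] by blast
  have approx: "(\<integral>y. \<bar>?V x y - kcomp V S x y\<bar> \<partial>M) \<le> e" if x: "x \<in> space M" for x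
  proof -
    have k: "bkernel (\<lambda>z y. \<bar>P z y - S z y\<bar>)"
      by (rule kernelI, rule bounded_measurable_abs, rule bounded_measurable_pair[OF kernel_diff[OF P kS]])
    have k': "bkernel (\<lambda>y z. D * \<bar>P z y - S z y\<bar>)" by (rule kernel_scale[OF kernel_flip[OF k]])
    have "(\<integral>y. \<bar>?V x y - kcomp V S x y\<bar> \<partial>M) \<le> (\<integral>y. \<integral>z. D * \<bar>P z y - S z y\<bar> \<partial>M \<partial>M)"
    proof (rule integral_mono)
      show "integrable M (\<lambda>y. \<bar>?V x y - kcomp V S x y\<bar>)"
        by (intro bounded_measurable_integrable bounded_measurable_abs
            bounded_measurable_diff bounded_measurable_row[OF V' x] bounded_measurable_row[OF kernel_comp[OF V kS] x])
      show "integrable M (\<lambda>y. \<integral>z. D * \<bar>P z y - S z y\<bar> \<partial>M)"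
        by (rule bounded_measurable_integrable[OF bounded_measurable_row_integral[OF k']])
      fix y assume y: "y \<in> space M"
      have i: "integrable M (\<lambda>z. V x z * P z y)" "integrable M (\<lambda>z. V x z * S z y)"
        by (rule integrable_comp_integrand[OF V _ x y], rule P) (rule integrable_comp_integrand[OF V _ x y], rule kS)
      have "\<bar>?V x y - kcomp V S x y\<bar> = \<bar>\<integral>z. V x z * P z y - V x z * S z y \<partial>M\<bar>"
        unfolding kcomp_def by (subst Bochner_Integration.integral_diff[OF i]) simp
      also have "\<dots> \<le> (\<integral>z. \<bar>V x z * P z y - V x z * S z y\<bar> \<partial>M)" by (rule integral_abs_bound)
      also have "\<dots> \<le> (\<integral>z. D * \<bar>P z y - S z y\<bar> \<partial>M)"
      proof (rule integral_mono)
        show "integrable M (\<lambda>z. \<bar>V x z * P z y - V x z * S z y\<bar>)" using i by simp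
        show "integrable M (\<lambda>z. D * \<bar>P z y - S z y\<bar>)"
          by (rule bounded_measurable_integrable[OF bounded_measurable_row[OF k' y]])
        fix z assume z: "z \<in> space M"
        show "\<bar>V x z * P z y - V x z * S z y\<bar> \<le> D * \<bar>P z y - S z y\<bar>"
          using D(2)[OF x z] by (simp add: right_diff_distrib[symmetric] abs_mult mult_right_mono)
      qed
      finally show "\<bar>?V x y - kcomp V S x y\<bar> \<le> (\<integral>z. D * \<bar>P z y - S z y\<bar> \<partial>M)" .
    qed
    also have "\<dots> = D * (\<integral>y. \<integral>z. \<bar>P z y - S z y\<bar> \<partial>M \<partial>M)" by simp
    also have "(\<integral>y. \<integral>z. \<bar>P z y - S z y\<bar> \<partial>M \<partial>M) = (\<integral>z. \<integral>y. \<bar>P z y - S z y\<bar> \<partial>M \<partial>M)"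
      by (rule kernel_integral_swap[OF kernel_flip[OF k]])
    also have "D * \<dots> \<le> e" using S(2) D(1) by (simp add: field_simps)
    finally show ?thesis .
  qed
  define G where "G = {x \<in> space M. (AE y in M. V x y = ?V x y) \<and> (AE y in M. V x y \<in> F)}"
  have "AE x in M. x \<in> G"
    using VP[unfolded keq_def] F(2) AE_space by eventually_elim (simp add: G_def)
  moreover have "AE y in M. V x y = V x' y" if xG: "x \<in> G" "x' \<in> G" and cc: "c x = c x'" for x x'
  proof -
    have x: "x \<in> space M" "x' \<in> space M"
      and ae: "AE y in M. V x y = ?V x y" "AE y in M. V x' y = ?V x' y"
        "AE y in M. V x y \<in> F" "AE y in M. V x' y \<in> F"
      using xG by (auto simp: G_def)
    note bm = bounded_measurable_row[OF V x(1)] bounded_measurable_row[OF V x(2)] bounded_measurable_row[OF V' x(1)] bounded_measurable_row[OF V' x(2)]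
      bounded_measurable_row[OF kernel_comp[OF V kS] x(1)] bounded_measurable_row[OF kernel_comp[OF V kS] x(2)]
    have "(\<integral>y. \<bar>V x y - V x' y\<bar> \<partial>M) = (\<integral>y. \<bar>?V x y - ?V x' y\<bar> \<partial>M)"
    proof (rule integral_cong_AE)
      show "AE y in M. \<bar>V x y - V x' y\<bar> = \<bar>?V x y - ?V x' y\<bar>" using ae(1,2) by eventually_elim simp
    qed (use bm(1-4)[THEN bounded_measurableD] in measurable)
    also have "\<dots> \<le> (\<integral>y. \<bar>?V x y - kcomp V S x y\<bar> \<partial>M) + (\<integral>y. \<bar>kcomp V S x y - ?V x' y\<bar> \<partial>M)"
      by (rule l1_dist_bound) (fact bm)+
    also have "(\<integral>y. \<bar>kcomp V S x y - ?V x' y\<bar> \<partial>M) \<le>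
        (\<integral>y. \<bar>kcomp V S x y - kcomp V S x' y\<bar> \<partial>M) + (\<integral>y. \<bar>kcomp V S x' y - ?V x' y\<bar> \<partial>M)"
      by (rule l1_dist_bound) (fact bm)+
    finally have dist: "(\<integral>y. \<bar>V x y - V x' y\<bar> \<partial>M) < 3 * e"
      using approx[OF x(1)] approx[OF x(2)] c(2)[OF x cc] by (simp add: abs_minus_commute)
    have close: "\<bar>?V x y - ?V x' y\<bar> < \<delta>" if y: "y \<in> space M" for y
    proof -
      have i: "integrable M (\<lambda>z. V x z * P z y)" "integrable M (\<lambda>z. V x' z * P z y)"
        by (rule integrable_comp_integrand[OF V P x(1) y], rule integrable_comp_integrand[OF V P x(2) y])
      have "\<bar>?V x y - ?V x' y\<bar> = \<bar>\<integral>z. V x z * P z y - V x' z * P z y \<partial>M\<bar>"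
        unfolding kcomp_def by (subst Bochner_Integration.integral_diff[OF i]) simp
      also have "\<dots> \<le> (\<integral>z. \<bar>V x z * P z y - V x' z * P z y\<bar> \<partial>M)" by (rule integral_abs_bound)
      also have "\<dots> \<le> (\<integral>z. C * \<bar>V x z - V x' z\<bar> \<partial>M)"
      proof (rule integral_mono)
        show "integrable M (\<lambda>z. \<bar>V x z * P z y - V x' z * P z y\<bar>)" using i by simp
        show "integrable M (\<lambda>z. C * \<bar>V x z - V x' z\<bar>)"
          by (intro bounded_measurable_integrable bounded_measurable_mult bounded_measurable_const
              bounded_measurable_abs bounded_measurable_diff bm(1,2))
        fix z assume z: "z \<in> space M"
        have "\<bar>V x z * P z y - V x' z * P z y\<bar> = \<bar>P z y\<bar> * \<bar>V x z - V x' z\<bar>"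
          by (simp add: left_diff_distrib[symmetric] abs_mult)
        also have "\<dots> \<le> C * \<bar>V x z - V x' z\<bar>" using C(2)[OF z y] by (intro mult_right_mono) auto
        finally show "\<bar>V x z * P z y - V x' z * P z y\<bar> \<le> C * \<bar>V x z - V x' z\<bar>" .
      qed
      also have "\<dots> = C * (\<integral>z. \<bar>V x z - V x' z\<bar> \<partial>M)" by simp
      also have "\<dots> < C * (3 * e)" using dist C(1) by simp
      also have "\<dots> < \<delta>" using C(1) \<delta>(1) by (simp add: e_def)
      finally show ?thesis .
    qed
    show ?thesis
      using ae AE_space
    proof eventually_elim
      case (elim y)
      then show ?case using close[of y] \<delta>(2) by metis
    qed
  qed
  moreover have "G \<subseteq> space M" by (auto simp: G_def)
  ultimately show ?thesis using c(1) by blast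
qed

text \<open>The row of \<open>V L\<close> at \<open>x\<close> is determined by the colour of \<open>x\<close>, which makes \<open>W\<close> a step function in its
  first variable. Symmetry then makes it one in both: \<open>W(x, y)\<close> equals \<open>g (c x) y\<close> and
  \<open>g (c y) x\<close> almost everywhere, and a fixed generic point \<open>s i\<close> of each colour \<open>i\<close> is substituted
  for \<open>x\<close> in the latter.\<close>

lemma step_function_if_finitely_many_rows:
  assumes W: "bkernel W" and sym: "\<And>x y. x \<in> space M \<Longrightarrow> y \<in> space M \<Longrightarrow> W x y = W y x"
    and V: "bkernel V" and L: "bkernel L" and WVL: "keq W (kcomp V L)"
    and G: "AE x in M. x \<in> G" "G \<subseteq> space M"
    and rows: "\<And>x x'. x \<in> G \<Longrightarrow> x' \<in> G \<Longrightarrow> c x = (c x' :: nat) \<Longrightarrow> AE y in M. V x y = V x' y"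
  shows "\<exists>\<beta>. keq W (\<lambda>x y. \<beta> (c x) (c y))"
proof -
  let ?W = "kcomp V L"
  have W': "bkernel ?W" by (rule kernel_comp[OF V L])
  define r where "r = (\<lambda>i. SOME x. x \<in> G \<and> c x = i)"
  have r: "r (c x) \<in> G \<and> c (r (c x)) = c x" if "x \<in> G" for x
    unfolding r_def using that by (intro someI[of "\<lambda>z. z \<in> G \<and> c z = c x" x]) simp
  define g where "g = (\<lambda>i. ?W (r i))"
  have g: "?W x y = g (c x) y" if "x \<in> G" "y \<in> space M" for x y
    unfolding g_def
    by (rule comp_AE_cong_left[OF V V L])
       (use that r[of x] G(2) rows[of x "r (c x)"] in auto)
  have "keq ?W (\<lambda>x y. ?W y x)"
  proof -
    have "keq ?W W" by (rule keq_sym[OF WVL])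
    also have "keq W (\<lambda>x y. W y x)" by (rule keqI) (rule sym)
    also have "keq \<dots> (\<lambda>x y. ?W y x)" by (rule keq_flip[OF W W' WVL])
    finally show ?thesis .
  qed
  define H where "H = {x \<in> G. AE y in M. g (c x) y = g (c y) x}"
  have H: "AE x in M. x \<in> H"
    using \<open>keq ?W (\<lambda>x y. ?W y x)\<close>[unfolded keq_def] G(1)
  proof eventually_elim
    case (elim x)
    have "AE y in M. g (c x) y = g (c y) x"
      using elim(1) G(1) AE_space
    proof eventually_elim
      case (elim y)
      then show ?case using g[OF \<open>x \<in> G\<close>, of y] g[of y x] \<open>x \<in> G\<close> G(2) by auto
    qed
    with elim show ?case by (simp add: H_def)
  qed
  define s where "s = (\<lambda>i. SOME x. x \<in> H \<and> c x = i)"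
  have s: "s (c x) \<in> H \<and> c (s (c x)) = c x" if "x \<in> H" for x
    unfolding s_def using that by (intro someI[of "\<lambda>z. z \<in> H \<and> c z = c x" x]) simp
  have "keq ?W (\<lambda>x y. g (c y) (s (c x)))"
    unfolding keq_def using H
  proof eventually_elim
    case (elim x)
    from s[OF elim] have "AE y in M. g (c x) y = g (c y) (s (c x))" by (auto simp: H_def)
    then show ?case using AE_space
    proof eventually_elim
      case (elim y)
      then show ?case using g[of x y] \<open>x \<in> H\<close> by (simp add: H_def)
    qed
  qed
  with WVL have "keq W (\<lambda>x y. g (c y) (s (c x)))" by (rule keq_trans)
  then show ?thesis by (intro exI[of _ "\<lambda>i j. g j (s i)"])
qed

lemma step_function_if_finite_values:
  assumes W: "bkernel W" and sym: "\<And>x y. x \<in> space M \<Longrightarrow> y \<in> space M \<Longrightarrow> W x y = W y x"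
    and V: "bkernel V" and P: "bkernel P" and L: "bkernel L"
    and "keq V (kcomp V P)" and WVL: "keq W (kcomp V L)"
    and "finite F" "AE x in M. AE y in M. V x y \<in> F"
  shows "\<exists>c \<beta>. finite_colouring c \<and> keq W (\<lambda>x y. \<beta> (c x) (c y))"
proof -
  obtain c G where c: "finite_colouring c" "AE x in M. x \<in> G" "G \<subseteq> space M"
      "\<And>x x'. x \<in> G \<Longrightarrow> x' \<in> G \<Longrightarrow> c x = c x' \<Longrightarrow> (AE y in M. V x y = V x' y)"
    using finitely_many_rows[OF V P assms(6,8,9)] by blast
  show ?thesis
    using step_function_if_finitely_many_rows[OF W sym V L WVL c(2-4)] c(1) by blast
qed

end

section \<open>Homomorphism densities of parallel edges, bipartite graphs and cycles\<close>

lemma is_multigraph_edge: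
  assumes "is_multigraph F" "e \<in># edges F"
  shows "Min e \<in> nodes F" "Max e \<in> nodes F" "Min e \<noteq> Max e"
proof -
  have e: "e \<subseteq> nodes F" "card e = 2" using assms by (auto simp: is_multigraph_def)
  then have "finite e" "e \<noteq> {}" by (auto intro: card_ge_0_finite)
  then show "Min e \<in> nodes F" "Max e \<in> nodes F" using e(1) by (meson Min_in Max_in subsetD)+
  show "Min e \<noteq> Max e"
  proof
    assume "Min e = Max e"
    then have "x = y" if "x \<in> e" "y \<in> e" for x y
      using that \<open>finite e\<close> by (metis Max_ge Min_le antisym order_trans)
    then have "card e \<le> 1" by (metis One_nat_def card_le_Suc0_iff_eq \<open>finite e\<close>)
    with e(2) show False by simp
  qed
qed

context prob_space
begin

text \<open>The density of \<open>F\<close> in \<open>W\<close> over the probability space \<open>M\<close>, without completion of the product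
  measure; the kernels to which it is applied are measurable for the product measure.\<close>

definition hom_density :: "multigraph \<Rightarrow> ('a \<Rightarrow> 'a \<Rightarrow> real) \<Rightarrow> real" where
  "hom_density F W =
     (\<integral>x. (\<Prod>e\<in>#edges F. W (x (Min e)) (x (Max e))) \<partial>(\<Pi>\<^sub>M i\<in>nodes F. M))"

lemma product_prob_space_const: "product_prob_space (\<lambda>i::nat. M)"
  by unfold_locales

lemma product_sigma_finite_const: "product_sigma_finite (\<lambda>i::nat. M)"
  by unfold_locales

lemma prob_space_PiM_const: "prob_space (\<Pi>\<^sub>M i\<in>(I::nat set). M)"
  by (rule prob_space_PiM) (rule prob_space_axioms)

text \<open>Two different coordinates of a random point of the product space are independent.\<close>

lemma distr_two_coordinates:
  fixes I :: "nat set"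
  assumes "i \<in> I" "j \<in> I" "i \<noteq> j"
  shows "distr (\<Pi>\<^sub>M i\<in>I. M) (M \<Otimes>\<^sub>M M) (\<lambda>x. (x i, x j)) = M \<Otimes>\<^sub>M M"
proof (rule pair_measure_eqI[symmetric])
  interpret PP: product_prob_space "\<lambda>i::nat. M" I by (rule product_prob_space_const)
  show "sigma_finite_measure M" "sigma_finite_measure M" by unfold_locales
  show "sets (M \<Otimes>\<^sub>M M) = sets (distr (\<Pi>\<^sub>M i\<in>I. M) (M \<Otimes>\<^sub>M M) (\<lambda>x. (x i, x j)))" by simp
  fix A B assume A: "A \<in> sets M" and B: "B \<in> sets M"
  let ?X = "\<lambda>k. if k = i then A else B"
  have m: "(\<lambda>x. (x i, x j)) \<in> measurable (\<Pi>\<^sub>M i\<in>I. M) (M \<Otimes>\<^sub>M M)"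
    using assms by (intro measurable_Pair measurable_component_singleton)
  have "emeasure (distr (\<Pi>\<^sub>M i\<in>I. M) (M \<Otimes>\<^sub>M M) (\<lambda>x. (x i, x j))) (A \<times> B)
      = emeasure (\<Pi>\<^sub>M i\<in>I. M) {x \<in> space (\<Pi>\<^sub>M i\<in>I. M). \<forall>k\<in>{i, j}. x k \<in> ?X k}"
    using A B assms(3) by (subst emeasure_distr[OF m]) (auto intro!: arg_cong[where f = "emeasure _"])
  also have "\<dots> = (\<Prod>k\<in>{i, j}. emeasure M (?X k))"
    using assms A B by (intro PP.emeasure_PiM_Collect) auto
  also have "\<dots> = emeasure M A * emeasure M B" using assms(3) by simp
  finally show "emeasure M A * emeasure M B =
      emeasure (distr (\<Pi>\<^sub>M i\<in>I. M) (M \<Otimes>\<^sub>M M) (\<lambda>x. (x i, x j))) (A \<times> B)" by simp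
qed

lemma AE_two_coordinates:
  fixes I :: "nat set"
  assumes ij: "i \<in> I" "j \<in> I" "i \<noteq> j" and P: "AE p in M \<Otimes>\<^sub>M M. P (fst p) (snd p)"
  shows "AE x in (\<Pi>\<^sub>M i\<in>I. M). P (x i) (x j)"
proof -
  have m: "(\<lambda>x. (x i, x j)) \<in> measurable (\<Pi>\<^sub>M i\<in>I. M) (M \<Otimes>\<^sub>M M)"
    using ij by (intro measurable_Pair measurable_component_singleton)
  have "AE p in distr (\<Pi>\<^sub>M i\<in>I. M) (M \<Otimes>\<^sub>M M) (\<lambda>x. (x i, x j)). P (fst p) (snd p)"
    unfolding distr_two_coordinates[OF ij] by (rule P)
  from AE_distrD[OF m this] show ?thesis by simp
qed

lemma integral_two_coordinates:
  fixes I :: "nat set"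
  assumes ij: "i \<in> I" "j \<in> I" "i \<noteq> j" and K: "bkernel K"
  shows "(\<integral>x. K (x i) (x j) \<partial>(\<Pi>\<^sub>M i\<in>I. M)) = (\<integral>x. \<integral>y. K x y \<partial>M \<partial>M)"
proof -
  have m: "(\<lambda>x. (x i, x j)) \<in> measurable (\<Pi>\<^sub>M i\<in>I. M) (M \<Otimes>\<^sub>M M)"
    using ij by (intro measurable_Pair measurable_component_singleton)
  have "(\<integral>x. \<integral>y. K x y \<partial>M \<partial>M) = (\<integral>p. K (fst p) (snd p) \<partial>distr (\<Pi>\<^sub>M i\<in>I. M) (M \<Otimes>\<^sub>M M) (\<lambda>x. (x i, x j)))"
    unfolding distr_two_coordinates[OF ij] by (rule kernel_integral_pair[OF K])
  also have "\<dots> = (\<integral>x. K (x i) (x j) \<partial>(\<Pi>\<^sub>M i\<in>I. M))"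
    by (subst integral_distr[OF m bounded_measurableD[OF bounded_measurable_pair[OF K]]]) simp
  finally show ?thesis by simp
qed

lemma bounded_measurable_coordinates:
  fixes I :: "nat set"
  assumes "i \<in> I" "j \<in> I" "bkernel K"
  shows "bounded_measurable (\<Pi>\<^sub>M i\<in>I. M) (\<lambda>x. K (x i) (x j))"
  using assms by (intro bounded_measurable_kernel measurable_component_singleton)

lemma bounded_measurable_density_integrand:
  assumes "is_multigraph F" "bkernel W"
  shows "bounded_measurable (\<Pi>\<^sub>M i\<in>nodes F. M) (\<lambda>x. \<Prod>e\<in>#edges F. W (x (Min e)) (x (Max e)))"
  using is_multigraph_edge[OF assms(1)] assms(2)
  by (intro bounded_measurable_prod_mset bounded_measurable_coordinates)

lemma AE_prod_edges:
  assumes F: "is_multigraph F" and P: "AE p in M \<Otimes>\<^sub>M M. W (fst p) (snd p) = W' (fst p) (snd p)"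
  shows "AE x in (\<Pi>\<^sub>M i\<in>nodes F. M).
     (\<Prod>e\<in>#edges F. W (x (Min e)) (x (Max e))) = (\<Prod>e\<in>#edges F. W' (x (Min e)) (x (Max e)))"
proof -
  have "AE x in (\<Pi>\<^sub>M i\<in>nodes F. M). \<forall>e\<in>set_mset (edges F). W (x (Min e)) (x (Max e)) = W' (x (Min e)) (x (Max e))"
    using is_multigraph_edge[OF F] P
    by (intro AE_finite_allI finite_set_mset AE_two_coordinates[where P = "\<lambda>u v. W u v = W' u v"])
  then show ?thesis
  proof eventually_elim
    case (elim x)
    then show ?case by (intro arg_cong[where f = prod_mset] image_mset_cong) auto
  qed
qed

lemma hom_density_keq:
  assumes "is_multigraph F" "bkernel W" "bkernel W'" "keq W W'"
  shows "hom_density F W = hom_density F W'"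
  unfolding hom_density_def
  by (rule integral_cong_AE[OF bounded_measurableD[OF bounded_measurable_density_integrand[OF assms(1,2)]]
      bounded_measurableD[OF bounded_measurable_density_integrand[OF assms(1,3)]]
      AE_prod_edges[OF assms(1) assms(4)[unfolded keq_pair[OF assms(2,3)]]]])

lemma hom_density_parallel_edges:
  assumes "bkernel W"
  shows "hom_density (parallel_edges n) W = (\<integral>x. \<integral>y. W x y ^ n \<partial>M \<partial>M)"
proof -
  have "hom_density (parallel_edges n) W = (\<integral>x. W (x 0) (x 1) ^ n \<partial>(\<Pi>\<^sub>M i\<in>{0, 1::nat}. M))"
    by (simp add: hom_density_def parallel_edges_def)
  also have "\<dots> = (\<integral>x. \<integral>y. W x y ^ n \<partial>M \<partial>M)"
    by (rule integral_two_coordinates[OF _ _ _ kernel_power[OF assms]]) auto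
  finally show ?thesis .
qed

lemma hom_density_complete_bipartite:
  assumes W: "bkernel W" and sym: "\<And>x y. x \<in> space M \<Longrightarrow> y \<in> space M \<Longrightarrow> W x y = W y x"
  shows "hom_density (complete_bipartite n 2) W = (\<integral>x. \<integral>y. kcomp W W x y ^ n \<partial>M \<partial>M)"
proof -
  interpret PS: product_sigma_finite "\<lambda>i::nat. M" by (rule product_sigma_finite_const)
  let ?I = "{n, n + 1}" and ?J = "{..<n}"
  let ?f = "\<lambda>x. \<Prod>i<n. W (x i) (x n) * W (x i) (x (n + 1))"
  have nodes: "nodes (complete_bipartite n 2) = ?I \<union> ?J" by (auto simp: complete_bipartite_def)
  have two: "{n..<n + 2} = ?I" by auto
  have "hom_density (complete_bipartite n 2) W = (\<integral>x. ?f x \<partial>(\<Pi>\<^sub>M i\<in>?I \<union> ?J. M))"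
  proof -
    have "(\<Prod>e\<in>#edges (complete_bipartite n 2). W (x (Min e)) (x (Max e))) = ?f x" for x :: "nat \<Rightarrow> 'a"
    proof -
      have "(\<Prod>e\<in>#edges (complete_bipartite n 2). W (x (Min e)) (x (Max e)))
          = (\<Prod>(i, j)\<in>?J \<times> ?I. W (x (Min {i, j})) (x (Max {i, j})))"
        unfolding complete_bipartite_def two
        by (simp add: image_mset.compositionality o_def case_prod_beta prod_unfold_prod_mset)
      also have "\<dots> = (\<Prod>i<n. \<Prod>j\<in>?I. W (x (Min {i, j})) (x (Max {i, j})))"
        by (rule prod.cartesian_product[symmetric])
      also have "\<dots> = ?f x"
        by (intro prod.cong) auto
      finally show ?thesis .
    qed
    then show ?thesis
      unfolding hom_density_def nodes by simp
  qed
  also have "\<dots> = (\<integral>x. \<integral>y. ?f (merge ?I ?J (x, y)) \<partial>(\<Pi>\<^sub>M i\<in>?J. M) \<partial>(\<Pi>\<^sub>M i\<in>?I. M))"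
  proof (rule PS.product_integral_fold)
    interpret P: prob_space "\<Pi>\<^sub>M i\<in>?I \<union> ?J. M" by (rule prob_space_PiM_const)
    show "integrable (\<Pi>\<^sub>M i\<in>?I \<union> ?J. M) ?f"
      by (intro P.bounded_measurable_integrable bounded_measurable_prod bounded_measurable_mult
          bounded_measurable_coordinates W) auto
  qed auto
  also have "\<dots> = (\<integral>x. kcomp W W (x n) (x (n + 1)) ^ n \<partial>(\<Pi>\<^sub>M i\<in>?I. M))"
  proof (rule Bochner_Integration.integral_cong[OF refl])
    fix x assume "x \<in> space (\<Pi>\<^sub>M i\<in>?I. M)"
    then have x: "x n \<in> space M" "x (n + 1) \<in> space M" by (auto simp: space_PiM)
    have "(\<integral>y. ?f (merge ?I ?J (x, y)) \<partial>(\<Pi>\<^sub>M i\<in>?J. M))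
        = (\<integral>y. (\<Prod>i<n. W (y i) (x n) * W (y i) (x (n + 1))) \<partial>(\<Pi>\<^sub>M i\<in>?J. M))"
      by (intro Bochner_Integration.integral_cong refl prod.cong) (auto simp: merge_def)
    also have "\<dots> = (\<Prod>i<n. \<integral>z. W z (x n) * W z (x (n + 1)) \<partial>M)"
      by (rule PS.product_integral_prod)
        (rule finite_lessThan, intro bounded_measurable_integrable bounded_measurable_mult bounded_measurable_column[OF W] x)
    also have "(\<integral>z. W z (x n) * W z (x (n + 1)) \<partial>M) = kcomp W W (x n) (x (n + 1))"
      unfolding kcomp_def by (intro Bochner_Integration.integral_cong refl) (simp add: sym x)
    finally show "(\<integral>y. ?f (merge ?I ?J (x, y)) \<partial>(\<Pi>\<^sub>M i\<in>?J. M)) = kcomp W W (x n) (x (n + 1)) ^ n"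
      by simp
  qed
  also have "\<dots> = (\<integral>x. \<integral>y. kcomp W W x y ^ n \<partial>M \<partial>M)"
    by (rule integral_two_coordinates[OF _ _ _ kernel_power[OF kernel_comp[OF W W]]]) auto
  finally show ?thesis .
qed

text \<open>The inner nodes of a path are integrated out one at a time, starting from the last edge, which is
  absorbed into the test kernel \<open>g\<close> on the end nodes.\<close>

lemma integral_path:
  assumes W: "bkernel W" and "bkernel g"
  shows "(\<integral>x. (\<Prod>i<Suc n. W (x i) (x (Suc i))) * g (x 0) (x (Suc n)) \<partial>(\<Pi>\<^sub>M i\<in>{..<Suc (Suc n)}. M))
     = (\<integral>x. \<integral>y. kpow W n x y * g x y \<partial>M \<partial>M)"
  using assms(2)
proof (induction n arbitrary: g)
  case 0
  show ?case
    using integral_two_coordinates[of 0 "{..<Suc (Suc 0)}" "Suc 0", OF _ _ _ kernel_mult[OF W 0]] by simp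
next
  case (Suc n)
  interpret PS: product_sigma_finite "\<lambda>i::nat. M" by (rule product_sigma_finite_const)
  let ?I = "{..<Suc (Suc n)}"
  let ?f = "\<lambda>x. (\<Prod>i<Suc (Suc n). W (x i) (x (Suc i))) * g (x 0) (x (Suc (Suc n)))"
  define h where "h = (\<lambda>u v. \<integral>y. W v y * g u y \<partial>M)"
  have h: "bkernel h"
    using kernel_comp[OF Suc.prems kernel_flip[OF W]] by (simp add: h_def kcomp_def[abs_def] mult.commute)
  have ins: "{..<Suc (Suc (Suc n))} = insert (Suc (Suc n)) ?I" by auto
  have "(\<integral>x. ?f x \<partial>(\<Pi>\<^sub>M i\<in>{..<Suc (Suc (Suc n))}. M))
      = (\<integral>x. \<integral>y. ?f (x(Suc (Suc n) := y)) \<partial>M \<partial>(\<Pi>\<^sub>M i\<in>?I. M))"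
    unfolding ins
  proof (rule PS.product_integral_insert)
    interpret P: prob_space "\<Pi>\<^sub>M i\<in>insert (Suc (Suc n)) ?I. M" by (rule prob_space_PiM_const)
    show "integrable (\<Pi>\<^sub>M i\<in>insert (Suc (Suc n)) ?I. M) ?f"
      by (intro P.bounded_measurable_integrable bounded_measurable_prod bounded_measurable_mult
          bounded_measurable_coordinates W Suc.prems) auto
  qed auto
  also have "\<dots> = (\<integral>x. (\<Prod>i<Suc n. W (x i) (x (Suc i))) * h (x 0) (x (Suc n)) \<partial>(\<Pi>\<^sub>M i\<in>?I. M))"
  proof (rule Bochner_Integration.integral_cong[OF refl])
    fix x :: "nat \<Rightarrow> 'a"
    have E: "?f (x(Suc (Suc n) := y)) = (\<Prod>i<Suc n. W (x i) (x (Suc i))) * (W (x (Suc n)) y * g (x 0) y)" for y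
    proof -
      have "(\<Prod>i<Suc n. W ((x(Suc (Suc n) := y)) i) ((x(Suc (Suc n) := y)) (Suc i))) = (\<Prod>i<Suc n. W (x i) (x (Suc i)))"
        by (rule prod.cong) auto
      then show ?thesis by (subst prod.lessThan_Suc) (simp add: mult.assoc)
    qed
    show "(\<integral>y. ?f (x(Suc (Suc n) := y)) \<partial>M) = (\<Prod>i<Suc n. W (x i) (x (Suc i))) * h (x 0) (x (Suc n))"
      by (simp only: E h_def integral_mult_right_zero)
  qed
  also have "\<dots> = (\<integral>x. \<integral>y. kpow W n x y * h x y \<partial>M \<partial>M)" by (rule Suc.IH[OF h])
  also have "\<dots> = (\<integral>x. \<integral>y. kpow W (Suc n) x y * g x y \<partial>M \<partial>M)"
  proof (rule Bochner_Integration.integral_cong[OF refl])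
    fix x assume x: "x \<in> space M"
    have k: "bkernel (\<lambda>v y. kpow W n x v * (W v y * g x y))"
      by (intro kernel_mult W kernel_fst kernel_snd bounded_measurable_row[OF kpow_kernel[OF W] x] bounded_measurable_row[OF Suc.prems x])
    have "(\<integral>v. kpow W n x v * h x v \<partial>M) = (\<integral>v. \<integral>y. kpow W n x v * (W v y * g x y) \<partial>M \<partial>M)"
      by (simp add: h_def)
    also have "\<dots> = (\<integral>y. \<integral>v. kpow W n x v * (W v y * g x y) \<partial>M \<partial>M)"
      by (rule kernel_integral_swap[OF k])
    also have "\<dots> = (\<integral>y. kpow W (Suc n) x y * g x y \<partial>M)"
      by (simp add: kcomp_def mult.assoc[symmetric])
    finally show "(\<integral>v. kpow W n x v * h x v \<partial>M) = (\<integral>y. kpow W (Suc n) x y * g x y \<partial>M)" .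
  qed
  finally show ?case .
qed

lemma hom_density_cycle_graph:
  assumes W: "bkernel W" and sym: "\<And>x y. x \<in> space M \<Longrightarrow> y \<in> space M \<Longrightarrow> W x y = W y x"
    and n: "n \<ge> 2"
  shows "hom_density (cycle_graph n) W = (\<integral>x. kpow W (n - 1) x x \<partial>M)"
proof -
  define m where "m = n - 2"
  have m: "n = Suc (Suc m)" using n by (simp add: m_def)
  have "(\<Prod>e\<in>#edges (cycle_graph n). W (x (Min e)) (x (Max e)))
      = (\<Prod>i<Suc m. W (x i) (x (Suc i))) * W (x 0) (x (Suc m))" for x :: "nat \<Rightarrow> 'a"
  proof -
    have "(\<Prod>e\<in>#edges (cycle_graph n). W (x (Min e)) (x (Max e)))
        = (\<Prod>i<n. W (x (Min {i, (i + 1) mod n})) (x (Max {i, (i + 1) mod n})))"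
      by (simp add: cycle_graph_def image_mset.compositionality o_def prod_unfold_prod_mset)
    also have "\<dots> = (\<Prod>i<Suc m. W (x (Min {i, (i + 1) mod n})) (x (Max {i, (i + 1) mod n}))) *
        W (x (Min {Suc m, (Suc m + 1) mod n})) (x (Max {Suc m, (Suc m + 1) mod n}))"
      unfolding m by (rule prod.lessThan_Suc)
    also have "(\<Prod>i<Suc m. W (x (Min {i, (i + 1) mod n})) (x (Max {i, (i + 1) mod n})))
        = (\<Prod>i<Suc m. W (x i) (x (Suc i)))"
      by (rule prod.cong) (auto simp: m)
    also have "W (x (Min {Suc m, (Suc m + 1) mod n})) (x (Max {Suc m, (Suc m + 1) mod n})) = W (x 0) (x (Suc m))"
      by (simp add: m)
    finally show ?thesis .
  qed
  then have "hom_density (cycle_graph n) W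
      = (\<integral>x. (\<Prod>i<Suc m. W (x i) (x (Suc i))) * W (x 0) (x (Suc m)) \<partial>(\<Pi>\<^sub>M i\<in>{..<Suc (Suc m)}. M))"
    by (simp add: hom_density_def cycle_graph_def m)
  also have "\<dots> = (\<integral>x. \<integral>y. kpow W m x y * W x y \<partial>M \<partial>M)" by (rule integral_path[OF W W])
  also have "\<dots> = (\<integral>x. kpow W (Suc m) x x \<partial>M)" using trace_kpow[OF W sym, of m 0] by simp
  finally show ?thesis by (simp add: m)
qed

end

section \<open>The connection matrix of a weighted graph\<close>

lemma sum_PiE_Un:
  fixes f :: "('a \<Rightarrow> 'b) \<Rightarrow> 'c::comm_monoid_add"
  assumes "A \<inter> B = {}"
  shows "(\<Sum>\<phi>\<in>A \<union> B \<rightarrow>\<^sub>E S. f \<phi>) = (\<Sum>\<phi>\<in>A \<rightarrow>\<^sub>E S. \<Sum>\<psi>\<in>B \<rightarrow>\<^sub>E S. f (merge A B (\<phi>, \<psi>)))"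
  unfolding sum.cartesian_product
proof (rule sum.reindex_bij_witness[where j = "\<lambda>\<phi>. (restrict \<phi> A, restrict \<phi> B)" and i = "merge A B"])
  fix \<phi> assume "\<phi> \<in> A \<union> B \<rightarrow>\<^sub>E S"
  then show m: "merge A B (restrict \<phi> A, restrict \<phi> B) = \<phi>"
    by (auto simp: merge_def fun_eq_iff PiE_def extensional_def)
  show "(restrict \<phi> A, restrict \<phi> B) \<in> (A \<rightarrow>\<^sub>E S) \<times> (B \<rightarrow>\<^sub>E S)"
    using \<open>\<phi> \<in> A \<union> B \<rightarrow>\<^sub>E S\<close> by auto
  show "(case (restrict \<phi> A, restrict \<phi> B) of (\<phi>, \<psi>) \<Rightarrow> f (merge A B (\<phi>, \<psi>))) = f \<phi>"
    unfolding prod.case m ..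
next
  fix p assume "p \<in> (A \<rightarrow>\<^sub>E S) \<times> (B \<rightarrow>\<^sub>E S)"
  then obtain \<phi> \<psi> where p: "p = (\<phi>, \<psi>)" "\<phi> \<in> A \<rightarrow>\<^sub>E S" "\<psi> \<in> B \<rightarrow>\<^sub>E S" by auto
  show "merge A B p \<in> A \<union> B \<rightarrow>\<^sub>E S"
    using p assms by (auto simp: merge_def PiE_def extensional_def Pi_def)
  show "(restrict (merge A B p) A, restrict (merge A B p) B) = p"
    using p assms by (auto simp: merge_def fun_eq_iff PiE_def extensional_def restrict_def)
qed

text \<open>The normalised sum over the maps of the unlabeled nodes \<open>N\<close>, for given images \<open>\<xi>\<close> of the labeled
  nodes \<open>L\<close>. The weights of the labeled nodes are left out.\<close>

definition rooted_sum ::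
    "weighted_graph \<Rightarrow> nat set \<Rightarrow> nat set \<Rightarrow> nat set multiset \<Rightarrow> (nat \<Rightarrow> nat) \<Rightarrow> real" where
  "rooted_sum H L N E \<xi> =
     (\<Sum>i\<in>wnodes H. nodeweight H i) powi (- int (card N)) *
     (\<Sum>\<phi>\<in>N \<rightarrow>\<^sub>E wnodes H. (\<Prod>i\<in>N. nodeweight H (\<phi> i)) *
        (\<Prod>e\<in>#E. edgeweight H (merge L N (\<xi>, \<phi>) (Min e)) (merge L N (\<xi>, \<phi>) (Max e))))"

text \<open>For a fixed map \<open>\<xi>\<close> of the common nodes \<open>L\<close> the sum over the remaining nodes factors.\<close>

lemma t_weighted_glued:
  assumes fin: "finite L" "finite N1" "finite N2"
    and disj: "L \<inter> N1 = {}" "L \<inter> N2 = {}" "N1 \<inter> N2 = {}"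
    and E1: "\<And>e. e \<in># E1 \<Longrightarrow> e \<subseteq> L \<union> N1 \<and> card e = 2"
    and E2: "\<And>e. e \<in># E2 \<Longrightarrow> e \<subseteq> L \<union> N2 \<and> card e = 2"
    and H: "(\<Sum>i\<in>wnodes H. nodeweight H i) \<noteq> 0"
  shows "t_weighted \<lparr>nodes = L \<union> N1 \<union> N2, edges = E1 + E2\<rparr> H =
    (\<Sum>\<xi>\<in>L \<rightarrow>\<^sub>E wnodes H. ((\<Sum>i\<in>wnodes H. nodeweight H i) powi (- int (card L)) *
        (\<Prod>i\<in>L. nodeweight H (\<xi> i)) * rooted_sum H L N1 E1 \<xi>) * rooted_sum H L N2 E2 \<xi>)"
proof -
  let ?S = "wnodes H" and ?\<alpha> = "nodeweight H" and ?\<beta> = "edgeweight H"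
  let ?T = "\<Sum>i\<in>wnodes H. nodeweight H i"
  let ?M = "\<lambda>\<xi> \<phi> \<psi>. merge (L \<union> N1) N2 (merge L N1 (\<xi>, \<phi>), \<psi>)"
  let ?P = "\<lambda>E m. \<Prod>e\<in>#E. ?\<beta> (m (Min e)) (m (Max e))"
  have disj': "(L \<union> N1) \<inter> N2 = {}" using disj by auto
  have card: "card (L \<union> N1 \<union> N2) = card L + card N1 + card N2"
    using fin disj disj' by (simp add: card_Un_disjoint)
  have MinMax: "Min e \<in> e" "Max e \<in> e" if "card e = 2" for e :: "nat set"
    using that by (auto intro!: Min_in Max_in card_ge_0_finite)
  have P1: "?P E1 (?M \<xi> \<phi> \<psi>) = ?P E1 (merge L N1 (\<xi>, \<phi>))" for \<xi> \<phi> \<psi>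
  proof (intro arg_cong[where f = prod_mset] image_mset_cong)
    fix e assume "e \<in># E1"
    then have "Min e \<in> L \<union> N1" "Max e \<in> L \<union> N1" using E1 MinMax by blast+
    then show "?\<beta> (?M \<xi> \<phi> \<psi> (Min e)) (?M \<xi> \<phi> \<psi> (Max e)) =
        ?\<beta> (merge L N1 (\<xi>, \<phi>) (Min e)) (merge L N1 (\<xi>, \<phi>) (Max e))"
      by (simp add: merge_def)
  qed
  have P2: "?P E2 (?M \<xi> \<phi> \<psi>) = ?P E2 (merge L N2 (\<xi>, \<psi>))" for \<xi> \<phi> \<psi>
  proof (intro arg_cong[where f = prod_mset] image_mset_cong)
    fix e assume "e \<in># E2"
    then have "Min e \<in> L \<union> N2" "Max e \<in> L \<union> N2" using E2 MinMax by blast+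
    then have "?M \<xi> \<phi> \<psi> (Min e) = merge L N2 (\<xi>, \<psi>) (Min e)"
        "?M \<xi> \<phi> \<psi> (Max e) = merge L N2 (\<xi>, \<psi>) (Max e)"
      using disj by (auto simp: merge_def)
    then show "?\<beta> (?M \<xi> \<phi> \<psi> (Min e)) (?M \<xi> \<phi> \<psi> (Max e)) =
        ?\<beta> (merge L N2 (\<xi>, \<psi>) (Min e)) (merge L N2 (\<xi>, \<psi>) (Max e))" by simp
  qed
  have A: "(\<Prod>i\<in>L \<union> N1 \<union> N2. ?\<alpha> (?M \<xi> \<phi> \<psi> i)) =
      (\<Prod>i\<in>L. ?\<alpha> (\<xi> i)) * (\<Prod>i\<in>N1. ?\<alpha> (\<phi> i)) * (\<Prod>i\<in>N2. ?\<alpha> (\<psi> i))" for \<xi> \<phi> \<psi>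
  proof -
    have "(\<Prod>i\<in>L \<union> N1 \<union> N2. ?\<alpha> (?M \<xi> \<phi> \<psi> i)) = (\<Prod>i\<in>L. ?\<alpha> (?M \<xi> \<phi> \<psi> i)) *
        (\<Prod>i\<in>N1. ?\<alpha> (?M \<xi> \<phi> \<psi> i)) * (\<Prod>i\<in>N2. ?\<alpha> (?M \<xi> \<phi> \<psi> i))"
      using fin disj disj' by (simp add: prod.union_disjoint)
    moreover have "(\<Prod>i\<in>L. ?\<alpha> (?M \<xi> \<phi> \<psi> i)) = (\<Prod>i\<in>L. ?\<alpha> (\<xi> i))"
      by (rule prod.cong) (auto simp: merge_def)
    moreover have "(\<Prod>i\<in>N1. ?\<alpha> (?M \<xi> \<phi> \<psi> i)) = (\<Prod>i\<in>N1. ?\<alpha> (\<phi> i))"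
      using disj by (intro prod.cong) (auto simp: merge_def)
    moreover have "(\<Prod>i\<in>N2. ?\<alpha> (?M \<xi> \<phi> \<psi> i)) = (\<Prod>i\<in>N2. ?\<alpha> (\<psi> i))"
      using disj by (intro prod.cong) (auto simp: merge_def)
    ultimately show ?thesis by simp
  qed
  have T: "?T powi (- int (card (L \<union> N1 \<union> N2))) =
      ?T powi (- int (card L)) * ?T powi (- int (card N1)) * ?T powi (- int (card N2))"
    unfolding card using H by (simp add: power_int_add[symmetric])
  have "t_weighted \<lparr>nodes = L \<union> N1 \<union> N2, edges = E1 + E2\<rparr> H = ?T powi (- int (card (L \<union> N1 \<union> N2))) *
     (\<Sum>\<xi>\<in>L \<rightarrow>\<^sub>E ?S. \<Sum>\<phi>\<in>N1 \<rightarrow>\<^sub>E ?S. \<Sum>\<psi>\<in>N2 \<rightarrow>\<^sub>E ?S.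
       (\<Prod>i\<in>L. ?\<alpha> (\<xi> i)) * (\<Prod>i\<in>N1. ?\<alpha> (\<phi> i)) * (\<Prod>i\<in>N2. ?\<alpha> (\<psi> i)) *
       (?P E1 (merge L N1 (\<xi>, \<phi>)) * ?P E2 (merge L N2 (\<xi>, \<psi>))))"
    unfolding t_weighted_def
    by (simp add: sum_PiE_Un[OF disj'] sum_PiE_Un[OF disj(1)] A P1 P2)
  also have "\<dots> = (\<Sum>\<xi>\<in>L \<rightarrow>\<^sub>E ?S. \<Sum>\<phi>\<in>N1 \<rightarrow>\<^sub>E ?S. \<Sum>\<psi>\<in>N2 \<rightarrow>\<^sub>E ?S.
       (?T powi (- int (card L)) * (\<Prod>i\<in>L. ?\<alpha> (\<xi> i))) *
       ((?T powi (- int (card N1)) * ((\<Prod>i\<in>N1. ?\<alpha> (\<phi> i)) * ?P E1 (merge L N1 (\<xi>, \<phi>)))) *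
       (?T powi (- int (card N2)) * ((\<Prod>i\<in>N2. ?\<alpha> (\<psi> i)) * ?P E2 (merge L N2 (\<xi>, \<psi>))))))"
    unfolding T sum_distrib_left by (intro sum.cong refl) (simp only: mult_ac)
  also have "\<dots> = (\<Sum>\<xi>\<in>L \<rightarrow>\<^sub>E ?S. (?T powi (- int (card L)) * (\<Prod>i\<in>L. ?\<alpha> (\<xi> i))) *
       (rooted_sum H L N1 E1 \<xi> * rooted_sum H L N2 E2 \<xi>))"
    unfolding rooted_sum_def sum_distrib_left[symmetric] sum_distrib_right[symmetric] ..
  finally show ?thesis by (simp only: mult.assoc)
qed

lemma finite_rank_M2_t_weighted:
  assumes H: "is_weighted_graph H" and f: "\<And>F. is_multigraph F \<Longrightarrow> f F = t_weighted F H"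
  shows "finite_rank two_labeled two_labeled (M2_matrix f)"
proof -
  let ?T = "\<Sum>i\<in>wnodes H. nodeweight H i"
  define g1 :: "nat \<Rightarrow> nat" where "g1 = (\<lambda>v. if v \<in> {1, 2} then v else 2 * v + 3)"
  define g2 :: "nat \<Rightarrow> nat" where "g2 = (\<lambda>v. if v \<in> {1, 2} then v else 2 * v + 4)"
  have finH: "finite (wnodes H)" and "?T > 0"
    using H by (auto simp: is_weighted_graph_def intro!: sum_pos)
  then have T: "?T \<noteq> 0" by simp
  let ?L = "{1, 2} :: nat set"
  let ?N1 = "\<lambda>F. g1 ` (nodes F - ?L)" and ?N2 = "\<lambda>F. g2 ` (nodes F - ?L)"
  let ?E1 = "\<lambda>F. image_mset ((`) g1) (edges F)" and ?E2 = "\<lambda>F. image_mset ((`) g2) (edges F)"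
  have inj: "inj g1" "inj g2"
    by (auto simp: inj_def g1_def g2_def split: if_splits)
  show ?thesis
  proof (rule finite_rankI[where L = "?L \<rightarrow>\<^sub>E wnodes H"])
    show "finite (?L \<rightarrow>\<^sub>E wnodes H)" using finH by (intro finite_PiE) auto
    fix F1 F2 assume "F1 \<in> two_labeled" "F2 \<in> two_labeled"
    then have F1: "is_multigraph F1" "?L \<subseteq> nodes F1" and F2: "is_multigraph F2" "?L \<subseteq> nodes F2"
      by (auto simp: two_labeled_def)
    have img: "g1 ` nodes F1 = ?L \<union> ?N1 F1" "g2 ` nodes F2 = ?L \<union> ?N2 F2"
      using F1(2) F2(2) by (auto simp: g1_def g2_def)
    have nodes_eq: "g1 ` nodes F1 \<union> g2 ` nodes F2 = ?L \<union> ?N1 F1 \<union> ?N2 F2"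
      unfolding img by auto
    have gl: "glue F1 F2 = \<lparr>nodes = ?L \<union> ?N1 F1 \<union> ?N2 F2, edges = ?E1 F1 + ?E2 F2\<rparr>"
      unfolding glue_def rename_nodes_def g1_def[symmetric] g2_def[symmetric] Let_def
      by (simp add: nodes_eq)
    have fin: "finite (nodes F1)" "finite (nodes F2)"
      using F1(1) F2(1) by (auto simp: is_multigraph_def)
    have E1: "e \<subseteq> ?L \<union> ?N1 F1 \<and> card e = 2" if "e \<in># ?E1 F1" for e
      unfolding img[symmetric] using that F1(1)
      by (auto simp: is_multigraph_def card_image[OF inj_on_subset[OF inj(1) subset_UNIV]])
    have E2: "e \<subseteq> ?L \<union> ?N2 F2 \<and> card e = 2" if "e \<in># ?E2 F2" for e
      unfolding img[symmetric] using that F2(1)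
      by (auto simp: is_multigraph_def card_image[OF inj_on_subset[OF inj(2) subset_UNIV]])
    have disj: "?L \<inter> ?N1 F1 = {}" "?L \<inter> ?N2 F2 = {}"
      by (auto simp: g1_def g2_def split: if_splits)
    have "2 * v + 3 \<noteq> 2 * w + (4::nat)" for v w by presburger
    then have disj': "?N1 F1 \<inter> ?N2 F2 = {}"
      by (auto simp: g1_def g2_def split: if_splits)
    have "is_multigraph (glue F1 F2)"
      unfolding gl is_multigraph_def
    proof (intro conjI ballI)
      show "finite (nodes \<lparr>nodes = ?L \<union> ?N1 F1 \<union> ?N2 F2, edges = ?E1 F1 + ?E2 F2\<rparr>)"
        using fin by simp
      fix e assume "e \<in># edges \<lparr>nodes = ?L \<union> ?N1 F1 \<union> ?N2 F2, edges = ?E1 F1 + ?E2 F2\<rparr>"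
      then have "e \<in># ?E1 F1 \<or> e \<in># ?E2 F2" by simp
      then have e: "e \<subseteq> ?L \<union> ?N1 F1 \<and> card e = 2 \<or> e \<subseteq> ?L \<union> ?N2 F2 \<and> card e = 2"
        using E1 E2 by blast
      then show "card e = 2" by blast
      from e show "e \<subseteq> nodes \<lparr>nodes = ?L \<union> ?N1 F1 \<union> ?N2 F2, edges = ?E1 F1 + ?E2 F2\<rparr>"
        unfolding multigraph.simps by blast
    qed
    then have "M2_matrix f F1 F2 = t_weighted (glue F1 F2) H" by (simp add: M2_matrix_def f)
    also have "\<dots> = (\<Sum>\<xi>\<in>?L \<rightarrow>\<^sub>E wnodes H. (?T powi (- int (card ?L)) *
        (\<Prod>i\<in>?L. nodeweight H (\<xi> i)) * rooted_sum H ?L (?N1 F1) (?E1 F1) \<xi>) *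
        rooted_sum H ?L (?N2 F2) (?E2 F2) \<xi>)"
      unfolding gl by (rule t_weighted_glued) (use fin disj disj' E1 E2 T in auto)
    finally show "M2_matrix f F1 F2 = (\<Sum>\<xi>\<in>?L \<rightarrow>\<^sub>E wnodes H.
        (\<lambda>\<xi> F1. ?T powi (- int (card ?L)) *
        (\<Prod>i\<in>?L. nodeweight H (\<xi> i)) * rooted_sum H ?L (?N1 F1) (?E1 F1) \<xi>) \<xi> F1 *
        (\<lambda>\<xi> F2. rooted_sum H ?L (?N2 F2) (?E2 F2) \<xi>) \<xi> F2)" .
  qed
qed

section \<open>Gluing labeled paths and labeled parallel edges\<close>

text \<open>Parallel edges between the nodes labeled \<open>1\<close> and \<open>2\<close>.\<close>

definition labeled_parallel_edges :: "nat \<Rightarrow> multigraph" where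
  "labeled_parallel_edges n = \<lparr>nodes = {1, 2}, edges = replicate_mset n {1, 2}\<rparr>"

text \<open>A path with \<open>n\<close> edges from node \<open>s\<close> to node \<open>t\<close>, where \<open>s\<close> and \<open>t\<close> are the two labels; the \<open>k\<close>-th
  inner node gets the number \<open>k + 2\<close>, which avoids the labels.\<close>

definition labeled_path :: "nat \<Rightarrow> nat \<Rightarrow> nat \<Rightarrow> multigraph" where
  "labeled_path s t n =
     (let h = (\<lambda>k. if k = 0 then s else if k = n then t else k + 2)
      in \<lparr>nodes = h ` {..n}, edges = image_mset (\<lambda>k. {h k, h (Suc k)}) (mset_set {..<n})\<rparr>)"

lemma labeled_parallel_edges_two_labeled: "labeled_parallel_edges n \<in> two_labeled"
  by (auto simp: labeled_parallel_edges_def two_labeled_def is_multigraph_def card_insert_if)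

lemma labeled_path_two_labeled:
  assumes "n \<ge> 1" "{s, t} = {1, 2}"
  shows "labeled_path s t n \<in> two_labeled"
proof -
  define h where "h = (\<lambda>k::nat. if k = 0 then s else if k = n then t else k + 2)"
  have F: "labeled_path s t n = \<lparr>nodes = h ` {..n}, edges = image_mset (\<lambda>k. {h k, h (Suc k)}) (mset_set {..<n})\<rparr>"
    by (simp add: labeled_path_def h_def Let_def)
  have st: "s \<noteq> t" "s \<in> {1, 2}" "t \<in> {1, 2}" using assms(2) by (auto simp: doubleton_eq_iff)
  have "s \<in> h ` {..n}" "t \<in> h ` {..n}"
    using assms(1) by (auto simp: h_def image_iff intro: bexI[of _ 0] bexI[of _ n])
  then have "{1, 2} \<subseteq> h ` {..n}" using assms(2) by (metis insert_subset empty_subsetI)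
  moreover have "card {h k, h (Suc k)} = 2" if "k < n" for k
  proof -
    have "h k \<noteq> h (Suc k)" using that st by (auto simp: h_def)
    then show ?thesis by simp
  qed
  moreover have "{h k, h (Suc k)} \<subseteq> h ` {..n}" if "k < n" for k using that by auto
  ultimately show ?thesis
    unfolding F two_labeled_def is_multigraph_def by auto
qed

lemma glue_labeled_parallel_edges:
  "glue (labeled_parallel_edges i) (labeled_parallel_edges j) = rename_nodes Suc (parallel_edges (i + j))"
proof -
  have "replicate_mset (i + j) e = replicate_mset i e + replicate_mset j e" for e :: "nat set"
    by (induction i) simp_all
  then show ?thesis
    by (auto simp: glue_def rename_nodes_def labeled_parallel_edges_def parallel_edges_def Let_def
        numeral_2_eq_2)
qed

text \<open>The second path runs from label \<open>2\<close> back to label \<open>1\<close>, so that the nodes of the glued graph are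
  met in cyclic order. The renaming \<open>G\<close> lists them in this order.\<close>

lemma glue_labeled_paths:
  assumes i: "i \<ge> 1" and j: "j \<ge> 1"
  shows "\<exists>G. inj_on G {..<i + j} \<and>
     glue (labeled_path 1 2 i) (labeled_path 2 1 j) = rename_nodes G (cycle_graph (i + j))"
proof -
  define g1 :: "nat \<Rightarrow> nat" where "g1 = (\<lambda>v. if v \<in> {1, 2} then v else 2 * v + 3)"
  define g2 :: "nat \<Rightarrow> nat" where "g2 = (\<lambda>v. if v \<in> {1, 2} then v else 2 * v + 4)"
  define h1 :: "nat \<Rightarrow> nat" where "h1 = (\<lambda>k. if k = 0 then 1 else if k = i then 2 else k + 2)"
  define h2 :: "nat \<Rightarrow> nat" where "h2 = (\<lambda>k. if k = 0 then 2 else if k = j then 1 else k + 2)"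
  \<comment> \<open>\<open>g1\<close>, \<open>g2\<close> are the renamings of gluing; \<open>h1\<close>, \<open>h2\<close> number the nodes along the two paths.\<close>
  define G where "G = (\<lambda>k. if k \<le> i then g1 (h1 k) else g2 (h2 (k - i)))"
  let ?n = "i + j"
  have G1: "g1 (h1 k) = G k" if "k \<le> i" for k using that by (simp add: G_def)
  have G2: "g2 (h2 k) = G ((i + k) mod ?n)" if "k \<le> j" for k
  proof (cases "k = j")
    case True
    then show ?thesis using i j by (simp add: G_def g1_def g2_def h1_def h2_def)
  next
    case False
    then have "(i + k) mod ?n = i + k" using that by simp
    then show ?thesis using i False by (simp add: G_def g1_def g2_def h1_def h2_def)
  qed
  have "inj_on G {..<?n}"
  proof (rule inj_onI)
    fix k l assume kl: "k \<in> {..<?n}" "l \<in> {..<?n}" "G k = G l"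
    have val: "G k = (if k = 0 then 1 else if k = i then 2 else if k < i then 2 * k + 7 else 2 * (k - i) + 8)"
      if "k < ?n" for k
      using that i by (auto simp: G_def g1_def g2_def h1_def h2_def)
    have "(if k = 0 then 1 else if k = i then 2 else if k < i then 2 * k + 7 else 2 * (k - i) + 8) =
        (if l = 0 then 1 else if l = i then 2 else if l < i then 2 * l + 7 else 2 * (l - i) + 8)"
      using kl(3) val[of k] val[of l] kl(1,2) by (simp only: lessThan_iff)
    then show "k = l"
      by (simp split: if_split_asm; presburger)
  qed
  moreover have "glue (labeled_path 1 2 i) (labeled_path 2 1 j) = rename_nodes G (cycle_graph ?n)"
  proof -
    have gl: "glue (labeled_path 1 2 i) (labeled_path 2 1 j) =
        \<lparr>nodes = g1 ` h1 ` {..i} \<union> g2 ` h2 ` {..j},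
         edges = image_mset (\<lambda>k. g1 ` {h1 k, h1 (Suc k)}) (mset_set {..<i}) +
           image_mset (\<lambda>k. g2 ` {h2 k, h2 (Suc k)}) (mset_set {..<j})\<rparr>"
      unfolding glue_def labeled_path_def rename_nodes_def g1_def[symmetric] g2_def[symmetric]
        h1_def[symmetric] h2_def[symmetric] Let_def
      by (simp add: image_mset.compositionality o_def)
    have "g1 ` h1 ` {..i} \<union> g2 ` h2 ` {..j} = G ` ({..i} \<union> (\<lambda>k. (i + k) mod ?n) ` {..j})"
      unfolding image_Un image_image using G1 G2 by (intro arg_cong2[where f = "(\<union>)"] image_cong) auto
    also have "{..i} \<union> (\<lambda>k. (i + k) mod ?n) ` {..j} = {..<?n}"
    proof (intro equalityI subsetI)
      fix k assume "k \<in> {..<?n}"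
      then show "k \<in> {..i} \<union> (\<lambda>k. (i + k) mod ?n) ` {..j}"
        by (cases "k \<le> i") (auto intro!: image_eqI[of _ _ "k - i"])
    qed (use i j in auto)
    finally have nodes: "g1 ` h1 ` {..i} \<union> g2 ` h2 ` {..j} = G ` {..<?n}" .
    have m: "mset_set {..<?n} = mset_set {..<i} + image_mset ((+) i) (mset_set {..<j})"
    proof -
      have "{..<?n} = {..<i} \<union> (+) i ` {..<j}"
      proof (intro equalityI subsetI)
        fix k assume "k \<in> {..<?n}"
        then show "k \<in> {..<i} \<union> (+) i ` {..<j}"
          by (cases "k < i") (auto intro!: image_eqI[of _ _ "k - i"])
      qed auto
      moreover have "{..<i} \<inter> (+) i ` {..<j} = {}" by auto
      ultimately show ?thesis by (simp add: mset_set_Union image_mset_mset_set)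
    qed
    have e1: "image_mset (\<lambda>k. g1 ` {h1 k, h1 (Suc k)}) (mset_set {..<i}) =
        image_mset (\<lambda>k. G ` {k, (k + 1) mod ?n}) (mset_set {..<i})"
    proof (rule image_mset_cong)
      fix k assume "k \<in># mset_set {..<i}"
      then have "k < i" by simp
      then show "g1 ` {h1 k, h1 (Suc k)} = G ` {k, (k + 1) mod ?n}"
        using G1[of k] G1[of "Suc k"] j by simp
    qed
    have e2: "image_mset (\<lambda>k. g2 ` {h2 k, h2 (Suc k)}) (mset_set {..<j}) =
        image_mset (\<lambda>k. G ` {i + k, (i + k + 1) mod ?n}) (mset_set {..<j})"
    proof (rule image_mset_cong)
      fix k assume "k \<in># mset_set {..<j}"
      then have "k < j" by simp
      then show "g2 ` {h2 k, h2 (Suc k)} = G ` {i + k, (i + k + 1) mod ?n}"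
        using G2[of k] G2[of "Suc k"] by simp
    qed
    show ?thesis
      unfolding gl nodes rename_nodes_def cycle_graph_def e1 e2 m
      by (simp add: image_mset.compositionality o_def)
  qed
  ultimately show ?thesis by blast
qed

lemma is_multigraph_parallel_edges: "is_multigraph (parallel_edges n)"
  by (auto simp: is_multigraph_def parallel_edges_def)

lemma is_multigraph_cycle_graph:
  assumes "n \<ge> 2" shows "is_multigraph (cycle_graph n)"
proof -
  have "card {i, (i + 1) mod n} = 2" if "i < n" for i
  proof -
    have "i \<noteq> (i + 1) mod n" using that assms by (cases "i + 1 = n") auto
    then show ?thesis by simp
  qed
  then show ?thesis using assms by (auto simp: is_multigraph_def cycle_graph_def)
qed

lemma is_multigraph_complete_bipartite: "is_multigraph (complete_bipartite a b)"
  by (auto simp: is_multigraph_def complete_bipartite_def)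

lemma is_multigraph_rename_nodes:
  assumes "is_multigraph F" "inj_on g (nodes F)"
  shows "is_multigraph (rename_nodes g F)"
  using assms
  by (auto simp: is_multigraph_def rename_nodes_def card_image inj_on_subset)

context prob_space
begin

lemma hom_density_rename_nodes:
  assumes F: "is_multigraph F" and g: "inj_on g (nodes F)" and W: "bkernel W"
    and sym: "\<And>x y. x \<in> space M \<Longrightarrow> y \<in> space M \<Longrightarrow> W x y = W y x"
  shows "hom_density (rename_nodes g F) W = hom_density F W"
proof -
  let ?K = "g ` nodes F"
  let ?f = "\<lambda>x. \<Prod>e\<in>#edges F. W (x (Min e)) (x (Max e))"
  let ?T = "\<lambda>\<omega>. \<lambda>n\<in>nodes F. \<omega> (g n)"
  have d: "distr (\<Pi>\<^sub>M i\<in>?K. M) (\<Pi>\<^sub>M i\<in>nodes F. M) ?T = (\<Pi>\<^sub>M i\<in>nodes F. M)"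
    using distr_PiM_reindex[of ?K "\<lambda>_. M" g "nodes F"] g prob_space_axioms by auto
  have T: "?T \<in> measurable (\<Pi>\<^sub>M i\<in>?K. M) (\<Pi>\<^sub>M i\<in>nodes F. M)"
    by (intro measurable_restrict measurable_component_singleton) auto
  have "hom_density F W = (\<integral>x. ?f x \<partial>distr (\<Pi>\<^sub>M i\<in>?K. M) (\<Pi>\<^sub>M i\<in>nodes F. M) ?T)"
    unfolding hom_density_def d ..
  also have "\<dots> = (\<integral>\<omega>. ?f (?T \<omega>) \<partial>(\<Pi>\<^sub>M i\<in>?K. M))"
    by (rule integral_distr[OF T bounded_measurableD[OF bounded_measurable_density_integrand[OF F W]]])
  also have "\<dots> = (\<integral>\<omega>. (\<Prod>e\<in>#edges F. W (\<omega> (Min (g ` e))) (\<omega> (Max (g ` e)))) \<partial>(\<Pi>\<^sub>M i\<in>?K. M))"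
  proof (intro Bochner_Integration.integral_cong refl arg_cong[where f = prod_mset] image_mset_cong)
    fix \<omega> e assume \<omega>: "\<omega> \<in> space (\<Pi>\<^sub>M i\<in>?K. M)" and e: "e \<in># edges F"
    then have "e \<subseteq> nodes F" "card e = 2" using F by (auto simp: is_multigraph_def)
    then obtain a b where ab: "e = {a, b}" "a \<in> nodes F" "b \<in> nodes F" by (auto simp: card_2_iff)
    have "\<omega> (g a) \<in> space M" "\<omega> (g b) \<in> space M"
      using \<omega> ab by (auto simp: space_PiM)
    then have s: "W (\<omega> (g a)) (\<omega> (g b)) = W (\<omega> (g b)) (\<omega> (g a))" by (rule sym)
    show "W (?T \<omega> (Min e)) (?T \<omega> (Max e)) = W (\<omega> (Min (g ` e))) (\<omega> (Max (g ` e)))"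
      using ab s by (auto simp: min_def max_def)
  qed
  also have "\<dots> = hom_density (rename_nodes g F) W"
    by (simp add: hom_density_def rename_nodes_def image_mset.compositionality o_def)
  finally show ?thesis by simp
qed

end

section \<open>Step functions and weighted graphs\<close>

context prob_space
begin

lemma step_kernel:
  assumes "finite_colouring c"
  shows "bkernel (\<lambda>x y. \<beta> (c x) (c y))"
proof -
  have [measurable]: "c \<in> measurable M (count_space UNIV)" and fin: "finite (c ` space M)"
    using assms by (auto simp: finite_colouring_def)
  have enc: "(\<lambda>p. prod_encode (c (fst p), c (snd p))) \<in> measurable (M \<Otimes>\<^sub>M M) (count_space UNIV)"
    by measurable
  have "(\<lambda>m. \<beta> (fst (prod_decode m)) (snd (prod_decode m))) \<in> borel_measurable (count_space UNIV)"
    by simp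
  from measurable_compose[OF enc this]
  have meas: "(\<lambda>p. \<beta> (c (fst p)) (c (snd p))) \<in> borel_measurable (M \<Otimes>\<^sub>M M)" by simp
  let ?V = "(\<lambda>q. \<bar>\<beta> (fst q) (snd q)\<bar>) ` (c ` space M \<times> c ` space M)"
  have "finite ?V" using fin by simp
  have "bounded_measurable (M \<Otimes>\<^sub>M M) (\<lambda>p. \<beta> (c (fst p)) (c (snd p)))"
  proof (rule bounded_measurableI[OF meas])
    fix p assume "p \<in> space (M \<Otimes>\<^sub>M M)"
    then have "(c (fst p), c (snd p)) \<in> c ` space M \<times> c ` space M"
      by (auto simp: space_pair_measure)
    then have "\<bar>\<beta> (c (fst p)) (c (snd p))\<bar> \<in> ?V" by force
    then show "\<bar>\<beta> (c (fst p)) (c (snd p))\<bar> \<le> Max ?V" by (rule Max_ge[OF \<open>finite ?V\<close>])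
  qed
  then show ?thesis by (rule kernelI)
qed

text \<open>A property that holds almost everywhere holds at some point of every colour of positive measure.\<close>

lemma ex_point_of_colour:
  assumes c: "finite_colouring c" and ae: "AE x in M. P x" and pos: "prob (c -` {i} \<inter> space M) > 0"
  shows "\<exists>x\<in>space M. c x = i \<and> P x"
proof (rule ccontr)
  assume no: "\<not> ?thesis"
  have "c -` {i} \<inter> space M \<in> events"
    using c by (auto simp: finite_colouring_def intro: measurable_sets)
  moreover have "AE x in M. x \<notin> c -` {i} \<inter> space M"
    using ae AE_space
  proof eventually_elim
    case (elim x)
    then show ?case using no by auto
  qed
  ultimately have "prob (c -` {i} \<inter> space M) = 0" by (simp add: prob_eq_0)
  with pos show False by simp
qed

lemma step_function_moments_finite_rank:
  assumes c: "finite_colouring c" and V: "bkernel V" and step: "keq V (\<lambda>x y. \<gamma> (c x) (c y))"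
  shows "finite_rank UNIV UNIV (\<lambda>i j. \<integral>x. \<integral>y. V x y ^ (i + j) \<partial>M \<partial>M)"
proof (rule finite_rankI)
  let ?R = "c ` space M \<times> c ` space M"
  show "finite ?R" using c by (simp add: finite_colouring_def)
  define \<mu> where "\<mu> = (\<lambda>q. \<integral>x. \<integral>y. (if c x = fst q \<and> c y = snd q then 1 else 0 :: real) \<partial>M \<partial>M)"
  fix i j :: nat
  have k: "bkernel (\<lambda>x y. if c x = fst q \<and> c y = snd q then 1 else 0)" for q
    by (rule step_kernel[OF c, of "\<lambda>a b. if a = fst q \<and> b = snd q then 1 else 0"])
  have "keq (\<lambda>x y. V x y ^ (i + j)) (\<lambda>x y. \<gamma> (c x) (c y) ^ (i + j))"
    using step unfolding keq_def
  proof eventually_elim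
    case (elim x)
    then show ?case by eventually_elim simp
  qed
  then have "(\<integral>x. \<integral>y. V x y ^ (i + j) \<partial>M \<partial>M) = (\<integral>x. \<integral>y. \<gamma> (c x) (c y) ^ (i + j) \<partial>M \<partial>M)"
    by (rule keq_integral_cong[OF kernel_power[OF V] kernel_power[OF step_kernel[OF c]]])
  also have "\<dots> = (\<integral>x. \<integral>y. (\<Sum>q\<in>?R. \<gamma> (fst q) (snd q) ^ (i + j) *
      (if c x = fst q \<and> c y = snd q then 1 else 0)) \<partial>M \<partial>M)"
  proof (intro Bochner_Integration.integral_cong refl)
    fix x y assume xy: "x \<in> space M" "y \<in> space M"
    have "(\<Sum>q\<in>?R. \<gamma> (fst q) (snd q) ^ (i + j) * (if c x = fst q \<and> c y = snd q then 1 else 0))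
        = (\<Sum>q\<in>?R. if q = (c x, c y) then \<gamma> (fst q) (snd q) ^ (i + j) else 0)"
      by (intro sum.cong) auto
    also have "\<dots> = \<gamma> (c x) (c y) ^ (i + j)"
      using \<open>finite ?R\<close> xy by (simp add: sum.delta)
    finally show "\<gamma> (c x) (c y) ^ (i + j) = (\<Sum>q\<in>?R. \<gamma> (fst q) (snd q) ^ (i + j) *
        (if c x = fst q \<and> c y = snd q then 1 else 0))" by simp
  qed
  also have "\<dots> = (\<Sum>q\<in>?R. \<integral>x. \<integral>y. \<gamma> (fst q) (snd q) ^ (i + j) *
        (if c x = fst q \<and> c y = snd q then 1 else 0) \<partial>M \<partial>M)"
    by (rule integral_sum_kernel[OF kernel_scale[OF k]])
  also have "\<dots> = (\<Sum>q\<in>?R. (\<mu> q * \<gamma> (fst q) (snd q) ^ i) * \<gamma> (fst q) (snd q) ^ j)"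
    by (intro sum.cong refl) (simp only: integral_mult_right_zero \<mu>_def power_add mult_ac)
  finally show "(\<integral>x. \<integral>y. V x y ^ (i + j) \<partial>M \<partial>M) =
      (\<Sum>q\<in>?R. (\<lambda>q i. \<mu> q * \<gamma> (fst q) (snd q) ^ i) q i * (\<lambda>q j. \<gamma> (fst q) (snd q) ^ j) q j)" .
qed

lemma comp_step_function:
  assumes c: "finite_colouring c" and W: "bkernel W" and step: "keq W (\<lambda>x y. \<beta> (c x) (c y))"
  shows "\<exists>\<gamma>. keq (kcomp W W) (\<lambda>x y. \<gamma> (c x) (c y))"
proof -
  let ?B = "\<lambda>x y. \<beta> (c x) (c y)"
  note B = step_kernel[OF c, of \<beta>]
  have "keq (kcomp W W) (kcomp ?B W)" by (rule keq_comp_left[OF W B W step])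
  also have "keq \<dots> (kcomp ?B ?B)" by (rule keq_comp_right[OF B W B step])
  also have "kcomp ?B ?B = (\<lambda>x y. (\<lambda>i j. \<integral>z. \<beta> i (c z) * \<beta> (c z) j \<partial>M) (c x) (c y))"
    by (intro ext) (simp add: kcomp_def)
  finally show ?thesis
    by (intro exI[of _ "\<lambda>i j. \<integral>z. \<beta> i (c z) * \<beta> (c z) j \<partial>M"])
qed

text \<open>The integrand is constant on each product of colour classes; these products are indexed by the maps
  of the nodes to the colours.\<close>

lemma hom_density_step_function:
  assumes c: "finite_colouring c" and F: "is_multigraph F"
  shows "hom_density F (\<lambda>x y. \<beta> (c x) (c y)) =
    (\<Sum>\<phi>\<in>nodes F \<rightarrow>\<^sub>E c ` space M. (\<Prod>i\<in>nodes F. prob (c -` {\<phi> i} \<inter> space M)) *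
        (\<Prod>e\<in>#edges F. \<beta> (\<phi> (Min e)) (\<phi> (Max e))))"
proof -
  let ?N = "nodes F" and ?R = "c ` space M"
  interpret PS: product_sigma_finite "\<lambda>i::nat. M" by (rule product_sigma_finite_const)
  have fN: "finite ?N" using F by (simp add: is_multigraph_def)
  have [measurable]: "c \<in> measurable M (count_space UNIV)" and fR: "finite ?R"
    using c by (auto simp: finite_colouring_def)
  have fin: "finite (?N \<rightarrow>\<^sub>E ?R)" using fN fR by (intro finite_PiE) auto
  let ?I = "\<lambda>\<phi> x. \<Prod>i\<in>?N. indicator (c -` {\<phi> i} \<inter> space M) (x i) :: real"
  let ?P = "\<lambda>\<phi>. \<Prod>e\<in>#edges F. \<beta> (\<phi> (Min e)) (\<phi> (Max e))"
  have ev: "c -` {k} \<inter> space M \<in> events" for k by measurable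
  have ii: "integrable M (indicator (c -` {k} \<inter> space M) :: 'a \<Rightarrow> real)" for k
    using ev by (simp add: integrable_indicator_iff less_top[symmetric])
  have pointwise: "(\<Prod>e\<in>#edges F. \<beta> (c (x (Min e))) (c (x (Max e)))) = (\<Sum>\<phi>\<in>?N \<rightarrow>\<^sub>E ?R. ?I \<phi> x * ?P \<phi>)"
    if x: "x \<in> space (\<Pi>\<^sub>M i\<in>?N. M)" for x
  proof -
    define \<psi> where "\<psi> = (\<lambda>i\<in>?N. c (x i))"
    have xi: "x i \<in> space M" if "i \<in> ?N" for i using x that by (auto simp: space_PiM)
    have \<psi>: "\<psi> \<in> ?N \<rightarrow>\<^sub>E ?R" using xi by (auto simp: \<psi>_def)
    have I: "?I \<phi> x = (if \<phi> = \<psi> then 1 else 0)" if \<phi>: "\<phi> \<in> ?N \<rightarrow>\<^sub>E ?R" for \<phi>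
    proof (cases "\<phi> = \<psi>")
      case True
      then have "?I \<phi> x = (\<Prod>i\<in>?N. 1)" by (intro prod.cong) (auto simp: \<psi>_def xi)
      then show ?thesis using True by simp
    next
      case False
      then obtain k where k: "\<phi> k \<noteq> \<psi> k" by auto
      have "k \<in> ?N" using k PiE_arb[OF \<phi>, of k] PiE_arb[OF \<psi>, of k] by metis
      then have "indicator (c -` {\<phi> k} \<inter> space M) (x k) = (0::real)" using k by (simp add: \<psi>_def indicator_def)
      then have "?I \<phi> x = 0" using \<open>k \<in> ?N\<close> fN by (intro prod_zero) auto
      then show ?thesis using False by simp
    qed
    have "(\<Sum>\<phi>\<in>?N \<rightarrow>\<^sub>E ?R. ?I \<phi> x * ?P \<phi>) = (\<Sum>\<phi>\<in>?N \<rightarrow>\<^sub>E ?R. if \<phi> = \<psi> then ?P \<phi> else 0)"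
      by (rule sum.cong) (simp_all add: I)
    also have "\<dots> = ?P \<psi>" using fin \<psi> by (simp add: sum.delta)
    also have "\<dots> = (\<Prod>e\<in>#edges F. \<beta> (c (x (Min e))) (c (x (Max e))))"
      using is_multigraph_edge[OF F]
      by (intro arg_cong[where f = prod_mset] image_mset_cong) (simp add: \<psi>_def)
    finally show ?thesis by simp
  qed
  have int: "integrable (\<Pi>\<^sub>M i\<in>?N. M) (?I \<phi>)" for \<phi>
    by (rule PS.product_integrable_prod[OF fN ii])
  have "hom_density F (\<lambda>x y. \<beta> (c x) (c y)) = (\<integral>x. (\<Sum>\<phi>\<in>?N \<rightarrow>\<^sub>E ?R. ?I \<phi> x * ?P \<phi>) \<partial>(\<Pi>\<^sub>M i\<in>?N. M))"
    unfolding hom_density_def by (rule Bochner_Integration.integral_cong[OF refl pointwise])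
  also have "\<dots> = (\<Sum>\<phi>\<in>?N \<rightarrow>\<^sub>E ?R. \<integral>x. ?I \<phi> x * ?P \<phi> \<partial>(\<Pi>\<^sub>M i\<in>?N. M))"
    by (rule Bochner_Integration.integral_sum) (intro integrable_mult_left int)
  also have "\<dots> = (\<Sum>\<phi>\<in>?N \<rightarrow>\<^sub>E ?R. (\<Prod>i\<in>?N. prob (c -` {\<phi> i} \<inter> space M)) * ?P \<phi>)"
  proof (rule sum.cong[OF refl])
    fix \<phi>
    have "(\<integral>x. ?I \<phi> x \<partial>(\<Pi>\<^sub>M i\<in>?N. M)) = (\<Prod>i\<in>?N. \<integral>z. indicator (c -` {\<phi> i} \<inter> space M) z \<partial>M)"
      by (rule PS.product_integral_prod[OF fN ii])
    then show "(\<integral>x. ?I \<phi> x * ?P \<phi> \<partial>(\<Pi>\<^sub>M i\<in>?N. M)) = (\<Prod>i\<in>?N. prob (c -` {\<phi> i} \<inter> space M)) * ?P \<phi>"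
      by (simp only: integral_mult_left_zero Bochner_Integration.integral_indicator Int_assoc Int_absorb)
  qed
  finally show ?thesis .
qed

text \<open>The nodes are the colours of positive measure. For these the value \<open>\<beta> i j\<close> is attained by \<open>W\<close>, so
  that it inherits symmetry and the bound \<open>d\<close> from \<open>W\<close>; for colours of measure zero \<open>\<beta>\<close> is arbitrary.\<close>

lemma weighted_graph_of_step_function:
  assumes W: "bkernel W" and sym: "\<And>x y. x \<in> space M \<Longrightarrow> y \<in> space M \<Longrightarrow> W x y = W y x"
    and bound: "\<And>x y. x \<in> space M \<Longrightarrow> y \<in> space M \<Longrightarrow> W x y \<in> {-d..d}"
    and c: "finite_colouring c" and step: "keq W (\<lambda>x y. \<beta> (c x) (c y))"
  shows "\<exists>H. is_bounded_weighted_graph d H \<and> (\<forall>F. is_multigraph F \<longrightarrow> hom_density F W = t_weighted F H)"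
proof -
  let ?\<mu> = "\<lambda>i. prob (c -` {i} \<inter> space M)" and ?R = "c ` space M"
  define S where "S = {i \<in> ?R. ?\<mu> i > 0}"
  define H where "H = \<lparr>wnodes = S, nodeweight = ?\<mu>, edgeweight = \<beta>\<rparr>"
  have [measurable]: "c \<in> measurable M (count_space UNIV)" and fR: "finite ?R"
    using c by (auto simp: finite_colouring_def)
  have fS: "finite S" using fR by (simp add: S_def)
  have zero: "?\<mu> i = 0" if "i \<in> ?R - S" for i
    using that measure_nonneg[of M "c -` {i} \<inter> space M"] by (auto simp: S_def less_le)
  have "(\<Sum>i\<in>?R. ?\<mu> i) = prob (\<Union>i\<in>?R. c -` {i} \<inter> space M)"
    by (rule finite_measure_finite_Union[symmetric, OF fR]) (auto simp: disjoint_family_on_def)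
  also have "(\<Union>i\<in>?R. c -` {i} \<inter> space M) = space M" by auto
  finally have one: "(\<Sum>i\<in>?R. ?\<mu> i) = 1" by (simp only: prob_space)
  have "S \<subseteq> ?R" unfolding S_def by blast
  then have "(\<Sum>i\<in>?R. ?\<mu> i) = (\<Sum>i\<in>S. ?\<mu> i)"
    by (rule sum.mono_neutral_right[OF fR]) (intro ballI zero)
  with one have sum1: "(\<Sum>i\<in>S. ?\<mu> i) = 1" by (simp only:)
  then have "S \<noteq> {}" by auto
  have vals: "\<exists>x\<in>space M. \<exists>y\<in>space M. W x y = \<beta> i j \<and> W y x = \<beta> j i" if "i \<in> S" "j \<in> S" for i j
  proof -
    have "AE x in M. (AE y in M. W x y = \<beta> (c x) (c y)) \<and> (AE y in M. W y x = \<beta> (c y) (c x))"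
      using step[unfolded keq_def] keq_flip_AE[OF W step_kernel[OF c] step] by eventually_elim simp
    then obtain x where x: "x \<in> space M" "c x = i"
        "AE y in M. W x y = \<beta> (c x) (c y)" "AE y in M. W y x = \<beta> (c y) (c x)"
      using ex_point_of_colour[OF c, of _ i] \<open>i \<in> S\<close> unfolding S_def by blast
    have "AE y in M. W x y = \<beta> (c x) (c y) \<and> W y x = \<beta> (c y) (c x)"
      using x(3,4) by eventually_elim simp
    then obtain y where "y \<in> space M" "c y = j" "W x y = \<beta> (c x) (c y) \<and> W y x = \<beta> (c y) (c x)"
      using ex_point_of_colour[OF c, of _ j] \<open>j \<in> S\<close> unfolding S_def by blast
    then show ?thesis using x(1,2) by blast
  qed
  have "is_bounded_weighted_graph d H"
    unfolding is_bounded_weighted_graph_def is_weighted_graph_def H_def weighted_graph.simps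
  proof (intro conjI ballI)
    fix i j assume ij: "i \<in> S" "j \<in> S"
    obtain x y where xy: "x \<in> space M" "y \<in> space M" "W x y = \<beta> i j" "W y x = \<beta> j i"
      using vals[OF ij] by blast
    show "\<beta> i j = \<beta> j i" using sym[OF xy(1,2)] xy(3,4) by simp
    show "\<beta> i j \<in> {-d..d}" using bound[OF xy(1,2)] xy(3) by simp
  qed (use fS \<open>S \<noteq> {}\<close> in \<open>auto simp: S_def\<close>)
  moreover have "hom_density F W = t_weighted F H" if F: "is_multigraph F" for F
  proof -
    have fN: "finite (nodes F)" using F by (simp add: is_multigraph_def)
    have "hom_density F W = hom_density F (\<lambda>x y. \<beta> (c x) (c y))"
      by (rule hom_density_keq[OF F W step_kernel[OF c] step])
    also have "\<dots> = (\<Sum>\<phi>\<in>nodes F \<rightarrow>\<^sub>E ?R. (\<Prod>i\<in>nodes F. ?\<mu> (\<phi> i)) *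
        (\<Prod>e\<in>#edges F. \<beta> (\<phi> (Min e)) (\<phi> (Max e))))"
      by (rule hom_density_step_function[OF c F])
    also have "\<dots> = (\<Sum>\<phi>\<in>nodes F \<rightarrow>\<^sub>E S. (\<Prod>i\<in>nodes F. ?\<mu> (\<phi> i)) *
        (\<Prod>e\<in>#edges F. \<beta> (\<phi> (Min e)) (\<phi> (Max e))))"
    proof (rule sum.mono_neutral_right)
      show "finite (nodes F \<rightarrow>\<^sub>E ?R)" using fN fR by (intro finite_PiE) auto
      show "nodes F \<rightarrow>\<^sub>E S \<subseteq> nodes F \<rightarrow>\<^sub>E ?R" by (rule PiE_mono) (auto simp: S_def)
      show "\<forall>\<phi>\<in>(nodes F \<rightarrow>\<^sub>E ?R) - (nodes F \<rightarrow>\<^sub>E S). (\<Prod>i\<in>nodes F. ?\<mu> (\<phi> i)) *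
        (\<Prod>e\<in>#edges F. \<beta> (\<phi> (Min e)) (\<phi> (Max e))) = 0"
      proof
        fix \<phi> assume "\<phi> \<in> (nodes F \<rightarrow>\<^sub>E ?R) - (nodes F \<rightarrow>\<^sub>E S)"
        then obtain k where "k \<in> nodes F" "\<phi> k \<in> ?R - S" by (auto simp: PiE_def Pi_def)
        then have "(\<Prod>i\<in>nodes F. ?\<mu> (\<phi> i)) = 0" using zero fN by (intro prod_zero) auto
        then show "(\<Prod>i\<in>nodes F. ?\<mu> (\<phi> i)) * (\<Prod>e\<in>#edges F. \<beta> (\<phi> (Min e)) (\<phi> (Max e))) = 0"
          by simp
      qed
    qed
    also have "\<dots> = t_weighted F H"
      unfolding t_weighted_def H_def weighted_graph.simps sum1 by simp
    finally show ?thesis .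
  qed
  ultimately show ?thesis by blast
qed

end

section \<open>The equivalences\<close>

lemma (in complete_measure) borel_measurable_if_AE_eq:
  fixes f g :: "'a \<Rightarrow> real"
  assumes g: "g \<in> borel_measurable M" and eq: "AE x in M. f x = g x"
  shows "f \<in> borel_measurable M"
proof (rule measurableI)
  fix A :: "real set" assume A: "A \<in> sets borel"
  have "AE x in M. x \<in> g -` A \<inter> space M \<longleftrightarrow> x \<in> f -` A \<inter> space M"
    using eq by eventually_elim auto
  then show "f -` A \<inter> space M \<in> sets M"
    by (rule in_sets_AE) (use measurable_sets[OF g A] in auto)
qed simp

context prob_space
begin

lemma AE_pair_swap:
  assumes "AE p in M \<Otimes>\<^sub>M M. P (fst p) (snd p)"
  shows "AE p in M \<Otimes>\<^sub>M M. P (snd p) (fst p)"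
proof -
  have "AE p in distr (M \<Otimes>\<^sub>M M) (M \<Otimes>\<^sub>M M) (\<lambda>(x, y). (y, x)). P (fst p) (snd p)"
    using assms unfolding pair_sigma_finite.distr_pair_swap[OF pair_sigma_finite_self, symmetric] .
  from AE_distrD[OF measurable_pair_swap' this] show ?thesis
    by (simp add: case_prod_beta')
qed

text \<open>Replacing \<open>W\<close> by a measurable kernel that agrees with it almost everywhere removes the completion.\<close>

lemma integral_completion_eq_hom_density:
  assumes F: "is_multigraph F" and W': "bkernel W'"
    and eq: "AE p in M \<Otimes>\<^sub>M M. W (fst p) (snd p) = W' (fst p) (snd p)"
  shows "(\<integral>x. (\<Prod>e\<in>#edges F. W (x (Min e)) (x (Max e))) \<partial>completion (\<Pi>\<^sub>M i\<in>nodes F. M))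
    = hom_density F W'"
proof -
  let ?N = "\<Pi>\<^sub>M i\<in>nodes F. M"
  let ?f = "\<lambda>W x. \<Prod>e\<in>#edges F. W (x (Min e)) (x (Max e))"
  have m: "?f W' \<in> borel_measurable ?N" by (rule bounded_measurableD[OF bounded_measurable_density_integrand[OF F W']])
  have ae: "AE x in completion ?N. ?f W x = ?f W' x"
    by (rule AE_completion[OF AE_prod_edges[OF F eq]])
  have "(\<integral>x. ?f W x \<partial>completion ?N) = (\<integral>x. ?f W' x \<partial>completion ?N)"
    by (rule integral_cong_AE[OF completion.borel_measurable_if_AE_eq[OF measurable_completion[OF m] ae]
          measurable_completion[OF m] ae])
  also have "\<dots> = hom_density F W'" unfolding hom_density_def by (rule integral_completion[OF m])
  finally show ?thesis .
qed

lemma finitely_many_values_if_finite_rank: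
  assumes "bkernel V" "finite_rank UNIV UNIV (\<lambda>i j. \<integral>x. \<integral>y. V x y ^ (i + j) \<partial>M \<partial>M)"
  shows "\<exists>F. finite F \<and> (AE x in M. AE y in M. V x y \<in> F)"
proof (rule finite_rank_relation[OF assms(2)])
  show "infinite (UNIV :: nat set)" by simp
  fix S :: "nat set" and c :: "nat \<Rightarrow> real"
  assume "finite S" "\<exists>i\<in>S. c i \<noteq> 0"
    "\<And>j. j \<in> UNIV \<Longrightarrow> (\<Sum>i\<in>S. c i * (\<integral>x. \<integral>y. V x y ^ (i + j) \<partial>M \<partial>M)) = 0"
  then show ?thesis using finitely_many_values_if_moment_relation[OF assms(1), of S c] by blast
qed

text \<open>The scheme of implications: both \<open>C \<and> E\<close> and \<open>C \<and> B\<close> make \<open>W\<close> a step function; a step function yields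
  \<open>a\<close>, \<open>E\<close> and \<open>B\<close>; from \<open>a\<close> follows \<open>M2\<close>, and from \<open>M2\<close> follow \<open>C\<close> and \<open>E\<close>.\<close>

lemma hom_density_equivalences:
  assumes W: "bkernel W" and sym: "\<And>x y. x \<in> space M \<Longrightarrow> y \<in> space M \<Longrightarrow> W x y = W y x"
    and bound: "\<And>x y. x \<in> space M \<Longrightarrow> y \<in> space M \<Longrightarrow> W x y \<in> {-d..d}"
    and f: "\<And>F. is_multigraph F \<Longrightarrow> f F = hom_density F W"
  defines "a \<equiv> \<exists>H. is_bounded_weighted_graph d H \<and> (\<forall>F. is_multigraph F \<longrightarrow> f F = t_weighted F H)"
    and "C \<equiv> finite_rank {1..} {1..} (C_matrix f)"
    and "E \<equiv> finite_rank UNIV UNIV (E_matrix f)"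
    and "B \<equiv> finite_rank UNIV UNIV (B_matrix f)"
    and "M2 \<equiv> finite_rank two_labeled two_labeled (M2_matrix f)"
  shows "(a \<longleftrightarrow> C \<and> E) \<and> (C \<and> E \<longleftrightarrow> B \<and> C) \<and> (B \<and> C \<longleftrightarrow> M2)"
proof -
  let ?U = "kcomp W W"
  have U: "bkernel ?U" by (rule kernel_comp[OF W W])
  have E_eq: "E_matrix f = (\<lambda>i j. \<integral>x. \<integral>y. W x y ^ (i + j) \<partial>M \<partial>M)"
    by (intro ext) (simp add: E_matrix_def f[OF is_multigraph_parallel_edges] hom_density_parallel_edges[OF W])
  have B_eq: "B_matrix f = (\<lambda>i j. \<integral>x. \<integral>y. ?U x y ^ (i + j) \<partial>M \<partial>M)"
    by (intro ext) (simp add: B_matrix_def f[OF is_multigraph_complete_bipartite]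
        hom_density_complete_bipartite[OF W sym])
  have C_eq: "C_matrix f i j = (\<integral>x. kpow W (i + j - 1) x x \<partial>M)" if "i \<ge> 1" "j \<ge> 1" for i j
  proof -
    have n: "i + j \<ge> 2" using that by simp
    show ?thesis
      by (simp only: C_matrix_def f[OF is_multigraph_cycle_graph[OF n]] hom_density_cycle_graph[OF W sym n])
  qed
  define step where "step \<longleftrightarrow> (\<exists>c \<beta>. finite_colouring c \<and> keq W (\<lambda>x y. \<beta> (c x) (c y)))"
  have fact: "\<exists>P L. bkernel P \<and> bkernel L \<and> keq W (kcomp W P) \<and> keq ?U (kcomp ?U P) \<and> keq W (kcomp ?U L)"
    if C
  proof (rule finite_rank_relation[OF that[unfolded C_def]])
    show "infinite {1::nat..}" by (rule infinite_Ici)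
    fix S :: "nat set" and c :: "nat \<Rightarrow> real"
    assume S: "finite S" "S \<subseteq> {1..}" "\<exists>i\<in>S. c i \<noteq> 0"
      and rel: "\<And>j. j \<in> {1..} \<Longrightarrow> (\<Sum>i\<in>S. c i * C_matrix f i j) = 0"
    have "(\<Sum>i\<in>S. c i * (\<integral>x. kpow W (i + j - 1) x x \<partial>M)) = 0" if j: "j \<ge> 1" for j
    proof -
      have "(\<Sum>i\<in>S. c i * (\<integral>x. kpow W (i + j - 1) x x \<partial>M)) = (\<Sum>i\<in>S. c i * C_matrix f i j)"
        using S(2) j by (intro sum.cong refl) (auto simp: C_eq)
      then show ?thesis using rel j by simp
    qed
    then obtain p where "p \<noteq> 0" "keq (kpoly W p) (\<lambda>x y. 0)"
      using annihilating_poly_if_trace_relation[OF W sym S] by blast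
    then show ?thesis using kernel_factorizations[OF W sym] by blast
  qed
  have CE: step if "C" "E"
  proof -
    obtain P L where "bkernel P" "keq W (kcomp W P)" using fact[OF \<open>C\<close>] by blast
    moreover obtain F where "finite F" "AE x in M. AE y in M. W x y \<in> F"
      using finitely_many_values_if_finite_rank[OF W] \<open>E\<close> unfolding E_def E_eq by blast
    ultimately show ?thesis
      unfolding step_def using step_function_if_finite_values[OF W sym W] by blast
  qed
  have CB: step if "C" "B"
  proof -
    obtain P L where "bkernel P" "bkernel L" "keq ?U (kcomp ?U P)" "keq W (kcomp ?U L)"
      using fact[OF \<open>C\<close>] by blast
    moreover obtain F where "finite F" "AE x in M. AE y in M. ?U x y \<in> F"
      using finitely_many_values_if_finite_rank[OF U] \<open>B\<close> unfolding B_def B_eq by blast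
    ultimately show ?thesis
      unfolding step_def using step_function_if_finite_values[OF W sym U] by blast
  qed
  have EB: "E \<and> B" if st: step
  proof -
    obtain c \<beta> where c: "finite_colouring c" "keq W (\<lambda>x y. \<beta> (c x) (c y))"
      using st unfolding step_def by blast
    obtain \<gamma> where "keq ?U (\<lambda>x y. \<gamma> (c x) (c y))" using comp_step_function[OF c(1) W c(2)] by blast
    then show ?thesis
      unfolding E_def E_eq B_def B_eq
      by (intro conjI step_function_moments_finite_rank[OF c(1) W c(2)]
          step_function_moments_finite_rank[OF c(1) U])
  qed
  have a: a if st: step
  proof -
    obtain c \<beta> where c: "finite_colouring c" "keq W (\<lambda>x y. \<beta> (c x) (c y))"
      using st unfolding step_def by blast
    obtain H where "is_bounded_weighted_graph d H" "\<forall>F. is_multigraph F \<longrightarrow> hom_density F W = t_weighted F H"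
      using weighted_graph_of_step_function[OF W sym bound c] by blast
    then show ?thesis unfolding a_def by (intro exI[of _ H]) (simp add: f)
  qed
  have M2: M2 if a
    using that finite_rank_M2_t_weighted unfolding a_def M2_def is_bounded_weighted_graph_def by blast
  have M2E: E if M2
    unfolding E_def
  proof (rule finite_rank_submatrix[OF that[unfolded M2_def]])
    show "labeled_parallel_edges i \<in> two_labeled" "labeled_parallel_edges i \<in> two_labeled" for i
      by (rule labeled_parallel_edges_two_labeled)+
    fix i j
    have "M2_matrix f (labeled_parallel_edges i) (labeled_parallel_edges j)
        = f (rename_nodes Suc (parallel_edges (i + j)))"
      by (simp only: M2_matrix_def glue_labeled_parallel_edges)
    also have "\<dots> = f (parallel_edges (i + j))"
      by (simp only: f is_multigraph_rename_nodes is_multigraph_parallel_edges inj_Suc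
          hom_density_rename_nodes[OF is_multigraph_parallel_edges inj_Suc W sym])
    finally show "E_matrix f i j = M2_matrix f (labeled_parallel_edges i) (labeled_parallel_edges j)"
      by (simp add: E_matrix_def)
  qed
  have M2C: C if M2
    unfolding C_def
  proof (rule finite_rank_submatrix[OF that[unfolded M2_def]])
    show "labeled_path 1 2 i \<in> two_labeled" if "i \<in> {1..}" for i
      using that by (intro labeled_path_two_labeled) auto
    show "labeled_path 2 1 i \<in> two_labeled" if "i \<in> {1..}" for i
      using that by (intro labeled_path_two_labeled) auto
    fix i j :: nat assume "i \<in> {1..}" "j \<in> {1..}"
    then have ij: "i \<ge> 1" "j \<ge> 1" by auto
    then have n: "i + j \<ge> 2" by simp
    obtain G where G: "inj_on G {..<i + j}"
        "glue (labeled_path 1 2 i) (labeled_path 2 1 j) = rename_nodes G (cycle_graph (i + j))"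
      using glue_labeled_paths[OF ij] by blast
    have G': "inj_on G (nodes (cycle_graph (i + j)))" using G(1) by (simp add: cycle_graph_def)
    note mg = is_multigraph_cycle_graph[OF n]
    have "M2_matrix f (labeled_path 1 2 i) (labeled_path 2 1 j) = f (rename_nodes G (cycle_graph (i + j)))"
      by (simp only: M2_matrix_def G(2))
    also have "\<dots> = f (cycle_graph (i + j))"
      by (simp only: f is_multigraph_rename_nodes[OF mg G'] mg hom_density_rename_nodes[OF mg G' W sym])
    finally show "C_matrix f i j = M2_matrix f (labeled_path 1 2 i) (labeled_path 2 1 j)"
      by (simp add: C_matrix_def)
  qed
  show ?thesis using CE CB EB a M2 M2E M2C by blast
qed

end

text \<open>Null sets of the plane, intersected with the unit square, are null sets for the product of the
  uniform measures on \<open>[0,1]\<close>.\<close>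

lemma AE_unit_square:
  fixes Q :: "real \<times> real \<Rightarrow> bool"
  defines "M \<equiv> restrict_space lborel {0..1 :: real}"
  assumes "AE p in (lborel :: (real \<times> real) measure). p \<in> {0..1} \<times> {0..1} \<longrightarrow> Q p"
  shows "AE p in M \<Otimes>\<^sub>M M. Q p"
proof -
  have prob: "prob_space M"
    unfolding M_def by (rule prob_space_restrict_space) auto
  interpret prob_space M by (rule prob)
  obtain N where N: "N \<in> null_sets (lborel :: (real \<times> real) measure)"
      "{p \<in> space lborel. \<not> (p \<in> {0..1} \<times> {0..1} \<longrightarrow> Q p)} \<subseteq> N"
    using assms(2) by (auto elim: AE_E3 simp: eventually_ae_filter)
  have "AE p in (lborel :: real measure) \<Otimes>\<^sub>M lborel. p \<notin> N"
    unfolding lborel_prod by (rule AE_not_in[OF N(1)])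
  then have "AE x in (lborel :: real measure). AE y in lborel. (x, y) \<notin> N"
    by (rule lborel_pair.AE_pair)
  moreover have restr: "AE z in M. P z" if "AE z in lborel. P z" for P
    unfolding M_def
  proof (subst AE_restrict_space_iff)
    show "AE z in lborel. z \<in> {0..1} \<longrightarrow> P z" using that by eventually_elim simp
  qed simp
  ultimately have "AE x in M. AE y in lborel. (x, y) \<notin> N" by blast
  then have ae: "AE x in M. AE y in M. (x, y) \<notin> N"
  proof eventually_elim
    case (elim x)
    then show ?case by (rule restr)
  qed
  have "{p \<in> space (M \<Otimes>\<^sub>M M). p \<notin> N} \<in> sets (M \<Otimes>\<^sub>M M)"
  proof -
    have "(\<lambda>p. p) \<in> measurable (M \<Otimes>\<^sub>M M) (lborel \<Otimes>\<^sub>M lborel)"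
      unfolding M_def
      by (rule measurable_pair) (auto simp: comp_def intro!: measurable_compose[OF measurable_fst] measurable_compose[OF measurable_snd] measurable_restrict_space1)
    moreover have "N \<in> sets ((lborel :: real measure) \<Otimes>\<^sub>M lborel)" using N(1) unfolding lborel_prod by auto
    ultimately have "(\<lambda>p. p) -` N \<inter> space (M \<Otimes>\<^sub>M M) \<in> sets (M \<Otimes>\<^sub>M M)" by (rule measurable_sets)
    then have "space (M \<Otimes>\<^sub>M M) - ((\<lambda>p. p) -` N \<inter> space (M \<Otimes>\<^sub>M M)) \<in> sets (M \<Otimes>\<^sub>M M)" by blast
    also have "space (M \<Otimes>\<^sub>M M) - ((\<lambda>p. p) -` N \<inter> space (M \<Otimes>\<^sub>M M)) = {p \<in> space (M \<Otimes>\<^sub>M M). p \<notin> N}" by auto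
    finally show ?thesis .
  qed
  from pair_sigma_finite.AE_pair_measure[OF pair_sigma_finite_self this ae] have "AE p in M \<Otimes>\<^sub>M M. p \<notin> N" .
  then show ?thesis
    using AE_space
  proof eventually_elim
    case (elim p)
    then have "p \<in> {0..1} \<times> {0..1}" by (auto simp: space_pair_measure M_def space_restrict_space)
    then show ?case using elim(1) N(2) by auto
  qed
qed

text \<open>A Borel measurable version of \<open>W\<close>, truncated to \<open>[-d, d]\<close> and then symmetrised, so that symmetry and
  bound hold everywhere rather than almost everywhere.\<close>

lemma symmetric_borel_representative:
  fixes W :: "real \<Rightarrow> real \<Rightarrow> real"
  defines "M \<equiv> restrict_space lborel {0..1 :: real}"
  assumes "d > 0" and meas: "(\<lambda>(x, y). W x y) \<in> borel_measurable (lebesgue_on ({0..1} \<times> {0..1}))"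
    and sym: "\<And>x y. x \<in> {0..1} \<Longrightarrow> y \<in> {0..1} \<Longrightarrow> W x y = W y x"
    and bound: "\<And>x y. x \<in> {0..1} \<Longrightarrow> y \<in> {0..1} \<Longrightarrow> W x y \<in> {-d..d}"
  shows "\<exists>V. prob_space.bkernel M V \<and> (\<forall>x y. V x y = V y x) \<and> (\<forall>x y. V x y \<in> {-d..d}) \<and>
     (AE p in M \<Otimes>\<^sub>M M. W (fst p) (snd p) = V (fst p) (snd p))"
proof -
  interpret prob_space M
    unfolding M_def by (rule prob_space_restrict_space) auto
  have spM: "space M = {0..1}" by (simp add: M_def space_restrict_space)
  let ?S = "{0..1 :: real} \<times> {0..1 :: real}"
  have S: "?S \<in> sets lebesgue"
    by (intro sets_completionI_sets) (auto simp: borel_Times)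
  have "(\<lambda>p. indicator ?S p *\<^sub>R (\<lambda>(x, y). W x y) p) \<in> borel_measurable lebesgue"
    using meas S by (subst (asm) borel_measurable_restrict_space_iff) auto
  then obtain g where g: "g \<in> borel_measurable lborel"
      "AE p in lborel. indicator ?S p *\<^sub>R (\<lambda>(x, y). W x y) p = g p"
    using completion_ex_borel_measurable_real by blast
  have "AE p in M \<Otimes>\<^sub>M M. W (fst p) (snd p) = g p"
    unfolding M_def
  proof (rule AE_unit_square)
    show "AE p in lborel. p \<in> ?S \<longrightarrow> W (fst p) (snd p) = g p"
      using g(2) by eventually_elim (auto simp: case_prod_beta')
  qed
  then have ae: "AE p in M \<Otimes>\<^sub>M M. W (fst p) (snd p) = (\<lambda>x y. g (x, y)) (fst p) (snd p)" by simp
  define h where "h = (\<lambda>x y. max (- d) (min d (g (x, y))))"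
  define V where "V = (\<lambda>x y. (h x y + h y x) / 2)"
  have "(\<lambda>p. p) \<in> measurable (M \<Otimes>\<^sub>M M) borel"
  proof -
    have "(\<lambda>p. p) \<in> measurable (M \<Otimes>\<^sub>M M) (borel \<Otimes>\<^sub>M borel)"
      unfolding M_def
      by (rule measurable_pair) (auto simp: comp_def intro!: measurable_compose[OF measurable_fst] measurable_compose[OF measurable_snd] measurable_restrict_space1)
    then show ?thesis by (simp only: borel_prod)
  qed
  from measurable_compose[OF this] g(1) have "g \<in> borel_measurable (M \<Otimes>\<^sub>M M)" by simp
  then have "(\<lambda>p. max (- d) (min d (g p))) \<in> borel_measurable (M \<Otimes>\<^sub>M M)" by measurable
  then have "bkernel h"
    unfolding h_def using \<open>d > 0\<close>
    by (intro kernelI bounded_measurableI[where C = d]) auto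
  have V: "bkernel V"
    using kernel_scale[OF kernel_add[OF \<open>bkernel h\<close> kernel_flip[OF \<open>bkernel h\<close>]], of "1/2"]
    by (simp add: V_def)
  have hd: "h x y \<in> {-d..d}" for x y using \<open>d > 0\<close> by (auto simp: h_def)
  have "AE p in M \<Otimes>\<^sub>M M. W (fst p) (snd p) = V (fst p) (snd p)"
    using ae AE_pair_swap[OF ae] AE_space
  proof eventually_elim
    case (elim p)
    then have p: "fst p \<in> {0..1}" "snd p \<in> {0..1}"
      by (auto simp: space_pair_measure spM)
    then have "h (fst p) (snd p) = W (fst p) (snd p)" "h (snd p) (fst p) = W (snd p) (fst p)"
      using elim(1,2) bound[OF p] bound[OF p(2,1)] by (auto simp: h_def)
    then show ?case using sym[OF p] by (simp add: V_def)
  qed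
  moreover have "V x y = V y x" for x y by (simp add: V_def add.commute)
  moreover have "V x y \<in> {-d..d}" for x y using hd[of x y] hd[of y x] by (auto simp: V_def)
  ultimately show ?thesis using V by blast
qed

theorem theorem3p7:
  fixes d :: real and W :: "real \<Rightarrow> real \<Rightarrow> real" and f :: "multigraph \<Rightarrow> real"
  assumes "d > 0"
    and "(\<lambda>(x, y). W x y) \<in> borel_measurable (lebesgue_on ({0..1} \<times> {0..1}))"
    and "\<And>x y. x \<in> {0..1} \<Longrightarrow> y \<in> {0..1} \<Longrightarrow> W x y = W y x"
    and "\<And>x y. x \<in> {0..1} \<Longrightarrow> y \<in> {0..1} \<Longrightarrow> W x y \<in> {-d..d}"
    and "f = (\<lambda>F. t_kernel F W)"
  shows
    "((\<exists>H. is_bounded_weighted_graph d H \<and> (\<forall>F. is_multigraph F \<longrightarrow> f F = t_weighted F H))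
        \<longleftrightarrow> finite_rank {1..} {1..} (C_matrix f) \<and> finite_rank UNIV UNIV (E_matrix f))
     \<and> (finite_rank {1..} {1..} (C_matrix f) \<and> finite_rank UNIV UNIV (E_matrix f)
        \<longleftrightarrow> finite_rank UNIV UNIV (B_matrix f) \<and> finite_rank {1..} {1..} (C_matrix f))
     \<and> (finite_rank UNIV UNIV (B_matrix f) \<and> finite_rank {1..} {1..} (C_matrix f)
        \<longleftrightarrow> finite_rank two_labeled two_labeled (M2_matrix f))"
proof -
  let ?M = "restrict_space lborel {0..1 :: real}"
  interpret prob_space ?M by (rule prob_space_restrict_space) auto
  obtain V where V: "bkernel V" "\<forall>x y. V x y = V y x" "\<forall>x y. V x y \<in> {-d..d}"
      "AE p in ?M \<Otimes>\<^sub>M ?M. W (fst p) (snd p) = V (fst p) (snd p)"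
    using symmetric_borel_representative[OF assms(1-4)] by blast
  have f: "f F = hom_density F V" if "is_multigraph F" for F
    unfolding assms(5) t_kernel_def by (rule integral_completion_eq_hom_density[OF that V(1,4)])
  show ?thesis
    by (rule hom_density_equivalences[OF V(1) _ _ f]) (use V(2,3) in auto)
qed

end
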